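(* Let $\pmb\lambda$ be a $d$-tuple of partitions of $m$ with $\ell(\lambda^{(i)})\le n$ and $\lambda^{(i)}_1\le n$ for all $i$. (i) For odd $d$, let $\Delta:\mathrm{WV}_{\pmb\lambda'}\bigwedge V\to\bigvee V$ be the linear map with $\bigwedge e_T\mapsto\Delta_T$ for $T\in B^{\mathrm{lex}}(\pmb\lambda')$, and $\nabla:\mathrm{WV}_{\pmb\lambda'}\bigvee V\to\bigwedge V$ the linear map with $\bigvee e_S\mapsto\nabla_S$ for $S\in A^{\mathrm{lex}}(\pmb\lambda')$. Then $\Delta$ maps onto $\mathrm{HWV}_{\pmb\lambda}\bigvee V$, $\nabla$ maps onto $\mathrm{HWV}_{\pmb\lambda}\bigwedge V$, and the restrictions $$\Delta:\mathrm{HWV}_{\pmb\lambda'}\textstyle\bigwedge V\to\mathrm{HWV}_{\pmb\lambda}\bigvee V,\qquad \nabla:\mathrm{HWV}_{\pmb\lambda'}\bigvee V\to\mathrm{HWV}_{\pmb\lambda}\bigwedge V$$ are isomorphisms. (ii) For even $d$, let $\Delta:\mathrm{WV}_{\pmb\lambda'}\bigvee V\to\bigvee V$ be the linear map with $\bigvee e_S\mapsto\Delta_S$ for $S\in A^{\mathrm{lex}}(\pmb\lambda')$, and $\nabla:\mathrm{WV}_{\pmb\lambda'}\bigwedge V\to\bigwedge V$ the linear map with $\bigwedge e_T\mapsto\nabla_T$ for $T\in B^{\mathrm{lex}}(\pmb\lambda')$. Then $\Delta$ maps onto $\mathrm{HWV}_{\pmb\lambda}\bigvee V$, $\nabla$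 maps onto $\mathrm{HWV}_{\pmb\lambda}\bigwedge V$, and the restrictions $$\Delta:\mathrm{HWV}_{\pmb\lambda'}\textstyle\bigvee V\to\mathrm{HWV}_{\pmb\lambda}\bigvee V,\qquad\nabla:\mathrm{HWV}_{\pmb\lambda'}\bigwedge V\to\mathrm{HWV}_{\pmb\lambda}\bigwedge V$$ are isomorphisms.
   Context: Integers $d,n\ge1$, $m\ge0$; $[r]=\{1,\dots,r\}$. $V=(\mathbb C^n)^{\otimes d}$ with basis $e_{\mathbf i}=e_{i_1}\otimes\cdots\otimes e_{i_d}$, $\mathbf i\in[n]^d$. $\bigvee V$ is the symmetric algebra (polynomial ring in commuting variables $e_{\mathbf i}$, product $\vee$), $\bigwedge V$ the exterior algebra. $G=\mathrm{GL}(n,\mathbb C)^{\times d}$ acts on $V$ factorwise and on $\bigvee V,\bigwedge V$ by algebra automorphisms. For a $d$-tuple $\pmb\alpha$ of vectors in $\mathbb Z^n_{\ge0}$, $\mathrm{WV}_{\pmb\alpha}W$ is the weight space of weight $\pmb\alpha$ for the torus of $d$-tuples of diagonal matrices, and $\mathrm{HWV}_{\pmb\alpha}W$ the subspace of it fixed by $U(n)^{\times d}$ ($U(n)$ upper unitriangular). Partitions of length $\le n$ are viewed as vectors in $\mathbb Z^n_{\ge 0}$; $\pmb\lambda'$ is the componentwise conjugate. Words/tables: for a sequence $\alpha$ of nonnegative integers with sum $m$, $A(\alpha)$ is the set of words of length $m$ in which letter $i$ occurs $\alpha_i$ times; $A(\pmb\alpha)=A(\alpha^{(1)})\times\cdots\times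 A(\alpha^{(d)})$, viewed as $d\times m$ tables with columns $S(1),\dots,S(m)$; $B(\pmb\alpha)$: tables with pairwise distinct columns; $A^{\mathrm{lex}},B^{\mathrm{lex}}$: those with columns weakly increasing lexicographically. $\|T\|=\prod_{\mathbf c}(\#\{j:T(j)=\mathbf c\})!$. $\bigvee e_S=e_{S(1)}\vee\cdots\vee e_{S(m)}$, $\bigwedge e_S=e_{S(1)}\wedge\cdots\wedge e_{S(m)}$; $\{\bigvee e_S:S\in A^{\mathrm{lex}}(\pmb\alpha)\}$, $\{\bigwedge e_S:S\in B^{\mathrm{lex}}(\pmb\alpha)\}$ are bases of the weight-$\pmb\alpha$ spaces. Signs: $(-1)^w=(-1)^{\#\{i<j:w_i>w_j\}}$ for a word $w$; $(-1)^T=\prod_i(-1)^{t_i}$ over rows $t_i$. For words $s,x$ of length $m$, $\mathrm{sgn}_s(x)=\prod_c\mathrm{sgn}(x_{b_1},\dots,x_{b_k})$ over letters $c$ of $s$ with positions $b_1<\dots<b_k$, where $\mathrm{sgn}(a_1,\dots,a_k)$ is the permutation sign if $(a_1,\dots,a_k)$ is a permutation of $[k]$ and $0$ otherwise; $\mathrm{sgn}_T(X)=\prod_i\mathrm{sgn}_{t_i}(x_i)$. Vectors: for a $d\times m$ table $T$ of positive integers, $\Delta_T=\frac{(-1)^T}{\|T\|}\sum_X\mathrm{sgn}_T(X)\bigvee e_X$ and $\nabla_T=\frac{(-1)^T}{\|T\|}\sum_X\mathrm{sgn}_T(X)\bigwedge e_X$, sums over all $d\times m$ tables $X$ with entries in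 $[n]$. *)

theory Defs
  imports
    Complex_Main
    "HOL-Library.Multiset"
    "HOL-Library.FSet"
    "HOL-Library.Poly_Mapping"
    "HOL-Library.List_Lexorder"
    "HOL-Combinatorics.Permutations"
    "Jordan_Normal_Form.Matrix"
begin

section \<open>Free complex vector spaces\<close>

text \<open>
  The type \<^typ>\<open>'a \<Rightarrow>\<^sub>0 complex\<close> of finitely supported functions is the complex vector space with
  basis \<open>single k 1\<close>.
\<close>

definition scale :: "complex \<Rightarrow> ('a \<Rightarrow>\<^sub>0 complex) \<Rightarrow> ('a \<Rightarrow>\<^sub>0 complex)" where
  "scale c x = Poly_Mapping.map (\<lambda>z. c * z) x"

text \<open>The linear map given by its values on the basis.\<close>

definition lin_ext :: "('a \<Rightarrow> ('b \<Rightarrow>\<^sub>0 complex)) \<Rightarrow> ('a \<Rightarrow>\<^sub>0 complex) \<Rightarrow> ('b \<Rightarrow>\<^sub>0 complex)" where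
  "lin_ext f x = (\<Sum>k\<in>Poly_Mapping.keys x. scale (Poly_Mapping.lookup x k) (f k))"

definition linear_on ::
    "('a \<Rightarrow>\<^sub>0 complex) set \<Rightarrow> (('a \<Rightarrow>\<^sub>0 complex) \<Rightarrow> ('b \<Rightarrow>\<^sub>0 complex)) \<Rightarrow> bool" where
  "linear_on W f \<longleftrightarrow>
     (\<forall>x\<in>W. \<forall>y\<in>W. f (x + y) = f x + f y) \<and> (\<forall>c. \<forall>x\<in>W. f (scale c x) = scale c (f x))"

definition linear_iso_on ::
    "(('a \<Rightarrow>\<^sub>0 complex) \<Rightarrow> ('b \<Rightarrow>\<^sub>0 complex)) \<Rightarrow> ('a \<Rightarrow>\<^sub>0 complex) set \<Rightarrow> ('b \<Rightarrow>\<^sub>0 complex) set \<Rightarrow> bool" where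
  "linear_iso_on f W W' \<longleftrightarrow> linear_on W f \<and> bij_betw f W W'"

lemma lookup_scale [simp]: "Poly_Mapping.lookup (scale c x) k = c * Poly_Mapping.lookup x k"
  by (simp add: scale_def Poly_Mapping.map.rep_eq when_def)

interpretation free_vs: vector_space "scale :: complex \<Rightarrow> ('a \<Rightarrow>\<^sub>0 complex) \<Rightarrow> ('a \<Rightarrow>\<^sub>0 complex)"
  by standard (auto intro!: poly_mapping_eqI simp: lookup_add algebra_simps)

lemma lin_ext_superset:
  assumes "finite K" "Poly_Mapping.keys x \<subseteq> K"
  shows "lin_ext f x = (\<Sum>k\<in>K. scale (Poly_Mapping.lookup x k) (f k))"
  unfolding lin_ext_def using assms
  by (intro sum.mono_neutral_left) (auto simp: in_keys_iff)

lemma lin_ext_add [simp]: "lin_ext f (x + y) = lin_ext f x + lin_ext f y"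
proof -
  let ?K = "Poly_Mapping.keys x \<union> Poly_Mapping.keys y"
  have "Poly_Mapping.keys (x + y) \<subseteq> ?K" by (rule keys_add)
  then show ?thesis
    by (simp add: lin_ext_superset[of ?K] lookup_add free_vs.scale_left_distrib sum.distrib)
qed

lemma lin_ext_scale [simp]: "lin_ext f (scale c x) = scale c (lin_ext f x)"
proof -
  have "Poly_Mapping.keys (scale c x) \<subseteq> Poly_Mapping.keys x" by (auto simp: in_keys_iff)
  then show ?thesis
    by (simp add: lin_ext_superset[of "Poly_Mapping.keys x"] free_vs.scale_sum_right)
qed

lemma lin_ext_zero [simp]: "lin_ext f 0 = 0"
  by (simp add: lin_ext_def)

lemma lin_ext_sum [simp]: "lin_ext f (\<Sum>i\<in>I. x i) = (\<Sum>i\<in>I. lin_ext f (x i))"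
  by (induction I rule: infinite_finite_induct) auto

lemma lin_ext_single [simp]: "lin_ext f (Poly_Mapping.single k c) = scale c (f k)"
  by (simp add: lin_ext_def)

lemma scale_single [simp]: "scale c (Poly_Mapping.single k b) = Poly_Mapping.single k (c * b)"
  by (auto intro!: poly_mapping_eqI simp: lookup_single when_def)

lemma sum_singles: "(\<Sum>k\<in>Poly_Mapping.keys x. Poly_Mapping.single k (Poly_Mapping.lookup x k)) = (x :: 'a \<Rightarrow>\<^sub>0 complex)"
  by (intro poly_mapping_eqI) (auto simp: lookup_sum lookup_single when_def in_keys_iff)

lemma lin_ext_fun_add: "lin_ext (\<lambda>k. f k + g k) x = lin_ext f x + lin_ext g x"
  by (simp add: lin_ext_def free_vs.scale_right_distrib sum.distrib)

lemma lin_ext_fun_scale: "lin_ext (\<lambda>k. scale c (f k)) x = scale c (lin_ext f x)"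
  by (simp add: lin_ext_def free_vs.scale_sum_right mult.commute)

text \<open>Two additive, homogeneous maps agree if they agree on the basis.\<close>

lemma free_eqI:
  assumes "\<And>x y. F (x + y) = F x + F y" "\<And>c x. F (scale c x) = scale c (F x)"
    and "\<And>x y. G (x + y) = G x + G y" "\<And>c x. G (scale c x) = scale c (G x)"
    and "\<And>k. F (Poly_Mapping.single k 1) = G (Poly_Mapping.single k 1)"
  shows "F x = (G x :: 'b \<Rightarrow>\<^sub>0 complex)"
proof -
  have "F (\<Sum>k\<in>K. scale (c k) (Poly_Mapping.single k 1)) = G (\<Sum>k\<in>K. scale (c k) (Poly_Mapping.single k 1))"
    if "finite K" for K c
    using that
  proof (induction K rule: finite_induct)
    case empty
    show ?case using assms(2)[of 0 0] assms(4)[of 0 0] by simp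
  next
    case (insert k K)
    then show ?case by (simp only: sum.insert assms not_False_eq_True)
  qed
  from this[of "Poly_Mapping.keys x" "Poly_Mapping.lookup x"] show ?thesis
    by (simp add: sum_singles)
qed

section \<open>The space V, its symmetric algebra and its exterior algebra\<close>

text \<open>
  A multi-index in $[n]^d$ is a list of length \<open>d\<close> with entries in \<open>{1..n}\<close>. The space
  $V = (\mathbb{C}^n)^{\otimes d}$ is the span of the basis vectors indexed by \<open>multi_idx d n\<close>
  in \<^typ>\<open>nat list \<Rightarrow>\<^sub>0 complex\<close>.
\<close>

definition multi_idx :: "nat \<Rightarrow> nat \<Rightarrow> nat list set" where
  "multi_idx d n = {c. length c = d \<and> set c \<subseteq> {1..n}}"

text \<open>
  Polynomials in commuting variables indexed by \<open>'a\<close>: monomials are multisets of variables, and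
  the product is the ring multiplication that \<^theory>\<open>HOL-Library.Poly_Mapping\<close> provides.
\<close>

type_synonym 'a sym_alg = "'a multiset \<Rightarrow>\<^sub>0 complex"

definition sym_incl :: "('a \<Rightarrow>\<^sub>0 complex) \<Rightarrow> 'a sym_alg" where
  "sym_incl = lin_ext (\<lambda>i. Poly_Mapping.single {#i#} 1)"

definition sym_mon :: "'a list \<Rightarrow> 'a sym_alg" where
  "sym_mon S = prod_list (map (\<lambda>i. sym_incl (Poly_Mapping.single i 1)) S)"

text \<open>
  The exterior algebra of the space with ordered basis \<open>'a\<close>: the basis vector of a finite set
  \<open>A = {a\<^sub>1 < \<dots> < a\<^sub>k}\<close> stands for $a_1 \wedge \dots \wedge a_k$. The product of the basis
  vectors of \<open>A\<close> and \<open>B\<close> is zero if they meet, and otherwise the basis vector of their union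
  with the sign of the permutation that sorts the concatenation.
\<close>

type_synonym 'a ext_alg = "'a fset \<Rightarrow>\<^sub>0 complex"

definition inv_pairs :: "'a::linorder fset \<Rightarrow> 'a fset \<Rightarrow> ('a \<times> 'a) set" where
  "inv_pairs A B = {(a, b). a |\<in>| A \<and> b |\<in>| B \<and> b < a}"

definition wedge_sign :: "'a::linorder fset \<Rightarrow> 'a fset \<Rightarrow> complex" where
  "wedge_sign A B = (if A |\<inter>| B = {||} then (- 1) ^ card (inv_pairs A B) else 0)"

definition wedge :: "'a::linorder ext_alg \<Rightarrow> 'a ext_alg \<Rightarrow> 'a ext_alg" where
  "wedge x y =
     lin_ext (\<lambda>A. lin_ext (\<lambda>B. Poly_Mapping.single (A |\<union>| B) (wedge_sign A B)) y) x"

definition ext_one :: "'a ext_alg" where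
  "ext_one = Poly_Mapping.single {||} 1"

definition wedge_list :: "'a::linorder ext_alg list \<Rightarrow> 'a ext_alg" where
  "wedge_list xs = foldr wedge xs ext_one"

definition ext_incl :: "('a \<Rightarrow>\<^sub>0 complex) \<Rightarrow> 'a ext_alg" where
  "ext_incl = lin_ext (\<lambda>i. Poly_Mapping.single {|i|} 1)"

definition ext_mon :: "'a::linorder list \<Rightarrow> 'a ext_alg" where
  "ext_mon S = wedge_list (map (\<lambda>i. ext_incl (Poly_Mapping.single i 1)) S)"

definition sym_V :: "nat \<Rightarrow> nat \<Rightarrow> nat list sym_alg set" where
  "sym_V d n = {x. \<forall>M\<in>Poly_Mapping.keys x. set_mset M \<subseteq> multi_idx d n}"

definition ext_V :: "nat \<Rightarrow> nat \<Rightarrow> nat list ext_alg set" where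
  "ext_V d n = {x. \<forall>A\<in>Poly_Mapping.keys x. fset A \<subseteq> multi_idx d n}"

lemma inv_pairs_finite [simp]: "finite (inv_pairs A B)"
  by (rule finite_subset[of _ "fset A \<times> fset B"]) (auto simp: inv_pairs_def)

lemma card_inv_pairs_union_left:
  "A |\<inter>| B = {||} \<Longrightarrow> card (inv_pairs (A |\<union>| B) C) = card (inv_pairs A C) + card (inv_pairs B C)"
  by (subst card_Un_disjoint[symmetric])
     (simp_all, auto simp: inv_pairs_def intro!: arg_cong[where f = card])

lemma card_inv_pairs_union_right:
  "B |\<inter>| C = {||} \<Longrightarrow> card (inv_pairs A (B |\<union>| C)) = card (inv_pairs A B) + card (inv_pairs A C)"
  by (subst card_Un_disjoint[symmetric])
     (simp_all, auto simp: inv_pairs_def intro!: arg_cong[where f = card])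

lemma wedge_sign_cocycle:
  "wedge_sign A B * wedge_sign (A |\<union>| B) C = wedge_sign B C * wedge_sign A (B |\<union>| C)"
proof (cases "A |\<inter>| B = {||} \<and> A |\<inter>| C = {||} \<and> B |\<inter>| C = {||}")
  case True
  then have "(A |\<union>| B) |\<inter>| C = {||}" "A |\<inter>| (B |\<union>| C) = {||}" by auto
  with True show ?thesis
    by (simp add: wedge_sign_def card_inv_pairs_union_left card_inv_pairs_union_right power_add)
next
  case False
  then have "A |\<inter>| B \<noteq> {||} \<or> (A |\<union>| B) |\<inter>| C \<noteq> {||}" "B |\<inter>| C \<noteq> {||} \<or> A |\<inter>| (B |\<union>| C) \<noteq> {||}"
    by auto
  then have "wedge_sign A B * wedge_sign (A |\<union>| B) C = 0" "wedge_sign B C * wedge_sign A (B |\<union>| C) = 0"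
    unfolding wedge_sign_def mult_eq_0_iff by metis+
  then show ?thesis by (simp only:)
qed

lemma wedge_add_left: "wedge (x + y) z = wedge x z + wedge y z"
  and wedge_scale_left: "wedge (scale c x) z = scale c (wedge x z)"
  and wedge_add_right: "wedge z (x + y) = wedge z x + wedge z y"
  and wedge_scale_right: "wedge z (scale c x) = scale c (wedge z x)"
  by (simp_all add: wedge_def lin_ext_fun_add lin_ext_fun_scale)

lemmas wedge_linear = wedge_add_left wedge_scale_left wedge_add_right wedge_scale_right

lemma wedge_zero [simp]: "wedge 0 x = 0" "wedge x 0 = 0"
  using wedge_scale_left[of 0 0 x] wedge_scale_right[of x 0 0] by auto

lemma wedge_single:
  "wedge (Poly_Mapping.single A 1) (Poly_Mapping.single B 1) = Poly_Mapping.single (A |\<union>| B) (wedge_sign A B)"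
  by (simp add: wedge_def)

lemma wedge_one_left [simp]: "wedge ext_one x = x"
  by (rule free_eqI[where F = "wedge ext_one" and G = "\<lambda>x. x"])
     (simp_all add: wedge_linear ext_one_def wedge_single wedge_sign_def inv_pairs_def)

lemma wedge_one_right [simp]: "wedge x ext_one = x"
  by (rule free_eqI[where F = "\<lambda>x. wedge x ext_one" and G = "\<lambda>x. x"])
     (simp_all add: wedge_linear ext_one_def wedge_single wedge_sign_def inv_pairs_def)

lemma wedge_assoc: "wedge (wedge x y) z = wedge x (wedge y z)"
proof -
  let ?s = "\<lambda>A. Poly_Mapping.single A (1::complex)"
  have s: "Poly_Mapping.single A c = scale c (?s A)" for A :: "'a fset" and c by simp
  have basis: "wedge (wedge (?s A) (?s B)) (?s C) = wedge (?s A) (wedge (?s B) (?s C))"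
    for A B C :: "'a fset"
    using wedge_sign_cocycle[of A B C]
    by (simp add: wedge_single s[of _ "wedge_sign _ _"] wedge_linear funion_assoc mult.commute del: scale_single)
  have 1: "wedge (wedge (?s A) (?s B)) z = wedge (?s A) (wedge (?s B) z)" for A B
    by (rule free_eqI[where F = "\<lambda>z. wedge (wedge (?s A) (?s B)) z"]) (simp_all only: wedge_linear basis)
  have 2: "wedge (wedge (?s A) y) z = wedge (?s A) (wedge y z)" for A
    by (rule free_eqI[where F = "\<lambda>y. wedge (wedge (?s A) y) z"]) (simp_all only: wedge_linear 1)
  show ?thesis
    by (rule free_eqI[where F = "\<lambda>x. wedge (wedge x y) z"]) (simp_all only: wedge_linear 2)
qed

lemma ext_incl_anticommute: "wedge (ext_incl v) (ext_incl w) = - wedge (ext_incl w) (ext_incl v)"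
proof -
  let ?s = "\<lambda>i. Poly_Mapping.single i (1::complex)"
  have add: "ext_incl (x + y) = ext_incl x + ext_incl y" and scale: "ext_incl (scale c x) = scale c (ext_incl x)"
    for x y :: "'a \<Rightarrow>\<^sub>0 complex" and c
    by (simp_all add: ext_incl_def)
  have basis: "wedge (ext_incl (?s i)) (ext_incl (?s j)) = - wedge (ext_incl (?s j)) (ext_incl (?s i))" for i j :: 'a
  proof -
    have "inv_pairs {|i|} {|j|} = (if j < i then {(i, j)} else {})" for i j :: 'a
      by (auto simp: inv_pairs_def)
    then show ?thesis
      by (cases i j rule: linorder_cases)
         (auto simp: ext_incl_def wedge_single wedge_sign_def single_uminus finsert_commute)
  qed
  have 1: "wedge (ext_incl (?s i)) (ext_incl w) = - wedge (ext_incl w) (ext_incl (?s i))" for i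
    by (rule free_eqI[where F = "\<lambda>w. wedge (ext_incl (?s i)) (ext_incl w)"])
       (simp_all add: add scale wedge_linear, rule basis)
  show ?thesis
    by (rule free_eqI[where F = "\<lambda>v. wedge (ext_incl v) (ext_incl w)"])
       (simp_all add: add scale wedge_linear, rule 1)
qed

lemma ext_incl_square: "wedge (ext_incl v) (ext_incl v) = 0"
proof -
  let ?x = "wedge (ext_incl v) (ext_incl v)"
  have "Poly_Mapping.lookup ?x k = 0" for k
    using arg_cong[OF ext_incl_anticommute[of v v], of "\<lambda>x. Poly_Mapping.lookup x k"] by simp
  then show ?thesis by (intro poly_mapping_eqI) simp
qed

section \<open>The group action, weight vectors and highest weight vectors\<close>

text \<open>
  A $d$-tuple of matrices is a list of length \<open>d\<close>. Letters count from 1 and matrix positions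
  from 0.
\<close>

definition GL :: "nat \<Rightarrow> complex mat set" where
  "GL n = {A \<in> carrier_mat n n. invertible_mat A}"

definition torus :: "nat \<Rightarrow> nat \<Rightarrow> complex mat list set" where
  "torus d n = {g. length g = d \<and> (\<forall>A\<in>set g. A \<in> GL n \<and> diagonal_mat A)}"

definition unitri :: "nat \<Rightarrow> nat \<Rightarrow> complex mat list set" where
  "unitri d n = {g. length g = d \<and>
     (\<forall>A\<in>set g. A \<in> GL n \<and> upper_triangular A \<and> (\<forall>i<n. A $$ (i, i) = 1))}"

text \<open>
  The image of the basis vector $e_{\mathbf i}$ of $V$, namely
  $g_1 e_{i_1} \otimes \dots \otimes g_d e_{i_d}$ expanded in the basis.
\<close>

definition act_basis :: "nat \<Rightarrow> nat \<Rightarrow> complex mat list \<Rightarrow> nat list \<Rightarrow> (nat list \<Rightarrow>\<^sub>0 complex)" where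
  "act_basis d n g i =
     (\<Sum>j\<in>multi_idx d n. Poly_Mapping.single j (\<Prod>k<d. (g ! k) $$ (j ! k - 1, i ! k - 1)))"

text \<open>The extensions to algebra endomorphisms of the symmetric and the exterior algebra.\<close>

definition sym_act :: "nat \<Rightarrow> nat \<Rightarrow> complex mat list \<Rightarrow> nat list sym_alg \<Rightarrow> nat list sym_alg" where
  "sym_act d n g = lin_ext (\<lambda>M. \<Prod>i\<in>#M. sym_incl (act_basis d n g i))"

definition ext_act :: "nat \<Rightarrow> nat \<Rightarrow> complex mat list \<Rightarrow> nat list ext_alg \<Rightarrow> nat list ext_alg" where
  "ext_act d n g =
     lin_ext (\<lambda>A. wedge_list (map (\<lambda>i. ext_incl (act_basis d n g i)) (sorted_list_of_fset A)))"

definition weight_char :: "nat \<Rightarrow> nat \<Rightarrow> nat list list \<Rightarrow> complex mat list \<Rightarrow> complex" where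
  "weight_char d n \<alpha> t = (\<Prod>k<d. \<Prod>i<n. ((t ! k) $$ (i, i)) ^ (\<alpha> ! k ! i))"

definition WV_sym :: "nat \<Rightarrow> nat \<Rightarrow> nat list list \<Rightarrow> nat list sym_alg set" where
  "WV_sym d n \<alpha> = {x \<in> sym_V d n. \<forall>t\<in>torus d n. sym_act d n t x = scale (weight_char d n \<alpha> t) x}"

definition WV_ext :: "nat \<Rightarrow> nat \<Rightarrow> nat list list \<Rightarrow> nat list ext_alg set" where
  "WV_ext d n \<alpha> = {x \<in> ext_V d n. \<forall>t\<in>torus d n. ext_act d n t x = scale (weight_char d n \<alpha> t) x}"

definition HWV_sym :: "nat \<Rightarrow> nat \<Rightarrow> nat list list \<Rightarrow> nat list sym_alg set" where
  "HWV_sym d n \<alpha> = {x \<in> WV_sym d n \<alpha>. \<forall>u\<in>unitri d n. sym_act d n u x = x}"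

definition HWV_ext :: "nat \<Rightarrow> nat \<Rightarrow> nat list list \<Rightarrow> nat list ext_alg set" where
  "HWV_ext d n \<alpha> = {x \<in> WV_ext d n \<alpha>. \<forall>u\<in>unitri d n. ext_act d n u x = x}"

lemma scale_mult_left: "scale c (x :: 'a sym_alg) * y = scale c (x * y)"
  and scale_mult_right: "x * scale c (y :: 'a sym_alg) = scale c (x * y)"
proof -
  have *: "scale c z = Poly_Mapping.single 0 c * z" for z :: "'a sym_alg"
    unfolding scale_def by (rule mult_map_scale_conv_mult)
  show "scale c x * y = scale c (x * y)" "x * scale c y = scale c (x * y)"
    by (simp_all only: * ac_simps)
qed

lemma sym_act_mult: "sym_act d n g (x * y) = sym_act d n g x * sym_act d n g y"
proof -
  let ?F = "sym_act d n g" and ?s = "\<lambda>A. Poly_Mapping.single A (1::complex)"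
  have 1: "?F (?s A * y) = ?F (?s A) * ?F y" for A
    by (rule free_eqI[where F = "\<lambda>y. ?F (?s A * y)"])
       (simp_all add: sym_act_def distrib_left scale_mult_right mult_single)
  show ?thesis
    by (rule free_eqI[where F = "\<lambda>x. ?F (x * y)"])
       (simp_all add: 1, simp_all add: sym_act_def distrib_right scale_mult_left)
qed

lemma wedge_list_Cons: "wedge_list (x # xs) = wedge x (wedge_list xs)"
  by (simp add: wedge_list_def)

lemma wedge_insort:
  assumes "sorted L" "distinct L"
  shows "wedge (ext_incl (v a)) (wedge_list (map (\<lambda>i. ext_incl (v i)) L)) =
    (if a \<in> set L then 0 else
       scale ((- 1) ^ length (filter (\<lambda>b. b < a) L)) (wedge_list (map (\<lambda>i. ext_incl (v i)) (insort a L))))"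
  using assms
proof (induction L)
  case Nil
  then show ?case by (simp add: wedge_list_def)
next
  case (Cons b L)
  let ?P = "\<lambda>L. wedge_list (map (\<lambda>i. ext_incl (v i)) L)"
  note P = wedge_list_Cons
  show ?case
  proof (cases a b rule: linorder_cases)
    case less
    then have "filter (\<lambda>c. c < a) (b # L) = []" "a \<notin> set (b # L)" using Cons.prems
      by (auto simp: filter_empty_conv)
    with less show ?thesis by (auto simp: P)
  next
    case equal
    then show ?thesis by (simp add: P wedge_assoc[symmetric] ext_incl_square)
  next
    case greater
    have "wedge (ext_incl (v a)) (?P (b # L)) = scale (- 1) (wedge (ext_incl (v b)) (wedge (ext_incl (v a)) (?P L)))"
      by (subst list.map, subst P, subst wedge_assoc[symmetric], subst ext_incl_anticommute, subst wedge_assoc[symmetric])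
         (metis free_vs.scale_minus_left free_vs.scale_one wedge_scale_left)
    with greater Cons show ?thesis by (auto simp: wedge_linear P)
  qed
qed

lemma wedge_sign_singleton: "wedge_sign {|a|} B = (if a |\<in>| B then 0 else (- 1) ^ card {b. b |\<in>| B \<and> b < a})"
proof -
  have "inv_pairs {|a|} B = Pair a ` {b. b |\<in>| B \<and> b < a}" by (auto simp: inv_pairs_def)
  then show ?thesis by (auto simp: wedge_sign_def card_image inj_on_def)
qed

lemma wedge_sign_min:
  assumes "\<And>b. b |\<in>| B \<Longrightarrow> a < b"
  shows "wedge_sign {|a|} B = 1"
proof -
  have "a |\<notin>| B" and "{b. b |\<in>| B \<and> b < a} = {}" using assms by force+
  then show ?thesis by (simp only: wedge_sign_singleton if_False card.empty power_0)
qed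

lemma wedge_insert_fset:
  "wedge (ext_incl (v a)) (wedge_list (map (\<lambda>i. ext_incl (v i)) (sorted_list_of_fset B))) =
     scale (wedge_sign {|a|} B) (wedge_list (map (\<lambda>i. ext_incl (v i)) (sorted_list_of_fset (finsert a B))))"
proof -
  have "length (filter (\<lambda>b. b < a) (sorted_list_of_fset B)) = card {b. b |\<in>| B \<and> b < a}"
    by (subst distinct_card[symmetric]) (auto simp: sorted_list_of_fset.rep_eq intro!: arg_cong[where f = card])
  then show ?thesis
    by (subst wedge_insort)
       (auto simp: sorted_list_of_fset.rep_eq wedge_sign_singleton)
qed

lemma wedge_fset:
  "wedge (wedge_list (map (\<lambda>i. ext_incl (v i)) (sorted_list_of_fset A)))
         (wedge_list (map (\<lambda>i. ext_incl (v i)) (sorted_list_of_fset B))) =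
     scale (wedge_sign A B) (wedge_list (map (\<lambda>i. ext_incl (v i)) (sorted_list_of_fset (A |\<union>| B))))"
proof -
  let ?P = "\<lambda>A. wedge_list (map (\<lambda>i. ext_incl (v i)) (sorted_list_of_fset A))"
  have "\<forall>A. fset A = S \<longrightarrow> wedge (?P A) (?P B) = scale (wedge_sign A B) (?P (A |\<union>| B))"
    if "finite S" for S
    using that
  proof (induction S rule: finite_linorder_min_induct)
    case empty
    have "?P {||} = ext_one" by (simp add: sorted_list_of_fset.rep_eq wedge_list_def)
    moreover have "wedge_sign {||} B = 1" by (simp add: wedge_sign_def inv_pairs_def)
    ultimately show ?case by (metis bot_fset.rep_eq fset_inject free_vs.scale_one sup_bot_left wedge_one_left)
  next
    case (insert a S)
    obtain A' where A': "fset A' = S" using insert.hyps(1) by (metis fset_cases mem_Collect_eq Abs_fset_inverse)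
    have one: "wedge_sign {|a|} A' = 1" using insert.hyps A' by (intro wedge_sign_min) auto
    have "wedge (?P (finsert a A')) (?P B) = wedge (ext_incl (v a)) (wedge (?P A') (?P B))"
      using wedge_insert_fset[of v a A'] by (simp add: one wedge_assoc[symmetric])
    also have "\<dots> = scale (wedge_sign A' B * wedge_sign {|a|} (A' |\<union>| B)) (?P (finsert a A' |\<union>| B))"
      using insert.IH A' by (simp add: wedge_linear wedge_insert_fset)
    also have "wedge_sign A' B * wedge_sign {|a|} (A' |\<union>| B) = wedge_sign (finsert a A') B"
      using wedge_sign_cocycle[of "{|a|}" A' B] by (simp add: one)
    finally have "wedge (?P (finsert a A')) (?P B) = scale (wedge_sign (finsert a A') B) (?P (finsert a A' |\<union>| B))" .
    then show ?case using A' by (metis finsert.rep_eq fset_inject)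
  qed
  from this[of "fset A"] show ?thesis by simp
qed

lemma ext_act_wedge: "ext_act d n g (wedge x y) = wedge (ext_act d n g x) (ext_act d n g y)"
proof -
  let ?F = "ext_act d n g" and ?s = "\<lambda>A. Poly_Mapping.single A (1::complex)"
  have add: "?F (x + y) = ?F x + ?F y" and scale: "?F (scale c x) = scale c (?F x)" for x y c
    by (simp_all add: ext_act_def)
  have 0: "?F (wedge (?s A) (?s B)) = wedge (?F (?s A)) (?F (?s B))" for A B
    by (simp add: wedge_single ext_act_def wedge_fset)
  have 1: "?F (wedge (?s A) y) = wedge (?F (?s A)) (?F y)" for A
    by (rule free_eqI[where F = "\<lambda>y. ?F (wedge (?s A) y)"]) (simp_all only: add scale wedge_linear 0)
  show ?thesis
    by (rule free_eqI[where F = "\<lambda>x. ?F (wedge x y)"]) (simp_all only: add scale wedge_linear 1)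
qed

section \<open>Partitions, words and tables\<close>

definition is_partition :: "nat \<Rightarrow> nat list \<Rightarrow> bool" where
  "is_partition m l \<longleftrightarrow> sorted_wrt (\<ge>) l \<and> (\<forall>a\<in>set l. 0 < a) \<and> sum_list l = m"

definition first_part :: "nat list \<Rightarrow> nat" where
  "first_part l = (if l = [] then 0 else hd l)"

definition conj_part :: "nat list \<Rightarrow> nat list" where
  "conj_part l = map (\<lambda>j. length (filter (\<lambda>a. j \<le> a) l)) [1..<Suc (first_part l)]"

definition part_vec :: "nat \<Rightarrow> nat list \<Rightarrow> nat list" where
  "part_vec n l = l @ replicate (n - length l) 0"

definition words :: "nat list \<Rightarrow> nat list set" where
  "words \<alpha> = {w. length w = sum_list \<alpha> \<and> set w \<subseteq> {1..length \<alpha>} \<and>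
     (\<forall>i\<in>{1..length \<alpha>}. count_list w i = \<alpha> ! (i - 1))}"

text \<open>A table is the list of its columns.\<close>

definition table_row :: "nat list list \<Rightarrow> nat \<Rightarrow> nat list" where
  "table_row T i = map (\<lambda>c. c ! i) T"

definition tables_A :: "nat list list \<Rightarrow> nat list list set" where
  "tables_A \<alpha> = {T. (\<forall>c\<in>set T. length c = length \<alpha>) \<and> (\<forall>i<length \<alpha>. table_row T i \<in> words (\<alpha> ! i))}"

definition tables_B :: "nat list list \<Rightarrow> nat list list set" where
  "tables_B \<alpha> = {T \<in> tables_A \<alpha>. distinct T}"

text \<open>Sorted with respect to the lexicographic order of \<^theory>\<open>HOL-Library.List_Lexorder\<close>.\<close>

definition A_lex :: "nat list list \<Rightarrow> nat list list set" where
  "A_lex \<alpha> = {T \<in> tables_A \<alpha>. sorted T}"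

definition B_lex :: "nat list list \<Rightarrow> nat list list set" where
  "B_lex \<alpha> = {T \<in> tables_B \<alpha>. sorted T}"

definition table_norm :: "nat list list \<Rightarrow> nat" where
  "table_norm T = (\<Prod>c\<in>set T. fact (count_list T c))"

definition word_sign :: "nat list \<Rightarrow> int" where
  "word_sign w = (- 1) ^ card {(i, j). i < j \<and> j < length w \<and> w ! i > w ! j}"

definition table_sign :: "nat \<Rightarrow> nat list list \<Rightarrow> int" where
  "table_sign d T = (\<Prod>i<d. word_sign (table_row T i))"

definition perm_sgn :: "nat list \<Rightarrow> int" where
  "perm_sgn a =
     (if distinct a \<and> set a = {1..length a}
      then sign (\<lambda>i. if i \<in> {1..length a} then a ! (i - 1) else i) else 0)"

definition word_sgn :: "nat list \<Rightarrow> nat list \<Rightarrow> int" where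
  "word_sgn s x = (\<Prod>c\<in>set s. perm_sgn (map (\<lambda>b. x ! b) (filter (\<lambda>b. s ! b = c) [0..<length s])))"

definition table_sgn :: "nat \<Rightarrow> nat list list \<Rightarrow> nat list list \<Rightarrow> int" where
  "table_sgn d T X = (\<Prod>i<d. word_sgn (table_row T i) (table_row X i))"

definition all_tables :: "nat \<Rightarrow> nat \<Rightarrow> nat \<Rightarrow> nat list list set" where
  "all_tables d n m = {X. length X = m \<and> set X \<subseteq> multi_idx d n}"

definition Delta_vec :: "nat \<Rightarrow> nat \<Rightarrow> nat list list \<Rightarrow> nat list sym_alg" where
  "Delta_vec d n T =
     scale (of_int (table_sign d T) / of_nat (table_norm T))
       (\<Sum>X\<in>all_tables d n (length T). scale (of_int (table_sgn d T X)) (sym_mon X))"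

definition Nabla_vec :: "nat \<Rightarrow> nat \<Rightarrow> nat list list \<Rightarrow> nat list ext_alg" where
  "Nabla_vec d n T =
     scale (of_int (table_sign d T) / of_nat (table_norm T))
       (\<Sum>X\<in>all_tables d n (length T). scale (of_int (table_sgn d T X)) (ext_mon X))"

text \<open>Linear maps with prescribed values on the bases of the weight spaces exist.\<close>

lemma sym_mon_eq: "sym_mon S = Poly_Mapping.single (mset S) 1"
  by (induction S) (simp_all add: sym_mon_def sym_incl_def mult_single)

lemma ext_mon_eq:
  assumes "sorted S" "distinct S"
  shows "ext_mon S = Poly_Mapping.single (fset_of_list S) 1"
  using assms
proof (induction S)
  case Nil
  then show ?case by (simp add: ext_mon_def wedge_list_def ext_one_def)
next
  case (Cons a S)
  have "ext_mon (a # S) = wedge (ext_incl (Poly_Mapping.single a 1)) (ext_mon S)"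
    by (simp add: ext_mon_def wedge_list_def)
  moreover have "wedge_sign {|a|} (fset_of_list S) = 1"
    using Cons.prems by (intro wedge_sign_min) (force simp: fset_of_list_elem less_le)
  ultimately show ?case using Cons by (simp add: ext_incl_def wedge_single)
qed

lemma linear_extension_sym: "\<exists>F. linear_on W F \<and> (\<forall>S\<in>A_lex \<alpha>. F (sym_mon S) = f S)"
proof -
  have "lin_ext (\<lambda>M. f (sorted_list_of_multiset M)) (sym_mon S) = f S" if "S \<in> A_lex \<alpha>" for S
    using that by (simp add: sym_mon_eq A_lex_def sorted_sort_id)
  then show ?thesis by (intro exI[of _ "lin_ext (\<lambda>M. f (sorted_list_of_multiset M))"]) (simp add: linear_on_def)
qed

lemma linear_extension_ext: "\<exists>F. linear_on W F \<and> (\<forall>T\<in>B_lex \<alpha>. F (ext_mon T) = f T)"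
proof -
  have "lin_ext (\<lambda>A. f (sorted_list_of_fset A)) (ext_mon T) = f T" if "T \<in> B_lex \<alpha>" for T
    using that
    by (simp add: ext_mon_eq B_lex_def tables_B_def sorted_list_of_fset.rep_eq fset_of_list.rep_eq
        sorted_list_of_set.idem_if_sorted_distinct)
  then show ?thesis by (intro exI[of _ "lin_ext (\<lambda>A. f (sorted_list_of_fset A))"]) (simp add: linear_on_def)
qed

end

theory Submission
  imports Defs "HOL-Library.Product_Lexorder" "Jordan_Normal_Form.Determinant"
begin

text \<open>
  Work with functions on tables, i.e. in the tensor power of \<open>V\<close>. Up to a sign, the coefficient of a table \<open>X\<close> in
  the vector attached to \<open>T\<close> is a product over the rows of determinants that test whether the pairs
  \<open>(t\<^sub>p, x\<^sub>p)\<close> enumerate the Young diagram. Hence this kernel is invariant under unitriangular matrices acting on \<open>X\<close>,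
  it changes by the \<open>d\<close>-th power of the sign under a permutation of the columns of \<open>X\<close> and \<open>T\<close>, and it is symmetric in
  \<open>X\<close> and \<open>T\<close> up to a global sign when the shapes are conjugated.

  A highest weight function is killed by the raising operators, so it is determined by its values on tables with
  Yamanouchi rows. On these tables the kernel is triangular, so its rows span the highest weight functions of the given
  weight; this gives surjectivity. If a highest weight function \<open>g\<close>, itself in the image of the transposed kernel, is
  sent to zero, then pairing with a preimage yields a vanishing positive definite form in \<open>g\<close>; this gives injectivity.
  Injectivity in both directions forces the restricted maps to be isomorphisms.
\<close>

section \<open>Signs of words\<close>

text \<open>All four maps are one construction. Let e be 0 for the symmetric and 1 for the exterior
  algebra. A column permutation multiplies the kernel by the d-th power of its sign, so the kernel
  carries functions of type e1 to functions of type e2 when e1 + e2 + d is even: the algebra changes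
  for odd d and stays for even d.

  The obstacle is that the monomials of tables are linearly dependent: reordered columns give the
  same vector up to sign, and repeated columns give zero in the exterior algebra. Vectors are
  therefore lifted to functions with the matching column symmetry, on which the projection to the
  algebra is injective. Surjectivity can forget this symmetry, since any coefficients may be fed
  into the kernel; injectivity cannot.

  The bounds on the number of parts and on the first part let a partition and its conjugate both use
  the letters 1 to n, so source and target may exchange roles. The map back that is compared with a
  given one is produced by linear extension from a basis. The factor 1 / \<open>table_norm\<close>
  becomes a positive weight in the form that proves injectivity.\<close>

lemma permute_list_adjacent:
  assumes "Suc i < length w"
  shows "permute_list (Transposition.transpose i (Suc i)) w = take i w @ w ! Suc i # w ! i # drop (Suc (Suc i)) w"
proof (rule nth_equalityI)
  fix j assume "j < length (permute_list (Transposition.transpose i (Suc i)) w)"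
  then show "permute_list (Transposition.transpose i (Suc i)) w ! j =
      (take i w @ w ! Suc i # w ! i # drop (Suc (Suc i)) w) ! j"
    using assms
    by (cases "j < i"; cases "j = i"; cases "j = Suc i")
      (auto simp: permute_list_def nth_append nth_Cons' transpose_def Suc_diff_Suc numeral_2_eq_2)
qed (use assms in auto)

text \<open>Adjacent transpositions generate the symmetric group.\<close>

lemma antisymmetric_permute_list:
  fixes h :: "'a list \<Rightarrow> complex"
  assumes swap: "\<And>a x y b. h (a @ y # x # b) = - h (a @ x # y # b)"
    and "\<sigma> permutes {..<length w}"
  shows "h (permute_list \<sigma> w) = of_int (sign \<sigma>) * h w"
proof -
  let ?t = "Transposition.transpose :: nat \<Rightarrow> nat \<Rightarrow> nat \<Rightarrow> nat"
  have adj: "h (permute_list (?t i (Suc i)) w) = - h w" if "Suc i < length w" for i w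
  proof -
    have "w = take i w @ w ! i # w ! Suc i # drop (Suc (Suc i)) w"
      using that by (metis Cons_nth_drop_Suc Suc_lessD id_take_nth_drop)
    then show ?thesis using swap[of "take i w" "w ! Suc i" "w ! i"] permute_list_adjacent[OF that] by metis
  qed
  have tr: "h (permute_list (?t i (i + Suc k)) w) = - h w" if "i + Suc k < length w" for i k w
    using that
  proof (induction k arbitrary: w)
    case 0
    then show ?case using adj by simp
  next
    case (Suc k)
    let ?a = "?t (i + Suc k) (Suc (i + Suc k))"
    have a: "?a permutes {..<length v}" if "length v = length w" for v :: "'a list"
      using Suc.prems that by (intro permutes_swap_id) auto
    have b: "?t i (i + Suc k) permutes {..<length v}" if "length v = length w" for v :: "'a list"
      using Suc.prems that by (intro permutes_swap_id) auto
    \<comment> \<open>A transposition at distance k + 2 is one at distance k + 1 conjugated by an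
      adjacent one; three sign changes amount to one.\<close>
    have "?t i (i + Suc (Suc k)) = ?a \<circ> ?t i (i + Suc k) \<circ> ?a"
      by (auto simp: fun_eq_iff transpose_def)
    then have "permute_list (?t i (i + Suc (Suc k))) w =
        permute_list ?a (permute_list (?t i (i + Suc k)) (permute_list ?a w))"
      using a b permutes_compose[OF a b] by (simp add: permute_list_compose o_assoc[symmetric])
    then show ?case using Suc adj[of "i + Suc k"] by simp
  qed
  have tr2: "h (permute_list (?t i j) w) = - h w" if "i \<noteq> j" "i < length w" "j < length w" for i j w
  proof (cases "i < j")
    case True
    then show ?thesis using tr[of i "j - i - 1" w] that by simp
  next
    case False
    then show ?thesis using tr[of j "i - j - 1" w] that by (simp add: transpose_commute)
  qed
  have "finite {..<length w}" by simp
  \<comment> \<open>The list is quantified inside the induction, because splitting off a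
    transposition changes the list to which the hypothesis is applied.\<close>
  from assms(2) this have "\<forall>v. length v = length w \<longrightarrow> h (permute_list \<sigma> v) = of_int (sign \<sigma>) * h v"
  proof (induction rule: permutes_induct)
    case id
    then show ?case by simp
  next
    case (swap a b p)
    show ?case
    proof (intro allI impI)
      fix v :: "'a list" assume v: "length v = length w"
      let ?u = "permute_list (?t a b) v"
      have "h (permute_list (?t a b \<circ> p) v) = h (permute_list p ?u)"
        using swap.hyps v by (simp add: permute_list_compose)
      also have "\<dots> = of_int (sign p) * h ?u"
        using swap.IH v by simp
      also have "h ?u = - h v"
        using tr2 swap.hyps v by simp
      also have "of_int (sign p) * - h v = of_int (sign (?t a b \<circ> p)) * h v"
      proof -
        have "permutation p" using swap.hyps permutation_permutes by blast
        then have "sign (?t a b \<circ> p) = sign (?t a b) * sign p"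
          by (intro sign_compose permutation_swap_id)
        moreover have "sign (?t a b) = - 1" using swap.hyps by (simp add: sign_swap_id)
        ultimately show ?thesis by simp
      qed
      finally show "h (permute_list (?t a b \<circ> p) v) = of_int (sign (?t a b \<circ> p)) * h v" .
    qed
  qed
  then show ?thesis by simp
qed

text \<open>The inversion sign over any linear order, so that it applies to lists of cells and to
  lists of columns as well as to words.\<close>

definition lex_sign :: "'a::linorder list \<Rightarrow> int" where
  "lex_sign w = (- 1) ^ card {(i, j). i < j \<and> j < length w \<and> w ! j < w ! i}"

lemma lex_sign_Cons: "lex_sign (x # w) = (- 1) ^ length (filter (\<lambda>y. y < x) w) * lex_sign w"
proof -
  let ?I = "\<lambda>w::'a list. {(i, j). i < j \<and> j < length w \<and> w ! j < w ! i}"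
  have fin: "finite (?I w)" for w
    by (rule finite_subset[of _ "{..<length w} \<times> {..<length w}"]) auto
  have eq: "?I (x # w) = (\<lambda>j. (0, Suc j)) ` {j. j < length w \<and> w ! j < x} \<union> map_prod Suc Suc ` ?I w"
    (is "?L = ?A \<union> ?B")
  proof (intro equalityI subsetI)
    fix z assume "z \<in> ?L"
    then obtain i j where z: "z = (i, j)" "i < j" "j < Suc (length w)" "(x # w) ! j < (x # w) ! i" by auto
    then obtain j' where j: "j = Suc j'" by (cases j) auto
    show "z \<in> ?A \<union> ?B" using z j by (cases i) (auto intro: image_eqI[of _ "map_prod Suc Suc" "(_, _)"])
  qed auto
  have "card ?L = card ?A + card ?B"
    unfolding eq by (intro card_Un_disjoint finite_imageI fin) auto
  also have "card ?A = length (filter (\<lambda>y. y < x) w)"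
    by (subst card_image) (auto simp: inj_on_def length_filter_conv_card)
  also have "card ?B = card (?I w)"
    by (intro card_image) (auto simp: inj_on_def)
  finally show ?thesis by (simp add: lex_sign_def power_add)
qed

lemma lex_sign_Nil [simp]: "lex_sign [] = 1"
  by (simp add: lex_sign_def)

lemma lex_sign_sorted: "sorted w \<Longrightarrow> lex_sign w = 1"
proof (induction w)
  case (Cons x w)
  then have "filter (\<lambda>y. y < x) w = []" by (auto simp: filter_empty_conv)
  with Cons show ?case by (simp add: lex_sign_Cons)
qed simp

lemma abs_lex_sign [simp]: "\<bar>lex_sign w\<bar> = 1"
  by (simp add: lex_sign_def power_abs)

lemma lex_sign_swap: "x \<noteq> y \<Longrightarrow> lex_sign (a @ y # x # b) = - lex_sign (a @ x # y # b)"
proof (induction a)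
  case Nil
  then show ?case by (cases x y rule: linorder_cases) (auto simp: lex_sign_Cons)
qed (auto simp: lex_sign_Cons)

lemma lex_sign_permute:
  assumes "distinct w" "\<sigma> permutes {..<length w}"
  shows "lex_sign (permute_list \<sigma> w) = sign \<sigma> * lex_sign w"
proof -
  \<comment> \<open>Extension by zero makes the swap rule hold for equal neighbours too.\<close>
  let ?h = "\<lambda>w. if distinct w then complex_of_int (lex_sign w) else 0"
  have "?h (a @ y # x # b) = - ?h (a @ x # y # b)" for a x y b
    using lex_sign_swap[of x y a b] by (cases "x = y") auto
  from antisymmetric_permute_list[of ?h, OF this assms(2)]
  have "?h (permute_list \<sigma> w) = of_int (sign \<sigma>) * ?h w" .
  then show ?thesis using assms by (auto simp flip: of_int_mult)
qed

text \<open>On an enumeration of 1..k both signs belong to the same permutation, read on {1..k} by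
  \<open>perm_sgn\<close> and on positions by \<open>lex_sign\<close>; \<open>Suc\<close> conjugates
  one reading into the other.\<close>

lemma perm_sgn_eq_lex_sign: "perm_sgn a = (if distinct a \<and> set a = {1..length a} then lex_sign a else 0)"
proof (cases "distinct a \<and> set a = {1..length a}")
  case True
  define k where "k = length a"
  have "mset a = mset_set {1..k}" using True mset_set_set[of a] k_def by simp
  also have "\<dots> = mset [1..<Suc k]" by (simp add: atLeastLessThanSuc_atLeastAtMost del: upt_Suc)
  finally obtain \<sigma> where "\<sigma> permutes {..<length [1..<Suc k]}" and a: "permute_list \<sigma> [1..<Suc k] = a"
    by (rule mset_eq_permutation)
  then have \<sigma>: "\<sigma> permutes {..<k}" by (simp del: upt_Suc)
  let ?\<pi> = "\<lambda>i. if i \<in> {1..length a} then a ! (i - 1) else i"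
  have "?\<pi> = map_permutation {..<k} Suc \<sigma>"
  proof
    fix i
    show "?\<pi> i = map_permutation {..<k} Suc \<sigma> i"
    proof (cases "i \<in> {1..k}")
      case True
      then obtain j where j: "i = Suc j" "j < k" by (cases i) auto
      have "\<sigma> j < k" using \<sigma> j permutes_in_image by fastforce
      then have "a ! j = Suc (\<sigma> j)" unfolding a[symmetric] using j
        by (simp add: permute_list_def del: upt_Suc)
      then show ?thesis using j by (simp add: k_def[symmetric] map_permutation_apply)
    next
      case False
      then have "i \<notin> Suc ` {..<k}" by (auto simp: image_iff)
      then show ?thesis using False by (auto simp: k_def[symmetric] map_permutation_def restrict_id_def)
    qed
  qed
  then have "perm_sgn a = sign \<sigma>"
    using True sign_map_permutation[of Suc "{..<k}" \<sigma>] \<sigma> by (simp add: perm_sgn_def)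
  moreover have "lex_sign a = sign \<sigma>"
    using lex_sign_permute[of "[1..<Suc k]" \<sigma>] \<sigma> a by (simp add: lex_sign_sorted del: upt_Suc)
  ultimately show ?thesis using True by simp
qed (auto simp: perm_sgn_def)

section \<open>The sign kernel of a row\<close>

lemma lists_length_Suc:
  "{w. length w = Suc m \<and> set w \<subseteq> A} = (\<lambda>(x, w). x # w) ` (A \<times> {w. length w = m \<and> set w \<subseteq> A})"
  by (auto simp: length_Suc_conv image_iff)

lemma sum_lists_Suc:
  "(\<Sum>w\<in>{w. length w = Suc m \<and> set w \<subseteq> A}. f w) = (\<Sum>x\<in>A. \<Sum>w\<in>{w. length w = m \<and> set w \<subseteq> A}. f (x # w))"
  unfolding lists_length_Suc
  by (subst sum.reindex) (auto simp: inj_on_def sum.cartesian_product split_def)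

text \<open>Distributivity: expanding the product chooses one letter per position. It is applied to
  the letters of a row and, with words as letters, to the rows of a table.\<close>

lemma sum_prod_lists:
  fixes g :: "nat \<Rightarrow> 'a \<Rightarrow> 'b::comm_semiring_1"
  shows "(\<Sum>w\<in>{w. length w = m \<and> set w \<subseteq> A}. \<Prod>p<m. g p (w ! p)) = (\<Prod>p<m. \<Sum>x\<in>A. g p x)"
proof (induction m arbitrary: g)
  case 0
  have "{w::'a list. length w = 0 \<and> set w \<subseteq> A} = {[]}" by auto
  then show ?case by simp
next
  case (Suc m)
  have "(\<Sum>w\<in>{w. length w = Suc m \<and> set w \<subseteq> A}. \<Prod>p<Suc m. g p (w ! p)) =
      (\<Sum>x\<in>A. g 0 x * (\<Sum>w\<in>{w. length w = m \<and> set w \<subseteq> A}. \<Prod>p<m. g (Suc p) (w ! p)))"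
    by (simp add: sum_lists_Suc prod.lessThan_Suc_shift sum_distrib_left del: prod.lessThan_Suc)
  also have "\<dots> = (\<Prod>p<Suc m. \<Sum>x\<in>A. g p x)"
    unfolding Suc[of "\<lambda>p. g (Suc p)"] sum_distrib_right[symmetric] prod.lessThan_Suc_shift by simp
  finally show ?case .
qed

text \<open>The Young diagram with 1-based coordinates. In its use for a row, the first coordinate
  is a letter of t and the second the letter of x at the same position.\<close>

definition diagram :: "nat list \<Rightarrow> (nat \<times> nat) set" where
  "diagram \<beta> = Sigma {1..length \<beta>} (\<lambda>c. {1..\<beta> ! (c - 1)})"

text \<open>The lexicographic listing is the reference enumeration of sign 1; its order also makes
  the matrix \<open>U\<close> in \<open>row_form_invariant\<close> triangular.\<close>

definition cells :: "nat list \<Rightarrow> (nat \<times> nat) list" where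
  "cells \<beta> = sorted_list_of_set (diagram \<beta>)"

text \<open>The share of one row in the product of the table sign and
  \<open>table_sgn\<close>.\<close>

definition row_form :: "nat list \<Rightarrow> nat list \<Rightarrow> int" where
  "row_form t x = word_sign t * word_sgn t x"

lemma finite_diagram [simp]: "finite (diagram \<beta>)"
  by (auto simp: diagram_def)

lemma set_cells [simp]: "set (cells \<beta>) = diagram \<beta>"
  and distinct_cells [simp]: "distinct (cells \<beta>)"
  and sorted_cells [simp]: "sorted (cells \<beta>)"
  by (simp_all add: cells_def)

lemma length_cells [simp]: "length (cells \<beta>) = sum_list \<beta>"
proof -
  have "length (cells \<beta>) = card (diagram \<beta>)" by (simp add: cells_def)
  also have "\<dots> = (\<Sum>c\<in>{1..length \<beta>}. \<beta> ! (c - 1))" by (simp add: diagram_def)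
  also have "\<dots> = (\<Sum>c<length \<beta>. \<beta> ! c)"
    by (rule sum.reindex_bij_witness[of _ Suc "\<lambda>c. c - 1"]) auto
  finally show ?thesis by (simp add: sum_list_sum_nth atLeast0LessThan)
qed

text \<open>A list that covers the diagram with as many entries as there are cells cannot repeat
  one, so it is a rearrangement of \<open>cells \<beta>\<close>.\<close>

lemma enumeration_permute_cells:
  assumes "length w = sum_list \<beta>" "set w = diagram \<beta>"
  obtains \<sigma> where "\<sigma> permutes {..<sum_list \<beta>}" "permute_list \<sigma> (cells \<beta>) = w"
proof -
  have "card (set w) = length w"
    using assms length_cells[of \<beta>] distinct_card[OF distinct_cells[of \<beta>]] by simp
  then have "distinct w" by (rule card_distinct)
  then have "mset w = mset (cells \<beta>)" using assms set_eq_iff_mset_eq_distinct[of w "cells \<beta>"] by simp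
  then show ?thesis using mset_eq_permutation[of w "cells \<beta>"] that by auto
qed

lemma distinct_enumeration:
  assumes "length w = sum_list \<beta>" "set w = diagram \<beta>"
  shows "distinct w"
  using enumeration_permute_cells[OF assms] distinct_permute_list[of _ "cells \<beta>"] by (metis distinct_cells length_cells)

text \<open>An increasing list of positions preserves their order, so inversions of a subword are
  inversions of x between the listed positions. This evaluates the sign of each block of
  \<open>word_sgn\<close>.\<close>

lemma card_inversions_sublist:
  fixes x :: "nat list"
  assumes "sorted_wrt (<) l"
  shows "card {(i, j). i < j \<and> j < length l \<and> map ((!) x) l ! j < map ((!) x) l ! i} =
    card {(i, j). i \<in> set l \<and> j \<in> set l \<and> i < j \<and> x ! j < x ! i}" (is "card ?A = card ?B")
proof (rule bij_betw_same_card)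
  have less: "l ! i < l ! j \<longleftrightarrow> i < j" if "i < length l" "j < length l" for i j
    using assms that by (metis linorder_neqE_nat order_less_asym sorted_wrt_nth_less)
  have dist: "distinct l" using assms strict_sorted_iff by blast
  show "bij_betw (\<lambda>(i, j). (l ! i, l ! j)) ?A ?B"
  proof (rule bij_betw_imageI)
    show "inj_on (\<lambda>(i, j). (l ! i, l ! j)) ?A"
      using dist by (auto simp: inj_on_def nth_eq_iff_index_eq)
    show "(\<lambda>(i, j). (l ! i, l ! j)) ` ?A = ?B"
    proof (intro equalityI subsetI)
      fix z assume "z \<in> ?B"
      then obtain i j where "z = (l ! i, l ! j)" "i < length l" "j < length l" "l ! i < l ! j" "x ! (l ! j) < x ! (l ! i)"
        by (auto simp: in_set_conv_nth)
      then show "z \<in> (\<lambda>(i, j). (l ! i, l ! j)) ` ?A"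
        by (intro image_eqI[of _ _ "(i, j)"]) (auto simp: less)
    qed (auto simp: less)
  qed
qed

text \<open>Pairs are ordered lexicographically, so an inversion of the zipped list is either an
  inversion of t, counted by \<open>word_sign\<close>, or an inversion of x between equal letters of
  t, counted by one factor of \<open>word_sgn\<close>. No factor vanishes exactly when the block of
  every letter c enumerates 1 up to its multiplicity, that is, when the pairs fill the
  diagram.\<close>

lemma row_form_eq_lex_sign:
  assumes "t \<in> words \<beta>" "length x = length t"
  shows "row_form t x = (if set (zip t x) = diagram \<beta> then lex_sign (zip t x) else 0)"
proof -
  let ?m = "length t"
  define l where "l c = filter (\<lambda>b. t ! b = c) [0..<?m]" for c
  define a where "a c = map ((!) x) (l c)" for c
  have set_l: "set (l c) = {b. b < ?m \<and> t ! b = c}" for c by (auto simp: l_def)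
  have sorted_l: "sorted_wrt (<) (l c)" for c unfolding l_def by (intro sorted_wrt_filter) simp
  have len: "length (a c) = count_list t c" for c
  proof -
    have "distinct (l c)" by (simp add: l_def)
    then have "length (a c) = card (set (l c))" by (simp add: a_def distinct_card)
    also have "\<dots> = card {b. b < ?m \<and> c = t ! b}" unfolding set_l by (simp add: eq_commute)
    also have "\<dots> = count_list t c" by (simp add: count_list_eq_length_filter length_filter_conv_card)
    finally show ?thesis .
  qed
  have ps: "perm_sgn (a c) = (if set (a c) = {1..count_list t c} then lex_sign (a c) else 0)" for c
    using card_distinct[of "a c"] by (auto simp: perm_sgn_eq_lex_sign len)
  have cnt: "count_list t c = \<beta> ! (c - 1)" if "c \<in> {1..length \<beta>}" for c
    using assms that by (auto simp: words_def)
  have tin: "set t \<subseteq> {1..length \<beta>}" using assms by (auto simp: words_def)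
  have set_zip: "set (zip t x) = {(t ! b, x ! b) |b. b < ?m}" using assms by (auto simp: set_zip)
  have iff: "(\<forall>c\<in>set t. set (a c) = {1..count_list t c}) \<longleftrightarrow> set (zip t x) = diagram \<beta>"
  proof
    assume L: "\<forall>c\<in>set t. set (a c) = {1..count_list t c}"
    show "set (zip t x) = diagram \<beta>"
    proof (intro equalityI subsetI)
      fix z assume "z \<in> set (zip t x)"
      then obtain b where b: "z = (t ! b, x ! b)" "b < ?m" by (auto simp: set_zip)
      then have "x ! b \<in> set (a (t ! b))" by (auto simp: a_def set_l)
      moreover have "t ! b \<in> set t" "t ! b \<in> {1..length \<beta>}" using tin nth_mem[OF b(2)] by blast+
      ultimately show "z \<in> diagram \<beta>" using b L cnt[of "t ! b"] by (auto simp: diagram_def)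
    next
      fix z assume "z \<in> diagram \<beta>"
      then obtain c r where z: "z = (c, r)" "c \<in> {1..length \<beta>}" "r \<in> {1..\<beta> ! (c - 1)}" by (auto simp: diagram_def)
      then have "count_list t c \<noteq> 0" using cnt by auto
      then have "c \<in> set t" by (meson count_list_0_iff)
      then have "r \<in> set (a c)" using L z cnt by auto
      then show "z \<in> set (zip t x)" using z by (auto simp: a_def set_l set_zip)
    qed
  next
    assume R: "set (zip t x) = diagram \<beta>"
    show "\<forall>c\<in>set t. set (a c) = {1..count_list t c}"
    proof
      fix c assume c: "c \<in> set t"
      have "set (a c) = {r. (c, r) \<in> set (zip t x)}" by (auto simp: set_zip a_def set_l)
      also have "\<dots> = {1..count_list t c}" using R c tin cnt[of c] by (auto simp: diagram_def)
      finally show "set (a c) = {1..count_list t c}" .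
    qed
  qed
  have ws: "word_sgn t x = (\<Prod>c\<in>set t. perm_sgn (a c))"
    by (simp add: word_sgn_def a_def l_def)
  show ?thesis
  proof (cases "set (zip t x) = diagram \<beta>")
    case False
    then have "\<exists>c\<in>set t. perm_sgn (a c) = 0" using iff ps by metis
    then have "word_sgn t x = 0" unfolding ws by simp
    then show ?thesis using False by (simp add: row_form_def)
  next
    case True
    define I where "I = {(i, j). i < j \<and> j < ?m \<and> t ! i > t ! j}"
    define J where "J c = {(i, j). i \<in> set (l c) \<and> j \<in> set (l c) \<and> i < j \<and> x ! j < x ! i}" for c
    have finI: "finite I" by (rule finite_subset[of _ "{..<?m} \<times> {..<?m}"]) (auto simp: I_def)
    have finJ: "finite (J c)" for c by (rule finite_subset[of _ "set (l c) \<times> set (l c)"]) (auto simp: J_def)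
    have "word_sgn t x = (\<Prod>c\<in>set t. (- 1) ^ card (J c))"
      unfolding ws
    proof (rule prod.cong)
      fix c assume "c \<in> set t"
      then have "perm_sgn (a c) = lex_sign (a c)" using ps iff True by metis
      also have "\<dots> = (- 1) ^ card (J c)"
        using card_inversions_sublist[OF sorted_l[of c], of x] by (simp add: lex_sign_def a_def J_def)
      finally show "perm_sgn (a c) = (- 1) ^ card (J c)" .
    qed simp
    also have "\<dots> = (- 1) ^ card (\<Union>c\<in>set t. J c)"
      by (subst card_UN_disjoint) (auto simp: finJ power_sum, auto simp: J_def set_l)
    finally have "row_form t x = (- 1) ^ (card I + card (\<Union>c\<in>set t. J c))"
      by (simp add: row_form_def word_sign_def I_def power_add)
    also have "card I + card (\<Union>c\<in>set t. J c) = card (I \<union> (\<Union>c\<in>set t. J c))"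
      by (subst card_Un_disjoint) (auto simp: finI finJ, auto simp: I_def J_def set_l)
    also have "I \<union> (\<Union>c\<in>set t. J c) =
        {(i, j). i < j \<and> j < length (zip t x) \<and> zip t x ! j < zip t x ! i}" (is "_ = ?K")
    proof (intro equalityI subsetI)
      fix z assume "z \<in> ?K"
      then obtain i j where "z = (i, j)" "i < j" "j < ?m" "t ! j < t ! i \<or> t ! j = t ! i \<and> x ! j < x ! i"
        using assms(2) by (auto simp: less_prod_def' less_le)
      then show "z \<in> I \<union> (\<Union>c\<in>set t. J c)" by (auto simp: I_def J_def set_l)
    qed (use assms(2) in \<open>auto simp: I_def J_def set_l less_prod_def'\<close>)
    finally show ?thesis using True by (simp add: lex_sign_def)
  qed
qed

lemma count_list_eq_mset: "count_list w c = count (mset w) c"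
  by (induction w) auto

lemma permute_list_words:
  assumes "w \<in> words \<beta>" "\<sigma> permutes {..<length w}"
  shows "permute_list \<sigma> w \<in> words \<beta>"
  using assms by (auto simp: words_def count_list_eq_mset)

lemma row_form_permute:
  assumes "t \<in> words \<beta>" "length x = length t" "\<sigma> permutes {..<length t}"
  shows "row_form (permute_list \<sigma> t) (permute_list \<sigma> x) = sign \<sigma> * row_form t x"
proof -
  have len: "length t = sum_list \<beta>" using assms by (simp add: words_def)
  have z: "zip (permute_list \<sigma> t) (permute_list \<sigma> x) = permute_list \<sigma> (zip t x)"
    using assms by (simp add: permute_list_zip[of \<sigma> "{..<length t}"])
  have s: "set (permute_list \<sigma> (zip t x)) = set (zip t x)"
    using assms by (intro set_permute_list) simp
  show ?thesis
    using row_form_eq_lex_sign[OF assms(1,2)]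
      row_form_eq_lex_sign[OF permute_list_words[OF assms(1,3)], of "permute_list \<sigma> x"] assms
      lex_sign_permute[OF distinct_enumeration[of "zip t x" \<beta>], of \<sigma>] len
    by (simp add: z s)
qed

section \<open>Determinants and the unitriangular invariance of a row\<close>

definition cell_mat :: "nat list \<Rightarrow> (nat \<times> nat) list \<Rightarrow> complex mat" where
  "cell_mat \<beta> w = mat (sum_list \<beta>) (sum_list \<beta>) (\<lambda>(p, q). if w ! p = cells \<beta> ! q then 1 else 0)"

lemma cell_mat_carrier [simp]: "cell_mat \<beta> w \<in> carrier_mat (sum_list \<beta>) (sum_list \<beta>)"
  by (simp add: cell_mat_def)

text \<open>For an enumeration of the diagram the matrix is a row permutation of the identity.
  Otherwise, by counting, w misses some cell, and the column of that cell is zero.\<close>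

lemma det_cell_mat:
  assumes "length w = sum_list \<beta>"
  shows "det (cell_mat \<beta> w) = (if set w = diagram \<beta> then of_int (lex_sign w) else 0)"
proof (cases "set w = diagram \<beta>")
  case True
  let ?m = "sum_list \<beta>"
  from enumeration_permute_cells[OF assms True] obtain \<sigma>
    where \<sigma>: "\<sigma> permutes {..<?m}" "permute_list \<sigma> (cells \<beta>) = w" .
  have "cell_mat \<beta> w = mat ?m ?m (\<lambda>(p, q). 1\<^sub>m ?m $$ (\<sigma> p, q))"
    unfolding cell_mat_def
  proof (rule cong_mat)
    fix p q assume "p < ?m" "q < ?m"
    moreover have "\<sigma> p < ?m" using \<sigma>(1) \<open>p < ?m\<close> permutes_in_image by fastforce
    ultimately show "(\<lambda>(p, q). if w ! p = cells \<beta> ! q then 1 else 0) (p, q) = (\<lambda>(p, q). 1\<^sub>m ?m $$ (\<sigma> p, q)) (p, q)"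
      by (simp add: \<sigma>(2)[symmetric] permute_list_def nth_eq_iff_index_eq)
  qed auto
  also have "det \<dots> = of_int (sign \<sigma>)"
    using det_permute_rows[of "1\<^sub>m ?m" ?m \<sigma>] \<sigma> by (simp add: atLeast0LessThan)
  also have "sign \<sigma> = lex_sign w"
    using lex_sign_permute[of "cells \<beta>" \<sigma>] \<sigma> by (simp add: lex_sign_sorted)
  finally show ?thesis using True by simp
next
  case False
  have "\<not> diagram \<beta> \<subseteq> set w"
  proof
    assume *: "diagram \<beta> \<subseteq> set w"
    have "card (set w) \<le> card (diagram \<beta>)"
      using assms card_length[of w] distinct_card[OF distinct_cells[of \<beta>]] by simp
    with * False show False by (metis List.finite_set card_seteq)
  qed
  then obtain q where q: "q < sum_list \<beta>" "cells \<beta> ! q \<notin> set w"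
    by (metis in_set_conv_nth length_cells set_cells subsetI)
  have "col (cell_mat \<beta> w) q = 0\<^sub>v (sum_list \<beta>)"
    using q assms by (intro eq_vecI) (auto simp: cell_mat_def, metis nth_mem)
  then have "row (cell_mat \<beta> w)\<^sup>T q = 0\<^sub>v (sum_list \<beta>)"
    using q by (simp add: cell_mat_def)
  then have r0: "(cell_mat \<beta> w)\<^sup>T $$ (q, j) = 0" if "j < sum_list \<beta>" for j
    using q that by (metis carrier_matD index_row(1) index_zero_vec(1) transpose_carrier_mat cell_mat_carrier)
  have "det (cell_mat \<beta> w)\<^sup>T = 0"
  proof -
    have z: "(\<Prod>i = 0..<sum_list \<beta>. (cell_mat \<beta> w)\<^sup>T $$ (i, p i)) = 0" if "p permutes {0..<sum_list \<beta>}" for p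
    proof -
      have "p q < sum_list \<beta>" using that q permutes_in_image by fastforce
      then show ?thesis using r0 q by (intro prod_zero) (auto intro: bexI[of _ q])
    qed
    show ?thesis
      by (subst det_def'[of _ "sum_list \<beta>"]) (simp, intro sum.neutral ballI, simp only: mem_Collect_eq z mult_zero_right)
  qed
  then show ?thesis using False by (simp add: det_transpose[OF cell_mat_carrier])
qed

text \<open>This drops the invertibility demanded in \<open>unitri\<close>, which is automatic by
  \<open>unitri_iff\<close>.\<close>

definition unitriangular :: "nat \<Rightarrow> complex mat \<Rightarrow> bool" where
  "unitriangular n u \<longleftrightarrow> u \<in> carrier_mat n n \<and> upper_triangular u \<and> (\<forall>i<n. u $$ (i, i) = 1)"

text \<open>Both vectors are indexed from 0, hence the strict inequalities.\<close>

locale conj_pair =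
  fixes n m :: nat and \<alpha> \<beta> :: "nat list"
  assumes length_alpha: "length \<alpha> = n" and length_beta: "length \<beta> = n"
    and sum_alpha: "sum_list \<alpha> = m" and sum_beta: "sum_list \<beta> = m"
    and alpha_le: "\<And>i. i < n \<Longrightarrow> \<alpha> ! i \<le> n" and beta_le: "\<And>i. i < n \<Longrightarrow> \<beta> ! i \<le> n"
    and conj_iff: "\<And>i j. i < n \<Longrightarrow> j < n \<Longrightarrow> j < \<beta> ! i \<longleftrightarrow> i < \<alpha> ! j"
begin

lemma conj_pair_swap: "conj_pair n m \<beta> \<alpha>"
  using length_alpha length_beta sum_alpha sum_beta alpha_le beta_le conj_iff by unfold_locales auto

lemma diagram_swap: "prod.swap ` diagram \<beta> = diagram \<alpha>"
proof -
  have "(c, r) \<in> diagram \<beta> \<longleftrightarrow> (r, c) \<in> diagram \<alpha>" for c r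
  proof (cases "c \<in> {1..n} \<and> r \<in> {1..n}")
    case True
    then obtain c' r' where "c = Suc c'" "r = Suc r'" by (cases c; cases r) auto
    then show ?thesis using True conj_iff[of c' r'] by (auto simp: diagram_def length_alpha length_beta Suc_le_eq)
  next
    \<comment> \<open>Outside the n by n square the bounds \<open>alpha_le\<close> and
      \<open>beta_le\<close> exclude a cell of either diagram.\<close>
    case False
    then show ?thesis using alpha_le[of "r - 1"] beta_le[of "c - 1"]
      by (force simp: diagram_def length_alpha length_beta)
  qed
  then show ?thesis by (force simp: image_iff)
qed

lemma length_words: "t \<in> words \<beta> \<Longrightarrow> length t = m"
  by (simp add: words_def sum_beta)

lemma set_zip_swap:
  assumes "length x = length t"
  shows "set (zip x t) = prod.swap ` set (zip t x)"
  using assms by (force simp: set_zip)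

lemma row_form_nonzero_diagram:
  assumes "t \<in> words \<beta>" "length x = m" "row_form t x \<noteq> 0"
  shows "set (zip t x) = diagram \<beta>"
  using row_form_eq_lex_sign[OF assms(1), of x] assms length_words by (auto split: if_splits)

text \<open>With its components exchanged, an enumeration of the diagram of \<beta> enumerates the
  diagram of \<alpha>, and the cells with first coordinate i then count the occurrences of i in x.
  So the kernel has weight \<alpha> in its second argument.\<close>

lemma row_form_support:
  assumes "t \<in> words \<beta>" "length x = m" "row_form t x \<noteq> 0"
  shows "x \<in> words \<alpha>"
proof -
  have len: "length t = m" using assms length_words by simp
  have st: "set (zip t x) = diagram \<beta>" by (rule row_form_nonzero_diagram[OF assms])
  have sx: "set (zip x t) = diagram \<alpha>" using st diagram_swap set_zip_swap[of x t] len assms by simp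
  have distx: "distinct (zip x t)" using sx len assms by (intro distinct_enumeration[of _ \<alpha>]) (auto simp: sum_alpha)
  have xeq: "x = map fst (zip x t)" using len assms by simp
  have "set x \<subseteq> {1..length \<alpha>}"
    by (subst xeq) (use sx in \<open>auto simp: diagram_def simp del: map_fst_zip\<close>)
  moreover have "count_list x i = \<alpha> ! (i - 1)" if "i \<in> {1..length \<alpha>}" for i
  proof -
    have "count_list x i = length (filter (\<lambda>z. i = fst z) (zip x t))"
      by (subst xeq) (simp add: count_list_eq_length_filter filter_map o_def del: map_fst_zip)
    also have "\<dots> = card (set (filter (\<lambda>z. i = fst z) (zip x t)))"
      using distx by (simp add: distinct_card del: set_filter)
    also have "set (filter (\<lambda>z. i = fst z) (zip x t)) = Pair i ` {1..\<alpha> ! (i - 1)}"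
      using sx that by (auto simp: diagram_def)
    also have "card \<dots> = \<alpha> ! (i - 1)" by (simp add: card_image inj_on_def)
    finally show ?thesis .
  qed
  ultimately show ?thesis using assms by (simp add: words_def sum_alpha)
qed

text \<open>The same permutation of the cells produces both zipped lists, once from
  \<open>cells \<beta>\<close> and once from its image under \<open>prod.swap\<close>. The two signs
  therefore differ by the sign of that image, which depends on the shape only.\<close>

lemma row_form_swap:
  assumes "t \<in> words \<beta>" "x \<in> words \<alpha>"
  shows "row_form x t = lex_sign (map prod.swap (cells \<beta>)) * row_form t x"
proof -
  interpret sw: conj_pair n m \<beta> \<alpha> by (rule conj_pair_swap)
  have len: "length t = m" "length x = m" using assms length_words sw.length_words by auto
  have iff: "set (zip x t) = diagram \<alpha> \<longleftrightarrow> set (zip t x) = diagram \<beta>"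
    using set_zip_swap[of x t] sw.set_zip_swap[of t x] diagram_swap sw.diagram_swap len by metis
  show ?thesis
  proof (cases "set (zip t x) = diagram \<beta>")
    case True
    from True len obtain \<sigma> where \<sigma>: "\<sigma> permutes {..<m}" "permute_list \<sigma> (cells \<beta>) = zip t x"
      using enumeration_permute_cells[of "zip t x" \<beta>] by (auto simp: sum_beta)
    have "zip x t = map prod.swap (zip t x)"
      using len by (simp add: zip_commute[of x t] prod.swap_def split_def) 
    also have "\<dots> = permute_list \<sigma> (map prod.swap (cells \<beta>))"
      using \<sigma> permute_list_map[of \<sigma> "cells \<beta>" prod.swap] by (simp add: sum_beta)
    finally have "lex_sign (zip x t) = sign \<sigma> * lex_sign (map prod.swap (cells \<beta>))"
      using \<sigma> by (simp add: lex_sign_permute distinct_map sum_beta)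
    moreover have "lex_sign (zip t x) = sign \<sigma>"
      using lex_sign_permute[of "cells \<beta>" \<sigma>] \<sigma> by (simp add: lex_sign_sorted sum_beta)
    ultimately show ?thesis
      using True iff row_form_eq_lex_sign[OF assms(1), of x] row_form_eq_lex_sign[OF assms(2), of t] len by simp
  next
    case False
    then show ?thesis
      using iff row_form_eq_lex_sign[OF assms(1), of x] row_form_eq_lex_sign[OF assms(2), of t] len by simp
  qed
qed

text \<open>
  By multilinearity the sum over words is the determinant of the product of the incidence matrix of
  \<open>zip t y\<close> with a unitriangular matrix indexed by the cells of the diagram.
\<close>

lemma row_form_invariant:
  assumes t: "t \<in> words \<beta>" and y: "y \<in> multi_idx m n" and u: "unitriangular n u"
  shows "(\<Sum>x\<in>multi_idx m n. of_int (row_form t x) * (\<Prod>p<m. u $$ (y ! p - 1, x ! p - 1))) = of_int (row_form t y)"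
proof -
  have len: "length t = m" "length y = m" using t y length_words by (auto simp: multi_idx_def)
  let ?c = "\<lambda>q. cells \<beta> ! q"
  have cq: "?c q \<in> diagram \<beta>" if "q < m" for q
    using that nth_mem[of q "cells \<beta>"] by (simp add: sum_beta)
  have sndc: "snd (?c q) \<in> {1..n}" if "q < m" for q
  proof -
    obtain c r where cr: "?c q = (c, r)" by fastforce
    then have "c \<in> {1..n}" "r \<in> {1..\<beta> ! (c - 1)}" using cq[OF that] by (auto simp: diagram_def length_beta)
    moreover from this have "c - 1 < n" by auto
    ultimately show ?thesis using beta_le[of "c - 1"] cr by auto
  qed
  have form: "complex_of_int (row_form t x) = det (cell_mat \<beta> (zip t x))" if "length x = m" for x
    using that t len by (simp add: row_form_eq_lex_sign det_cell_mat sum_beta)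
  \<comment> \<open>Row p of \<open>B\<close> carries row \<open>y ! p\<close> of u along the cells
    with first coordinate \<open>t ! p\<close>; \<open>U\<close> describes the same action on the
    cells themselves.\<close>
  define B where "B = mat m m (\<lambda>(p, q). if t ! p = fst (?c q) then u $$ (y ! p - 1, snd (?c q) - 1) else 0)"
  define U where "U = mat m m (\<lambda>(p, q). if fst (?c p) = fst (?c q) then u $$ (snd (?c p) - 1, snd (?c q) - 1) else 0)"
  have u0: "u $$ (i - 1, j - 1) = 0" if "i \<le> n" "1 \<le> j" "j < i" for i j
    using u that by (auto simp: unitriangular_def upper_triangular_def)
  have u1: "u $$ (i - 1, i - 1) = 1" if "i \<in> {1..n}" for i
    using u that by (auto simp: unitriangular_def)
  have "(\<Sum>x\<in>multi_idx m n. of_int (row_form t x) * (\<Prod>p<m. u $$ (y ! p - 1, x ! p - 1))) =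
     (\<Sum>x\<in>multi_idx m n. \<Sum>\<sigma> | \<sigma> permutes {0..<m}. of_int (sign \<sigma>) *
        (\<Prod>p<m. (if (t ! p, x ! p) = ?c (\<sigma> p) then 1 else 0) * u $$ (y ! p - 1, x ! p - 1)))"
  proof (rule sum.cong)
    fix x assume "x \<in> multi_idx m n"
    then have x: "length x = m" by (simp add: multi_idx_def)
    have "det (cell_mat \<beta> (zip t x)) = (\<Sum>\<sigma> | \<sigma> permutes {0..<m}. of_int (sign \<sigma>) *
        (\<Prod>p<m. if (t ! p, x ! p) = ?c (\<sigma> p) then 1 else 0))"
      unfolding det_def'[OF cell_mat_carrier] sum_beta
    proof (intro sum.cong refl arg_cong2[where f = "(*)"])
      fix \<sigma> assume "\<sigma> \<in> {p. p permutes {0..<m}}"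
      then have "\<sigma> p < m" if "p < m" for p using that permutes_in_image by fastforce
      then show "(\<Prod>i = 0..<m. cell_mat \<beta> (zip t x) $$ (i, \<sigma> i)) = (\<Prod>p<m. if (t ! p, x ! p) = ?c (\<sigma> p) then 1 else 0)"
        unfolding atLeast0LessThan using x len by (intro prod.cong) (auto simp: cell_mat_def sum_beta)
    qed
    then show "of_int (row_form t x) * (\<Prod>p<m. u $$ (y ! p - 1, x ! p - 1)) =
      (\<Sum>\<sigma> | \<sigma> permutes {0..<m}. of_int (sign \<sigma>) *
        (\<Prod>p<m. (if (t ! p, x ! p) = ?c (\<sigma> p) then 1 else 0) * u $$ (y ! p - 1, x ! p - 1)))"
      using form[OF x] by (simp add: sum_distrib_right prod.distrib mult.assoc)
  qed simp
  also have "\<dots> = (\<Sum>\<sigma> | \<sigma> permutes {0..<m}. of_int (sign \<sigma>) *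
      (\<Sum>x\<in>multi_idx m n. \<Prod>p<m. (if (t ! p, x ! p) = ?c (\<sigma> p) then 1 else 0) * u $$ (y ! p - 1, x ! p - 1)))"
    by (subst sum.swap) (simp add: sum_distrib_left)
  also have "\<dots> = (\<Sum>\<sigma> | \<sigma> permutes {0..<m}. of_int (sign \<sigma>) * (\<Prod>p = 0..<m. B $$ (p, \<sigma> p)))"
  proof (intro sum.cong refl arg_cong2[where f = "(*)"])
    fix \<sigma> assume "\<sigma> \<in> {p. p permutes {0..<m}}"
    then have \<sigma>: "\<sigma> p < m" if "p < m" for p using that permutes_in_image by fastforce
    have "(\<Sum>x\<in>multi_idx m n. \<Prod>p<m. (if (t ! p, x ! p) = ?c (\<sigma> p) then 1 else 0) * u $$ (y ! p - 1, x ! p - 1)) =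
       (\<Prod>p<m. \<Sum>a\<in>{1..n}. (if (t ! p, a) = ?c (\<sigma> p) then 1 else 0) * u $$ (y ! p - 1, a - 1))"
      unfolding multi_idx_def by (rule sum_prod_lists)
    also have "\<dots> = (\<Prod>p = 0..<m. B $$ (p, \<sigma> p))"
      unfolding atLeast0LessThan
    proof (rule prod.cong)
      fix p assume "p \<in> {..<m}"
      then have p: "p < m" by simp
      \<comment> \<open>Once \<sigma> is fixed, the cell at \<sigma> p determines the letter at
        position p, so a single summand survives.\<close>
      have "(\<Sum>a\<in>{1..n}. (if (t ! p, a) = ?c (\<sigma> p) then 1 else 0) * u $$ (y ! p - 1, a - 1)) =
        (\<Sum>a\<in>{1..n}. if a = snd (?c (\<sigma> p)) then B $$ (p, \<sigma> p) else 0)"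
        using p \<sigma>[OF p] by (intro sum.cong) (auto simp: B_def prod_eq_iff)
      also have "\<dots> = B $$ (p, \<sigma> p)" using sndc[OF \<sigma>[OF p]] by simp
      finally show "(\<Sum>a\<in>{1..n}. (if (t ! p, a) = ?c (\<sigma> p) then 1 else 0) * u $$ (y ! p - 1, a - 1)) = B $$ (p, \<sigma> p)" .
    qed simp
    finally show "(\<Sum>x\<in>multi_idx m n. \<Prod>p<m. (if (t ! p, x ! p) = ?c (\<sigma> p) then 1 else 0) * u $$ (y ! p - 1, x ! p - 1)) =
      (\<Prod>p = 0..<m. B $$ (p, \<sigma> p))" .
  qed
  also have "\<dots> = det B" by (subst det_def'[of _ m]) (auto simp: B_def)
  also have "B = cell_mat \<beta> (zip t y) * U"
  proof (rule eq_matI)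
    fix p q assume "p < dim_row (cell_mat \<beta> (zip t y) * U)" "q < dim_col (cell_mat \<beta> (zip t y) * U)"
    then have pq: "p < m" "q < m" by (auto simp: cell_mat_def U_def sum_beta)
    have yp: "y ! p \<in> {1..n}" using y pq nth_mem[of p y] unfolding multi_idx_def by blast
    have tp: "t ! p \<in> {1..n}" using t pq len nth_mem[of p t] unfolding words_def length_beta by blast
    have "(cell_mat \<beta> (zip t y) * U) $$ (p, q) = (\<Sum>r<m. (if (t ! p, y ! p) = ?c r then 1 else 0) * U $$ (r, q))"
      using pq len by (simp add: cell_mat_def U_def sum_beta scalar_prod_def atLeast0LessThan)
    also have "\<dots> = B $$ (p, q)"
    proof (cases "(t ! p, y ! p) \<in> diagram \<beta>")
      case True
      then obtain r where r: "r < m" "?c r = (t ! p, y ! p)"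
        by (metis in_set_conv_nth length_cells set_cells sum_beta)
      have "(\<Sum>s<m. (if (t ! p, y ! p) = ?c s then 1 else 0) * U $$ (s, q)) = (\<Sum>s<m. if s = r then U $$ (r, q) else 0)"
        using r by (intro sum.cong) (auto simp: r(2)[symmetric] nth_eq_iff_index_eq sum_beta)
      also have "\<dots> = B $$ (p, q)" using r pq by (simp add: U_def B_def)
      finally show ?thesis .
    next
      case False
      then have "(t ! p, y ! p) \<noteq> ?c r" if "r < m" for r using cq[OF that] by auto
      then have "(\<Sum>s<m. (if (t ! p, y ! p) = ?c s then 1 else 0) * U $$ (s, q)) = 0"
        by (intro sum.neutral ballI) simp
      \<comment> \<open>Here the shape matters: a pair outside the diagram lies beyond all cells
        with the same first coordinate, so only entries of u below the diagonal are met, and these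
        vanish.\<close>
      moreover have "B $$ (p, q) = 0"
      proof (cases "t ! p = fst (?c q)")
        case True
        have "y ! p > \<beta> ! (t ! p - 1)" using False yp tp by (auto simp: diagram_def length_beta)
        moreover have "snd (?c q) \<le> \<beta> ! (t ! p - 1)" using cq[OF pq(2)] True by (auto simp: diagram_def)
        ultimately show ?thesis using True pq yp sndc[OF pq(2)] u0[of "y ! p" "snd (?c q)"] by (auto simp: B_def)
      qed (use pq in \<open>simp add: B_def\<close>)
      ultimately show ?thesis by simp
    qed
    finally show "B $$ (p, q) = (cell_mat \<beta> (zip t y) * U) $$ (p, q)" by simp
  qed (auto simp: B_def cell_mat_def U_def sum_beta)
  also have "det \<dots> = det (cell_mat \<beta> (zip t y)) * det U"
    by (rule det_mult[of _ m]) (use cell_mat_carrier[of \<beta>] in \<open>auto simp: U_def sum_beta\<close>)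
  \<comment> \<open>Cells with equal first coordinate are listed by increasing second one, so
    \<open>U\<close> inherits the triangular form of u with ones on the diagonal.\<close>
  also have "det U = prod_list (diag_mat U)"
  proof (rule det_upper_triangular[of _ m])
    show "upper_triangular U"
      unfolding upper_triangular_def
    proof (intro allI impI)
      fix p q assume "p < dim_row U" "q < p"
      then have pq: "p < m" "q < m" "q < p" by (auto simp: U_def)
      have "?c q \<le> ?c p" using pq sorted_nth_mono[OF sorted_cells[of \<beta>], of q p] by (simp add: sum_beta)
      moreover have "?c q \<noteq> ?c p" using pq by (simp add: nth_eq_iff_index_eq sum_beta)
      ultimately have "fst (?c p) = fst (?c q) \<Longrightarrow> snd (?c q) < snd (?c p)"
        by (auto simp: less_eq_prod_def less_le prod_eq_iff split: prod.splits)
      then show "U $$ (p, q) = 0" using pq sndc[OF pq(1)] sndc[OF pq(2)] u0 by (auto simp: U_def)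
    qed
  qed (auto simp: U_def)
  also have "prod_list (diag_mat U) = 1"
    unfolding prod_list_diag_prod using u1[OF sndc] by (intro prod.neutral) (auto simp: U_def)
  finally show ?thesis using form len by simp
qed

end

section \<open>Raising operators on words\<close>

text \<open>The action of the matrix unit E_{j,j+1} on coefficient functions: the new coefficient at
  w is collected from the words that have j + 1 in place of one j of w, which is why the
  substitution goes upwards. Likewise \<open>lower_op\<close> is E_{j+1,j}.\<close>

definition raise_op :: "nat \<Rightarrow> (nat list \<Rightarrow> complex) \<Rightarrow> nat list \<Rightarrow> complex" where
  "raise_op j f w = (\<Sum>p | p < length w \<and> w ! p = j. f (w[p := Suc j]))"

definition lower_op :: "nat \<Rightarrow> (nat list \<Rightarrow> complex) \<Rightarrow> nat list \<Rightarrow> complex" where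
  "lower_op j f w = (\<Sum>p | p < length w \<and> w ! p = Suc j. f (w[p := j]))"

lemma count_list_card: "count_list w c = card {p. p < length w \<and> w ! p = c}"
proof -
  have "{p. p < length w \<and> w ! p = c} = {p. p < length w \<and> c = w ! p}" by auto
  then show ?thesis by (simp add: count_list_eq_length_filter length_filter_conv_card)
qed

lemma multi_idx_update: "w \<in> multi_idx m n \<Longrightarrow> a \<in> {1..n} \<Longrightarrow> w[p := a] \<in> multi_idx m n"
  using set_update_subset_insert[of w p a] by (auto simp: multi_idx_def)

lemma multi_idx_nth: "w \<in> multi_idx m n \<Longrightarrow> p < m \<Longrightarrow> w ! p \<in> {1..n}"
  unfolding multi_idx_def using nth_mem by blast

lemma finite_multi_idx [simp]: "finite (multi_idx m n)"
  unfolding multi_idx_def using finite_lists_length_eq[of "{1..n}" m] by (simp add: conj_commute)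

text \<open>The relation [E, F] = H of sl_2. Changing one j and one j + 1 at different positions
  gives the same double sum in either order. Undoing the first change returns \<open>f w\<close>
  once for every j in one order and once for every j + 1 in the other.\<close>

lemma raise_lower_commutator:
  "raise_op j (lower_op j f) w =
     lower_op j (raise_op j f) w + (of_nat (count_list w j) - of_nat (count_list w (Suc j))) * f w"
proof -
  let ?P = "{p. p < length w \<and> w ! p = j}" and ?Q = "{p. p < length w \<and> w ! p = Suc j}"
  have fin: "finite ?P" "finite ?Q" by auto
  have 1: "lower_op j f (w[p := Suc j]) = f w + (\<Sum>q\<in>?Q. f (w[p := Suc j, q := j]))" if p: "p \<in> ?P" for p
  proof -
    have "{q. q < length (w[p := Suc j]) \<and> w[p := Suc j] ! q = Suc j} = insert p ?Q"
      using p by (auto simp: nth_list_update)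
    moreover have "w[p := j] = w" using p by (metis (mono_tags) list_update_id mem_Collect_eq)
    ultimately show ?thesis using p by (simp add: lower_op_def)
  qed
  have 2: "raise_op j f (w[q := j]) = f w + (\<Sum>p\<in>?P. f (w[p := Suc j, q := j]))" if q: "q \<in> ?Q" for q
  proof -
    have "{p. p < length (w[q := j]) \<and> w[q := j] ! p = j} = insert q ?P"
      using q by (auto simp: nth_list_update)
    moreover have "w[q := Suc j] = w" using q by (metis (mono_tags) list_update_id mem_Collect_eq)
    moreover have "(\<Sum>p\<in>?P. f (w[q := j, p := Suc j])) = (\<Sum>p\<in>?P. f (w[p := Suc j, q := j]))"
      using q by (intro sum.cong refl arg_cong[of _ _ f] list_update_swap) auto
    ultimately show ?thesis using q by (simp add: raise_op_def)
  qed
  have "raise_op j (lower_op j f) w = (\<Sum>p\<in>?P. f w + (\<Sum>q\<in>?Q. f (w[p := Suc j, q := j])))"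
    unfolding raise_op_def[of j "lower_op j f"] using 1 by (intro sum.cong) auto
  moreover have "lower_op j (raise_op j f) w = (\<Sum>q\<in>?Q. f w + (\<Sum>p\<in>?P. f (w[p := Suc j, q := j])))"
    unfolding lower_op_def[of j "raise_op j f"] using 2 by (intro sum.cong) auto
  moreover have "(\<Sum>q\<in>?Q. \<Sum>p\<in>?P. f (w[p := Suc j, q := j])) = (\<Sum>p\<in>?P. \<Sum>q\<in>?Q. f (w[p := Suc j, q := j]))"
    by (rule sum.swap)
  ultimately show ?thesis
    by (simp add: sum.distrib count_list_card algebra_simps)
qed

text \<open>Changing the marked letter matches the words with a marked j to the words with a marked
  j + 1; the bounds on j keep the result inside \<open>multi_idx m n\<close>.\<close>

lemma raise_lower_adjoint:
  assumes "1 \<le> j" "Suc j \<le> n"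
  shows "(\<Sum>w\<in>multi_idx m n. g w * raise_op j f w) = (\<Sum>w\<in>multi_idx m n. lower_op j g w * f w)"
proof -
  let ?W = "multi_idx m n"
  have len: "w \<in> ?W \<Longrightarrow> length w = m" for w by (simp add: multi_idx_def)
  have up: "w[p := j] \<in> ?W" "w[p := Suc j] \<in> ?W" if "w \<in> ?W" for w p
    using multi_idx_update[OF that] assms by auto
  have "(\<Sum>w\<in>?W. g w * raise_op j f w) =
      (\<Sum>(w, p)\<in>Sigma ?W (\<lambda>w. {p. p < length w \<and> w ! p = j}). g w * f (w[p := Suc j]))"
    by (simp add: raise_op_def sum_distrib_left sum.Sigma)
  also have "\<dots> = (\<Sum>(w, p)\<in>Sigma ?W (\<lambda>w. {p. p < length w \<and> w ! p = Suc j}). g (w[p := j]) * f w)"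
    by (rule sum.reindex_bij_witness[of _ "\<lambda>(w, p). (w[p := j], p)" "\<lambda>(w, p). (w[p := Suc j], p)"])
      (auto simp: up, metis up(2), metis list_update_id)
  also have "\<dots> = (\<Sum>w\<in>?W. lower_op j g w * f w)"
    by (simp add: lower_op_def sum_distrib_right sum.Sigma)
  finally show ?thesis .
qed

text \<open>By the commutator relation the weight times the squared norm of \<open>f\<close> is the squared norm of the lowered function.\<close>

lemma raise_zero_dominant:
  assumes j: "1 \<le> j" "Suc j \<le> n"
    and zero: "\<And>w. w \<in> multi_idx m n \<Longrightarrow> raise_op j f w = 0"
    and content: "\<And>w. w \<in> multi_idx m n \<Longrightarrow> f w \<noteq> 0 \<Longrightarrow> count_list w j = a \<and> count_list w (Suc j) = b"
    and "w0 \<in> multi_idx m n" "f w0 \<noteq> 0"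
  shows "b \<le> a"
proof -
  let ?W = "multi_idx m n"
  have nsq: "cnj z * z = complex_of_real ((cmod z)\<^sup>2)" for z by (metis complex_norm_square mult.commute)
  have l0: "lower_op j (raise_op j f) w = 0" if "w \<in> ?W" for w
    unfolding lower_op_def using zero multi_idx_update[OF that, of j] j by (intro sum.neutral) auto
  have "(\<Sum>w\<in>?W. cnj (f w) * raise_op j (lower_op j f) w) = (\<Sum>w\<in>?W. (of_nat a - of_nat b) * (cnj (f w) * f w))"
  proof (rule sum.cong)
    fix w assume w: "w \<in> ?W"
    show "cnj (f w) * raise_op j (lower_op j f) w = (of_nat a - of_nat b) * (cnj (f w) * f w)"
    proof (cases "f w = 0")
      case False
      then show ?thesis using content[OF w False] l0[OF w] by (simp add: raise_lower_commutator)
    qed simp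
  qed simp
  also have "\<dots> = of_real ((real a - real b) * (\<Sum>w\<in>?W. (cmod (f w))\<^sup>2))"
    unfolding nsq by (simp add: sum_distrib_left[symmetric])
  finally have 1: "(\<Sum>w\<in>?W. cnj (f w) * raise_op j (lower_op j f) w) =
    of_real ((real a - real b) * (\<Sum>w\<in>?W. (cmod (f w))\<^sup>2))" .
  have "(\<Sum>w\<in>?W. cnj (f w) * raise_op j (lower_op j f) w) = (\<Sum>w\<in>?W. lower_op j (\<lambda>w. cnj (f w)) w * lower_op j f w)"
    by (rule raise_lower_adjoint[OF j])
  also have "\<dots> = (\<Sum>w\<in>?W. cnj (lower_op j f w) * lower_op j f w)"
    by (simp add: lower_op_def)
  also have "\<dots> = of_real (\<Sum>w\<in>?W. (cmod (lower_op j f w))\<^sup>2)"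
    unfolding nsq by simp
  finally have "(real a - real b) * (\<Sum>w\<in>?W. (cmod (f w))\<^sup>2) = (\<Sum>w\<in>?W. (cmod (lower_op j f w))\<^sup>2)"
    using 1 by (simp only: of_real_eq_iff)
  moreover have "(\<Sum>w\<in>?W. (cmod (lower_op j f w))\<^sup>2) \<ge> 0" by (intro sum_nonneg) auto
  moreover have "(\<Sum>w\<in>?W. (cmod (f w))\<^sup>2) > 0"
    using assms(5,6) by (intro sum_pos2[of _ w0]) auto
  ultimately have "real a - real b \<ge> 0" by (metis zero_le_mult_iff not_le)
  then show ?thesis by simp
qed

text \<open>The lattice condition is imposed on suffixes, since the search for such a word peels off
  first letters. It starts at j = 1 because letters do.\<close>

primrec yamanouchi :: "nat list \<Rightarrow> bool" where
  "yamanouchi [] \<longleftrightarrow> True"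
| "yamanouchi (x # w) \<longleftrightarrow> yamanouchi w \<and> (\<forall>j\<ge>1. count_list (x # w) (Suc j) \<le> count_list (x # w) j)"

lemma raise_op_Cons: "raise_op j f (i # w) = raise_op j (\<lambda>v. f (i # v)) w + (if i = j then f (Suc j # w) else 0)"
proof -
  have eq: "{p. p < length (i # w) \<and> (i # w) ! p = j} =
      Suc ` {p. p < length w \<and> w ! p = j} \<union> (if i = j then {0} else {})"
    by (auto simp: image_iff less_Suc_eq_0_disj nth_Cons')
  show ?thesis
    unfolding raise_op_def eq by (subst sum.union_disjoint) (auto simp: sum.reindex)
qed

lemma multi_idx_Cons: "x # w \<in> multi_idx (Suc m) n \<longleftrightarrow> x \<in> {1..n} \<and> w \<in> multi_idx m n"
  by (auto simp: multi_idx_def)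

text \<open>
  Among the first letters occurring in the support of \<open>f\<close> the largest one gives a function on shorter words
  that is again killed by the raising operators.
\<close>

lemma highest_weight_yamanouchi:
  assumes "\<And>j w. 1 \<le> j \<Longrightarrow> Suc j \<le> n \<Longrightarrow> w \<in> multi_idx m n \<Longrightarrow> raise_op j f w = 0"
    and "\<And>w i. w \<in> multi_idx m n \<Longrightarrow> f w \<noteq> 0 \<Longrightarrow> count_list w i = a i"
    and "w0 \<in> multi_idx m n" "f w0 \<noteq> 0"
  shows "\<exists>w\<in>multi_idx m n. yamanouchi w \<and> f w \<noteq> 0"
  using assms
proof (induction m arbitrary: f a w0)
  case 0
  then show ?case by (intro bexI[of _ w0]) (auto simp: multi_idx_def)
next
  case (Suc m)
  define I where "I = {i\<in>{1..n}. \<exists>w\<in>multi_idx m n. f (i # w) \<noteq> 0}"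
  have "finite I" by (simp add: I_def)
  moreover have "I \<noteq> {}"
    using Suc.prems(3,4) by (cases w0) (auto simp: I_def multi_idx_Cons, simp add: multi_idx_def)
  ultimately have "Max I \<in> I" and max: "\<And>i. i \<in> I \<Longrightarrow> i \<le> Max I" by auto
  then obtain i v0 where i: "i = Max I" "i \<in> {1..n}" "v0 \<in> multi_idx m n" "f (i # v0) \<noteq> 0" by (auto simp: I_def)
  have "\<exists>w\<in>multi_idx m n. yamanouchi w \<and> f (i # w) \<noteq> 0"
  proof (rule Suc.IH[of "\<lambda>v. f (i # v)" "\<lambda>k. a k - (if k = i then 1 else 0)" v0])
    fix j w assume jw: "1 \<le> j" "Suc j \<le> n" "w \<in> multi_idx m n"
    \<comment> \<open>This kills the extra term of \<open>raise_op_Cons\<close>: a first letter i +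
      1 would contradict the maximality of i.\<close>
    have "f (Suc j # w) = 0" if "i = j"
    proof (rule ccontr)
      assume "f (Suc j # w) \<noteq> 0"
      then have "Suc j \<in> I" using jw by (auto simp: I_def)
      then show False using max i that by fastforce
    qed
    then show "raise_op j (\<lambda>v. f (i # v)) w = 0"
      using Suc.prems(1)[of j "i # w"] jw i by (auto simp: raise_op_Cons multi_idx_Cons split: if_splits)
  next
    fix w k assume "w \<in> multi_idx m n" "f (i # w) \<noteq> 0"
    then have "count_list (i # w) k = a k" using i by (intro Suc.prems(2)) (auto simp: multi_idx_Cons)
    then show "count_list w k = a k - (if k = i then 1 else 0)" by (auto split: if_splits)
  qed (use i in auto)
  then obtain w where w: "w \<in> multi_idx m n" "yamanouchi w" "f (i # w) \<noteq> 0" by blast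
  have iw: "i # w \<in> multi_idx (Suc m) n" using w i by (simp add: multi_idx_Cons)
  \<comment> \<open>The proper suffixes are settled by the induction hypothesis. For the whole word
    the condition says that the weight \<open>a\<close> is dominant.\<close>
  have "count_list (i # w) (Suc j) \<le> count_list (i # w) j" if "1 \<le> j" for j
  proof (cases "Suc j \<le> n")
    case True
    have "a (Suc j) \<le> a j"
      using that True Suc.prems by (intro raise_zero_dominant[of j n "Suc m" f "a j" "a (Suc j)" w0]) auto
    then show ?thesis using Suc.prems(2)[OF iw] w by metis
  next
    case False
    then have "Suc j \<notin> set (i # w)" using iw by (auto simp: multi_idx_def)
    then show ?thesis by (metis count_notin le0)
  qed
  then have "yamanouchi (i # w)" using w by simp
  then show ?case using iw w by blast
qed

text \<open>
  Apply the elementary unipotent matrix with the extra entry in row \<open>j\<close>; for reasons of weight only the part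
  that changes exactly one letter contributes.
\<close>

lemma unipotent_invariant_raise_zero:
  assumes inv: "\<And>u y. unitriangular n u \<Longrightarrow> y \<in> multi_idx m n \<Longrightarrow>
      (\<Sum>w\<in>multi_idx m n. f w * (\<Prod>p<m. u $$ (y ! p - 1, w ! p - 1))) = f y"
    and content: "\<And>w i. w \<in> multi_idx m n \<Longrightarrow> f w \<noteq> 0 \<Longrightarrow> count_list w i = a i"
    and j: "1 \<le> j" "Suc j \<le> n" and y: "y \<in> multi_idx m n"
  shows "raise_op j f y = 0"
proof (cases "\<exists>p. p < length y \<and> y ! p = j \<and> f (y[p := Suc j]) \<noteq> 0")
  case False
  then show ?thesis unfolding raise_op_def by (intro sum.neutral) auto
next
  case True
  then obtain p0 where p0: "p0 < length y" "y ! p0 = j" "f (y[p0 := Suc j]) \<noteq> 0" by blast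
  have leny: "length y = m" using y by (simp add: multi_idx_def)
  let ?P = "{p. p < length y \<and> y ! p = j}"
  have up: "y[p := Suc j] \<in> multi_idx m n" for p using multi_idx_update[OF y] j by auto
  have "count_list (y[p0 := Suc j]) j = a j" using content[OF up p0(3)] .
  moreover have "count_list (y[p0 := Suc j]) j = card (?P - {p0})"
    unfolding count_list_card using p0 by (intro arg_cong[of _ _ card]) (auto simp: nth_list_update split: if_splits)
  ultimately have aj: "card (?P - {p0}) = a j" by simp
  then have cP: "card ?P = Suc (a j)" using card_Suc_Diff1[of ?P p0] p0 by simp
  \<comment> \<open>Raising one j of y leads into the support of f, so y itself has one j too many
    for the prescribed content.\<close>
  then have fy: "f y = 0" using content[OF y, of j] by (auto simp: count_list_card)
  define u :: "complex mat" where "u = mat n n (\<lambda>(i, k). if i = k \<or> i = j - 1 \<and> k = j then 1 else 0)"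
  have u: "unitriangular n u" using j by (auto simp: unitriangular_def u_def upper_triangular_def)
  define R where "R w \<longleftrightarrow> (\<forall>p<m. w ! p = y ! p \<or> y ! p = j \<and> w ! p = Suc j)" for w
  have prod: "(\<Prod>p<m. u $$ (y ! p - 1, w ! p - 1)) = (if R w then 1 else 0)" if w: "w \<in> multi_idx m n" for w
  proof -
    have e: "u $$ (y ! p - 1, w ! p - 1) = (if w ! p = y ! p \<or> y ! p = j \<and> w ! p = Suc j then 1 else 0)" if "p < m" for p
      using multi_idx_nth[OF w that] multi_idx_nth[OF y that] j by (auto simp: u_def)
    show ?thesis
    proof (cases "R w")
      case True
      then show ?thesis using e by (auto simp: R_def intro!: prod.neutral)
    next
      case False
      then obtain p where "p < m" "u $$ (y ! p - 1, w ! p - 1) = 0" using e by (auto simp: R_def)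
      then have "(\<Prod>p<m. u $$ (y ! p - 1, w ! p - 1)) = 0" by (intro prod_zero) auto
      then show ?thesis using False by simp
    qed
  qed
  \<comment> \<open>A word counted by \<open>R\<close> raises some set of the letters j of y, and
    the prescribed content forces this set to have exactly one element.\<close>
  have single: "w \<in> (\<lambda>p. y[p := Suc j]) ` ?P" if w: "w \<in> multi_idx m n" "R w" "f w \<noteq> 0" for w
  proof -
    have lenw: "length w = m" using w by (simp add: multi_idx_def)
    let ?A = "{p. p < m \<and> y ! p = j \<and> w ! p = Suc j}"
    have "card {p. p < m \<and> w ! p = j} = a j" using content[OF w(1,3), of j] lenw by (simp add: count_list_card)
    moreover have "card {p. p < m \<and> w ! p = j} = card (?P - ?A)"
      using w(2) by (intro arg_cong[of _ _ card]) (auto simp: R_def leny)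
    moreover have "card (?P - ?A) = card ?P - card ?A" by (intro card_Diff_subset) (auto simp: leny)
    moreover have "card ?A \<le> card ?P" by (intro card_mono) (auto simp: leny)
    ultimately have "card ?A = 1" using cP by linarith
    then obtain p where p: "?A = {p}" by (auto simp: card_1_singleton_iff)
    then have "p \<in> ?A" by simp
    moreover have "w = y[p := Suc j]"
    proof (rule nth_equalityI)
      fix q assume "q < length w"
      then have q: "q < m" by (simp add: lenw)
      show "w ! q = y[p := Suc j] ! q"
      proof (cases "q = p")
        case True
        then show ?thesis using \<open>p \<in> ?A\<close> leny by simp
      next
        case False
        then have "q \<notin> ?A" using p by auto
        then show ?thesis using w(2) q False by (auto simp: R_def)
      qed
    qed (simp add: lenw leny)
    ultimately show ?thesis using leny by auto
  qed
  have "0 = (\<Sum>w\<in>multi_idx m n. f w * (\<Prod>p<m. u $$ (y ! p - 1, w ! p - 1)))"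
    using inv[OF u y] fy by simp
  also have "\<dots> = (\<Sum>w\<in>(\<lambda>p. y[p := Suc j]) ` ?P. f w)"
  proof (rule sum.mono_neutral_cong_right)
    show "(\<lambda>p. y[p := Suc j]) ` ?P \<subseteq> multi_idx m n" using up by auto
    show "\<forall>w\<in>multi_idx m n - (\<lambda>p. y[p := Suc j]) ` ?P. f w * (\<Prod>p<m. u $$ (y ! p - 1, w ! p - 1)) = 0"
      using single prod by (auto split: if_splits)
    show "f w * (\<Prod>p<m. u $$ (y ! p - 1, w ! p - 1)) = f w" if "w \<in> (\<lambda>p. y[p := Suc j]) ` ?P" for w
    proof -
      have "w \<in> multi_idx m n" "R w" using that up by (auto simp: R_def leny nth_list_update split: if_splits)
      then show ?thesis by (simp only: prod if_True mult_1_right)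
    qed
  qed simp
  also have "\<dots> = raise_op j f y"
    unfolding raise_op_def
  proof (subst sum.reindex)
    show "inj_on (\<lambda>p. y[p := Suc j]) ?P"
    proof (rule inj_onI)
      fix p q assume pq: "p \<in> ?P" "q \<in> ?P" "y[p := Suc j] = y[q := Suc j]"
      have "y[p := Suc j] ! p = Suc j" using pq(1) by simp
      moreover have "y[q := Suc j] ! p = j" if "p \<noteq> q" using pq(1) that by simp
      ultimately show "p = q" using pq(3) by (metis n_not_Suc_n)
    qed
  qed simp
  finally show ?thesis by simp
qed

section \<open>Tables and their rows\<close>

definition transp :: "nat \<Rightarrow> nat list list \<Rightarrow> nat list list" where
  "transp d X = map (table_row X) [0..<d]"

definition set_row :: "nat list list \<Rightarrow> nat \<Rightarrow> nat list \<Rightarrow> nat list list" where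
  "set_row X k w = map2 (\<lambda>c a. c[k := a]) X w"

text \<open>The matrix entry at (Y, X) of the action of u on the tensor power of V whose exponent is
  the number of columns.\<close>

definition table_coef :: "nat \<Rightarrow> complex mat list \<Rightarrow> nat list list \<Rightarrow> nat list list \<Rightarrow> complex" where
  "table_coef d u Y X = (\<Prod>p<length X. \<Prod>k<d. (u ! k) $$ (Y ! p ! k - 1, X ! p ! k - 1))"

text \<open>The kernel of the whole proof: up to 1 / \<open>table_norm\<close> these are the
  coefficients of \<open>Delta_vec\<close> and \<open>Nabla_vec\<close>, by
  \<open>table_form_sgn\<close>.\<close>

definition table_form :: "nat \<Rightarrow> nat list list \<Rightarrow> nat list list \<Rightarrow> complex" where
  "table_form d T X = (\<Prod>k<d. of_int (row_form (table_row T k) (table_row X k)))"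

lemma table_form_sgn: "table_form d T X = of_int (table_sign d T) * of_int (table_sgn d T X)"
  by (simp add: table_form_def table_sign_def table_sgn_def row_form_def prod.distrib flip: of_int_mult of_int_prod)

lemma length_table_row [simp]: "length (table_row X k) = length X"
  by (simp add: table_row_def)

lemma table_row_nth [simp]: "p < length X \<Longrightarrow> table_row X k ! p = X ! p ! k"
  by (simp add: table_row_def)

lemma finite_all_tables [simp]: "finite (all_tables d n m)"
  unfolding all_tables_def using finite_lists_length_eq[of "multi_idx d n" m] by (simp add: conj_commute)

lemma all_tables_length: "X \<in> all_tables d n m \<Longrightarrow> length X = m"
  by (simp add: all_tables_def)

lemma all_tables_nth: "X \<in> all_tables d n m \<Longrightarrow> p < m \<Longrightarrow> X ! p \<in> multi_idx d n"
  unfolding all_tables_def using nth_mem by blast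

lemma all_tables_nth_length: "X \<in> all_tables d n m \<Longrightarrow> p < m \<Longrightarrow> length (X ! p) = d"
  using all_tables_nth by (auto simp: multi_idx_def)

lemma all_tablesI:
  assumes "length X = m" "\<And>p. p < m \<Longrightarrow> length (X ! p) = d" "\<And>p k. p < m \<Longrightarrow> k < d \<Longrightarrow> X ! p ! k \<in> {1..n}"
  shows "X \<in> all_tables d n m"
  using assms by (fastforce simp: all_tables_def multi_idx_def in_set_conv_nth)

lemma table_row_multi_idx:
  assumes "X \<in> all_tables d n m" "k < d"
  shows "table_row X k \<in> multi_idx m n"
proof -
  have "X ! p ! k \<in> {1..n}" if "p < m" for p
    using all_tables_nth[OF assms(1) that] assms(2) by (rule multi_idx_nth)
  then show ?thesis using all_tables_length[OF assms(1)] by (force simp: multi_idx_def in_set_conv_nth)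
qed

lemma all_tables_eqI:
  assumes "X \<in> all_tables d n m" "Y \<in> all_tables d n m" "\<And>k. k < d \<Longrightarrow> table_row X k = table_row Y k"
  shows "X = Y"
proof (rule nth_equalityI)
  show "length X = length Y" using assms all_tables_length by metis
  fix p assume "p < length X"
  then have p: "p < m" using all_tables_length[OF assms(1)] by simp
  show "X ! p = Y ! p"
  proof (rule nth_equalityI)
    show "length (X ! p) = length (Y ! p)" using all_tables_nth_length p assms by metis
    fix k assume "k < length (X ! p)"
    then have "k < d" using all_tables_nth_length[OF assms(1) p] by simp
    then have "table_row X k ! p = table_row Y k ! p" using assms(3) by simp
    then show "X ! p ! k = Y ! p ! k" using p assms all_tables_length by (metis table_row_nth)
  qed
qed

lemma transp_nth [simp]: "k < d \<Longrightarrow> transp d X ! k = table_row X k"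
  by (simp add: transp_def)

lemma transp_all_tables:
  assumes "X \<in> all_tables d n m"
  shows "transp d X \<in> all_tables m n d"
  using assms table_row_multi_idx[OF assms] by (auto simp: all_tables_def transp_def)

lemma table_row_transp:
  assumes "X \<in> all_tables d n m" "p < m"
  shows "table_row (transp d X) p = X ! p"
  using assms all_tables_length[OF assms(1)] all_tables_nth_length[OF assms]
  by (intro nth_equalityI) (auto simp: transp_def)

lemma transp_transp:
  assumes "X \<in> all_tables d n m"
  shows "transp m (transp d X) = X"
  using assms table_row_transp[OF assms] all_tables_length[OF assms]
  by (intro nth_equalityI) (auto simp: transp_def)

text \<open>Transposed, a table is an arbitrary list of d words, so \<open>sum_prod_lists\<close>
  applies with words as letters.\<close>

lemma sum_tables_prod_rows:
  fixes g :: "nat \<Rightarrow> nat list \<Rightarrow> complex"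
  shows "(\<Sum>X\<in>all_tables d n m. \<Prod>k<d. g k (table_row X k)) = (\<Prod>k<d. \<Sum>w\<in>multi_idx m n. g k w)"
proof -
  have "(\<Sum>X\<in>all_tables d n m. \<Prod>k<d. g k (table_row X k)) = (\<Sum>R\<in>all_tables m n d. \<Prod>k<d. g k (R ! k))"
    by (rule sum.reindex_bij_witness[of _ "transp m" "transp d"]) (auto simp: transp_all_tables transp_transp)
  then show ?thesis unfolding all_tables_def[of m n d] by (simp only: sum_prod_lists)
qed

lemma set_row_nth: "p < length X \<Longrightarrow> length w = length X \<Longrightarrow> set_row X k w ! p = (X ! p)[k := w ! p]"
  by (simp add: set_row_def)

lemma set_row_all_tables:
  assumes "X \<in> all_tables d n m" "w \<in> multi_idx m n"
  shows "set_row X k w \<in> all_tables d n m"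
proof -
  have len: "length X = m" "length w = m" using assms by (auto simp: all_tables_def multi_idx_def)
  have "set_row X k w ! p \<in> multi_idx d n" if "p < m" for p
    using that len all_tables_nth[OF assms(1) that] multi_idx_nth[OF assms(2) that]
    by (simp add: set_row_nth multi_idx_update)
  then show ?thesis using len by (force simp: all_tables_def set_row_def in_set_conv_nth)
qed

lemma table_row_set_row:
  assumes "X \<in> all_tables d n m" "w \<in> multi_idx m n" "i < d"
  shows "table_row (set_row X k w) i = (if i = k then w else table_row X i)"
proof -
  have len: "length X = m" "length w = m" using assms by (auto simp: all_tables_def multi_idx_def)
  have "length (set_row X k w) = m" using len by (simp add: set_row_def)
  then show ?thesis using len all_tables_nth_length[OF assms(1)] assms(3)
    by (intro nth_equalityI) (auto simp: set_row_nth nth_list_update)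
qed

lemma set_row_same:
  assumes "X \<in> all_tables d n m" "k < d"
  shows "set_row X k (table_row X k) = X"
proof (rule all_tables_eqI)
  have w: "table_row X k \<in> multi_idx m n" using assms table_row_multi_idx by blast
  show "set_row X k (table_row X k) \<in> all_tables d n m" using assms w set_row_all_tables by blast
  show "table_row (set_row X k (table_row X k)) i = table_row X i" if "i < d" for i
    using table_row_set_row[OF assms(1) w that] by simp
qed (rule assms)

lemma table_coef_rows:
  assumes "length X = m" "length Y = m"
  shows "table_coef d u Y X = (\<Prod>k<d. \<Prod>p<m. (u ! k) $$ (table_row Y k ! p - 1, table_row X k ! p - 1))"
  unfolding table_coef_def using assms by (subst prod.swap) simp

text \<open>Invariance is formulated in the tensor power, before passing to an algebra, so that it
  serves the symmetric and the exterior case alike.\<close>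

definition table_invariant :: "nat \<Rightarrow> nat \<Rightarrow> nat \<Rightarrow> (nat list list \<Rightarrow> complex) \<Rightarrow> bool" where
  "table_invariant d n m f \<longleftrightarrow> (\<forall>u. length u = d \<longrightarrow> (\<forall>k<d. unitriangular n (u ! k)) \<longrightarrow>
     (\<forall>Y\<in>all_tables d n m. (\<Sum>X\<in>all_tables d n m. f X * table_coef d u Y X) = f Y))"

lemma prod_one_mat:
  assumes "y \<in> multi_idx m n" "w \<in> multi_idx m n"
  shows "(\<Prod>p<m. (1\<^sub>m n :: complex mat) $$ (y ! p - 1, w ! p - 1)) = (if w = y then 1 else 0)"
proof -
  have e: "(1\<^sub>m n :: complex mat) $$ (y ! p - 1, w ! p - 1) = (if w ! p = y ! p then 1 else 0)" if "p < m" for p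
    using multi_idx_nth[OF assms(1) that] multi_idx_nth[OF assms(2) that] by auto
  have len: "length y = m" "length w = m" using assms by (auto simp: multi_idx_def)
  show ?thesis
  proof (cases "w = y")
    case True
    then show ?thesis using e by (auto intro!: prod.neutral)
  next
    case False
    then obtain p where "p < m" "w ! p \<noteq> y ! p" using len nth_equalityI by metis
    then have "(\<Prod>p<m. (1\<^sub>m n :: complex mat) $$ (y ! p - 1, w ! p - 1)) = 0"
      using e by (intro prod_zero) (auto intro!: bexI[of _ p])
    then show ?thesis using False by simp
  qed
qed

text \<open>Put u in place k and identity matrices elsewhere: then only tables that agree with X
  outside row k contribute.\<close>

lemma table_invariant_slice:
  assumes inv: "table_invariant d n m f" and X: "X \<in> all_tables d n m" and k: "k < d"
    and u: "unitriangular n u" and y: "y \<in> multi_idx m n"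
  shows "(\<Sum>w\<in>multi_idx m n. f (set_row X k w) * (\<Prod>p<m. u $$ (y ! p - 1, w ! p - 1))) = f (set_row X k y)"
proof -
  let ?U = "(replicate d (1\<^sub>m n))[k := u]" and ?Y = "set_row X k y"
  have Y: "?Y \<in> all_tables d n m" using set_row_all_tables[OF X y] .
  have "unitriangular n (?U ! i)" if "i < d" for i
    using that u by (cases "i = k") (auto simp: unitriangular_def)
  then have "(\<Sum>Z\<in>all_tables d n m. f Z * table_coef d ?U ?Y Z) = f ?Y"
    using inv Y unfolding table_invariant_def by simp
  moreover have "(\<Sum>Z\<in>all_tables d n m. f Z * table_coef d ?U ?Y Z) =
      (\<Sum>Z\<in>set_row X k ` multi_idx m n. f Z * table_coef d ?U ?Y Z)"
  proof (rule sum.mono_neutral_right)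
    show "set_row X k ` multi_idx m n \<subseteq> all_tables d n m" using set_row_all_tables[OF X] by auto
    show "\<forall>Z\<in>all_tables d n m - set_row X k ` multi_idx m n. f Z * table_coef d ?U ?Y Z = 0"
    proof
      fix Z assume Z: "Z \<in> all_tables d n m - set_row X k ` multi_idx m n"
      let ?w = "table_row Z k"
      have w: "?w \<in> multi_idx m n" using table_row_multi_idx k Z by blast
      have "Z \<noteq> set_row X k ?w" using Z w by blast
      then obtain i where i: "i < d" "table_row Z i \<noteq> table_row (set_row X k ?w) i"
        using all_tables_eqI[of Z d n m "set_row X k ?w"] Z set_row_all_tables[OF X w] by blast
      then have ik: "i \<noteq> k" "table_row Z i \<noteq> table_row X i" using table_row_set_row[OF X w] by (auto split: if_splits)
      have rows: "table_row X i \<in> multi_idx m n" "table_row Z i \<in> multi_idx m n"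
        using table_row_multi_idx i Z X by blast+
      have "(\<Prod>p<m. (?U ! i) $$ (table_row ?Y i ! p - 1, table_row Z i ! p - 1)) = 0"
        using prod_one_mat[OF rows] ik i table_row_set_row[OF X y] by simp
      then have "table_coef d ?U ?Y Z = 0"
        using i Y Z all_tables_length by (subst table_coef_rows[of _ m]) (auto intro!: prod_zero)
      then show "f Z * table_coef d ?U ?Y Z = 0" by simp
    qed
  qed simp
  moreover have "(\<Sum>Z\<in>set_row X k ` multi_idx m n. f Z * table_coef d ?U ?Y Z) =
      (\<Sum>w\<in>multi_idx m n. f (set_row X k w) * table_coef d ?U ?Y (set_row X k w))"
  proof (rule sum.reindex_cong[of "set_row X k"])
    show "inj_on (set_row X k) (multi_idx m n)"
      using table_row_set_row[OF X _ k] by (metis inj_onI)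
  qed auto
  moreover have "table_coef d ?U ?Y (set_row X k w) = (\<Prod>p<m. u $$ (y ! p - 1, w ! p - 1))" if w: "w \<in> multi_idx m n" for w
  proof -
    have Z: "set_row X k w \<in> all_tables d n m" using set_row_all_tables[OF X w] .
    have "(\<Prod>p<m. (?U ! i) $$ (table_row ?Y i ! p - 1, table_row (set_row X k w) i ! p - 1)) =
        (if i = k then \<Prod>p<m. u $$ (y ! p - 1, w ! p - 1) else 1)" if "i < d" for i
    proof (cases "i = k")
      case False
      have r: "table_row X i \<in> multi_idx m n" using table_row_multi_idx that X by blast
      show ?thesis using False prod_one_mat[OF r r] table_row_set_row[OF X y that] table_row_set_row[OF X w that] that by simp
    qed (use table_row_set_row[OF X y that] table_row_set_row[OF X w that] that in auto)
    then have "table_coef d ?U ?Y (set_row X k w) = (\<Prod>i<d. if i = k then \<Prod>p<m. u $$ (y ! p - 1, w ! p - 1) else 1)"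
      using Y Z all_tables_length by (subst table_coef_rows[of _ m]) (auto intro!: prod.cong)
    then show ?thesis using k by simp
  qed
  ultimately show ?thesis by simp
qed

section \<open>Highest weight functions are spanned by the kernel\<close>

text \<open>Numbers the occurrences of each letter from right to left. This yields the partner t of
  a word x for which the pairs enumerate the diagram.\<close>

primrec occ_word :: "nat list \<Rightarrow> nat list" where
  "occ_word [] = []"
| "occ_word (x # w) = count_list (x # w) x # occ_word w"

text \<open>Larger letters to the right weigh more: this is the reverse lexicographic order on words over \<open>{..<N}\<close>.\<close>

primrec word_code :: "nat \<Rightarrow> nat list \<Rightarrow> nat" where
  "word_code N [] = 0"
| "word_code N (x # w) = x + N * word_code N w"

lemma length_occ_word [simp]: "length (occ_word w) = length w"
  by (induction w) auto

lemma set_zip_occ_word: "set (zip (occ_word w) w) = {(c, r). 1 \<le> c \<and> c \<le> count_list w r}"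
proof (induction w)
  case (Cons x w)
  have "set (zip (occ_word (x # w)) (x # w)) = insert (Suc (count_list w x), x) {(c, r). 1 \<le> c \<and> c \<le> count_list w r}"
    by (simp add: Cons)
  also have "\<dots> = {(c, r). 1 \<le> c \<and> c \<le> count_list (x # w) r}" by (auto simp: le_Suc_eq)
  finally show ?case .
qed auto

lemma antimono_chain:
  fixes c :: "nat \<Rightarrow> nat"
  assumes "\<And>j. 1 \<le> j \<Longrightarrow> c (Suc j) \<le> c j" "1 \<le> i" "i \<le> k"
  shows "c k \<le> c i"
  using assms(3)
proof (induction k rule: dec_induct)
  case (step k)
  then show ?case using assms(1)[of k] assms(2) by linarith
qed simp

text \<open>Look at the rightmost difference, y' in place of y in front of a common suffix xs. The
  cells used by xs are those (c, r) with c at most the number of r in xs, so distinctness requires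
  y' to occur in xs at most as often as y. A smaller y' would, by the lattice condition on y # xs,
  occur in xs more often than y. Hence y' is larger, and the higher digit decides the code.\<close>

lemma yamanouchi_triangular:
  assumes "length x' = length x" "yamanouchi x" "distinct (zip (occ_word x) x')"
    and "set x \<subseteq> {1..<N}" "set x' \<subseteq> {1..<N}"
  shows "x' = x \<or> word_code N x < word_code N x'"
  using assms
proof (induction x arbitrary: x')
  case (Cons y xs)
  then obtain y' xs' where x': "x' = y' # xs'" "length xs' = length xs" by (cases x') auto
  have IH: "xs' = xs \<or> word_code N xs < word_code N xs'"
    using Cons.prems x' by (intro Cons.IH) auto
  have y: "1 \<le> y'" "y < N" using Cons.prems x' by auto
  show ?case
  proof (cases "xs' = xs")
    case False
    then have "Suc (word_code N xs) \<le> word_code N xs'" using IH by simp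
    then have "N * Suc (word_code N xs) \<le> N * word_code N xs'" by (rule mult_le_mono2)
    then show ?thesis using y x' by simp
  next
    case True
    have "(count_list (y # xs) y, y') \<notin> set (zip (occ_word xs) xs)"
      using Cons.prems(3) x' True by simp
    then have lt: "count_list xs y' < Suc (count_list xs y)" unfolding set_zip_occ_word by auto
    have "\<not> y' < y"
    proof
      assume "y' < y"
      have "count_list (y # xs) y \<le> count_list (y # xs) y'"
      proof (rule antimono_chain[of "count_list (y # xs)"])
        show "count_list (y # xs) (Suc j) \<le> count_list (y # xs) j" if "1 \<le> j" for j
          using Cons.prems(2) that unfolding yamanouchi.simps by blast
      qed (use y \<open>y' < y\<close> in simp_all)
      then show False using lt \<open>y' < y\<close> by simp
    qed
    then show ?thesis using x' True by (cases "y = y'") auto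
  qed
qed auto

section \<open>Triangularity of the row kernel on Yamanouchi words\<close>

context conj_pair
begin

lemma occ_word_enumerates:
  assumes "x \<in> words \<alpha>"
  shows "set (zip (occ_word x) x) = diagram \<beta>"
proof -
  interpret sw: conj_pair n m \<beta> \<alpha> by (rule conj_pair_swap)
  have "c \<le> count_list x r \<longleftrightarrow> r \<in> {1..n} \<and> c \<le> \<alpha> ! (r - 1)" if "1 \<le> c" for c r
  proof (cases "r \<in> {1..n}")
    case True
    then show ?thesis using assms by (auto simp: words_def length_alpha)
  next
    case False
    then have "count_list x r = 0" using assms by (intro count_notin) (auto simp: words_def length_alpha)
    then show ?thesis using False that by auto
  qed
  then have "set (zip (occ_word x) x) = prod.swap ` diagram \<alpha>"
    unfolding set_zip_occ_word by (force simp: diagram_def length_alpha image_iff)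
  then show ?thesis using sw.diagram_swap by simp
qed

text \<open>The transposed kernel value at x and \<open>occ_word x\<close> is a sign, hence nonzero.
  The support statement for the exchanged shapes then gives the content of
  \<open>occ_word x\<close>, and \<open>row_form_swap\<close> carries the value back.\<close>

lemma occ_word_words:
  assumes "x \<in> words \<alpha>"
  shows "occ_word x \<in> words \<beta>" "row_form (occ_word x) x \<noteq> 0"
proof -
  interpret sw: conj_pair n m \<beta> \<alpha> by (rule conj_pair_swap)
  have len: "length x = m" using sw.length_words[OF assms] .
  have "set (zip x (occ_word x)) = diagram \<alpha>"
    using occ_word_enumerates[OF assms] set_zip_swap[of x "occ_word x"] diagram_swap by simp
  then have "row_form x (occ_word x) = lex_sign (zip x (occ_word x))"
    using row_form_eq_lex_sign[OF assms, of "occ_word x"] by simp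
  then have nz: "row_form x (occ_word x) \<noteq> 0" using abs_lex_sign[of "zip x (occ_word x)"] by fastforce
  then show w: "occ_word x \<in> words \<beta>" using sw.row_form_support[OF assms] len by simp
  show "row_form (occ_word x) x \<noteq> 0" using row_form_swap[OF w assms] nz by auto
qed

lemma row_form_triangular:
  assumes x: "x \<in> words \<alpha>" "yamanouchi x" and x': "x' \<in> multi_idx m n" and nz: "row_form (occ_word x) x' \<noteq> 0"
  shows "x' = x \<or> word_code (Suc n) x < word_code (Suc n) x'"
proof (rule yamanouchi_triangular)
  interpret sw: conj_pair n m \<beta> \<alpha> by (rule conj_pair_swap)
  have len: "length x = m" "length x' = m" using sw.length_words x x' by (auto simp: multi_idx_def)
  then show "length x' = length x" by simp
  have "set (zip (occ_word x) x') = diagram \<beta>"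
    by (rule row_form_nonzero_diagram[OF occ_word_words(1)[OF x(1)] len(2) nz])
  then show "distinct (zip (occ_word x) x')"
    using len by (intro distinct_enumeration[of _ \<beta>]) (auto simp: sum_beta)
  show "set x \<subseteq> {1..<Suc n}" "set x' \<subseteq> {1..<Suc n}"
    using x x' by (auto simp: words_def length_alpha multi_idx_def)
qed (rule x)

end

locale conj_tables =
  fixes d n m :: nat and \<alpha> \<beta> :: "nat list list"
  assumes d_pos: "d \<ge> 1" and length_alpha: "length \<alpha> = d" and length_beta: "length \<beta> = d"
    and conj: "\<And>k. k < d \<Longrightarrow> conj_pair n m (\<alpha> ! k) (\<beta> ! k)"
begin

lemma conj_tables_swap: "conj_tables d n m \<beta> \<alpha>"
  using d_pos length_alpha length_beta conj_pair.conj_pair_swap[OF conj] by (intro conj_tables.intro) auto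

lemma tables_A_iff: "X \<in> tables_A \<alpha> \<longleftrightarrow> X \<in> all_tables d n m \<and> (\<forall>k<d. table_row X k \<in> words (\<alpha> ! k))"
proof
  assume X: "X \<in> tables_A \<alpha>"
  have row: "length (table_row X k) = m" "set (table_row X k) \<subseteq> {1..n}" if "k < d" for k
  proof -
    have "length (\<alpha> ! k) = n" "sum_list (\<alpha> ! k) = m" using conj[OF that] by (auto simp: conj_pair_def)
    then show "length (table_row X k) = m" "set (table_row X k) \<subseteq> {1..n}"
      using X that by (auto simp: tables_A_def words_def length_alpha)
  qed
  \<comment> \<open>The number of columns is read off from a row, which is where d \<ge> 1
    enters.\<close>
  have len: "length X = m" using row[of 0] d_pos by simp
  have "X ! p ! k \<in> {1..n}" if "p < m" "k < d" for p k
    using row(2)[OF that(2)] that len nth_mem[of p "table_row X k"] by (metis length_table_row subsetD table_row_nth)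
  then have "X \<in> all_tables d n m"
    using X len by (intro all_tablesI) (auto simp: tables_A_def length_alpha)
  then show "X \<in> all_tables d n m \<and> (\<forall>k<d. table_row X k \<in> words (\<alpha> ! k))"
    using X by (auto simp: tables_A_def length_alpha)
next
  assume X: "X \<in> all_tables d n m \<and> (\<forall>k<d. table_row X k \<in> words (\<alpha> ! k))"
  then show "X \<in> tables_A \<alpha>"
    by (auto simp: tables_A_def length_alpha all_tables_def multi_idx_def)
qed

lemma finite_tables_A [simp]: "finite (tables_A \<alpha>)"
  by (rule finite_subset[of _ "all_tables d n m"]) (auto simp: tables_A_iff)

lemma finite_tables_A_beta [simp]: "finite (tables_A \<beta>)"
  using conj_tables.finite_tables_A[OF conj_tables_swap] .

lemma tables_A_beta_iff: "X \<in> tables_A \<beta> \<longleftrightarrow> X \<in> all_tables d n m \<and> (\<forall>k<d. table_row X k \<in> words (\<beta> ! k))"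
  using conj_tables.tables_A_iff[OF conj_tables_swap] .

lemma table_form_support:
  assumes "T \<in> tables_A \<beta>" "X \<in> all_tables d n m" "table_form d T X \<noteq> 0"
  shows "X \<in> tables_A \<alpha>"
  unfolding tables_A_iff
proof (intro conjI allI impI)
  fix k assume k: "k < d"
  interpret conj_pair n m "\<alpha> ! k" "\<beta> ! k" by (rule conj[OF k])
  show "table_row X k \<in> words (\<alpha> ! k)"
  proof (rule row_form_support)
    show "table_row T k \<in> words (\<beta> ! k)" using assms k by (simp add: tables_A_beta_iff)
    show "length (table_row X k) = m" using assms all_tables_length by simp
    show "row_form (table_row T k) (table_row X k) \<noteq> 0" using assms(3) k by (auto simp: table_form_def)
  qed
qed (rule assms)

text \<open>Kernel and action coefficients are both products over the rows, so the sum over tables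
  factors into the row sums of \<open>row_form_invariant\<close>.\<close>

lemma table_form_invariant:
  assumes "T \<in> tables_A \<beta>"
  shows "table_invariant d n m (table_form d T)"
  unfolding table_invariant_def
proof (intro allI impI ballI)
  fix u Y assume u: "length u = d" "\<forall>k<d. unitriangular n (u ! k)" and Y: "Y \<in> all_tables d n m"
  have "(\<Sum>X\<in>all_tables d n m. table_form d T X * table_coef d u Y X) =
      (\<Sum>X\<in>all_tables d n m. \<Prod>k<d. of_int (row_form (table_row T k) (table_row X k)) *
         (\<Prod>p<m. (u ! k) $$ (table_row Y k ! p - 1, table_row X k ! p - 1)))"
    using Y all_tables_length
    by (intro sum.cong refl) (simp add: table_coef_rows[of _ m] table_form_def prod.distrib)
  also have "\<dots> = (\<Prod>k<d. \<Sum>w\<in>multi_idx m n. of_int (row_form (table_row T k) w) *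
         (\<Prod>p<m. (u ! k) $$ (table_row Y k ! p - 1, w ! p - 1)))"
    by (rule sum_tables_prod_rows)
  also have "\<dots> = table_form d T Y"
    unfolding table_form_def
  proof (rule prod.cong)
    fix k assume "k \<in> {..<d}"
    then have k: "k < d" by simp
    interpret conj_pair n m "\<alpha> ! k" "\<beta> ! k" by (rule conj[OF k])
    show "(\<Sum>w\<in>multi_idx m n. of_int (row_form (table_row T k) w) *
         (\<Prod>p<m. (u ! k) $$ (table_row Y k ! p - 1, w ! p - 1))) = complex_of_int (row_form (table_row T k) (table_row Y k))"
      using assms k u Y by (intro row_form_invariant) (auto simp: tables_A_beta_iff table_row_multi_idx)
  qed simp
  finally show "(\<Sum>X\<in>all_tables d n m. table_form d T X * table_coef d u Y X) = table_form d T Y" .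
qed

definition dual_sign :: complex where
  "dual_sign = (\<Prod>k<d. of_int (lex_sign (map prod.swap (cells (\<beta> ! k)))))"

lemma table_form_swap:
  assumes "T \<in> tables_A \<beta>" "X \<in> tables_A \<alpha>"
  shows "table_form d X T = dual_sign * table_form d T X"
proof -
  have "row_form (table_row X k) (table_row T k) =
      lex_sign (map prod.swap (cells (\<beta> ! k))) * row_form (table_row T k) (table_row X k)" if "k < d" for k
    using assms that by (intro conj_pair.row_form_swap[OF conj[OF that]]) (auto simp: tables_A_iff tables_A_beta_iff)
  then show ?thesis by (simp add: table_form_def dual_sign_def flip: prod.distrib)
qed

text \<open>Column symmetry is kept apart as \<open>symmetric_fun\<close>: its type depends on the
  algebra, while the spanning argument is common to both.\<close>

definition highest_fun :: "(nat list list \<Rightarrow> complex) \<Rightarrow> bool" where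
  "highest_fun f \<longleftrightarrow> (\<forall>X. f X \<noteq> 0 \<longrightarrow> X \<in> tables_A \<alpha>) \<and> table_invariant d n m f"

text \<open>The value 0 off \<open>all_tables\<close> allows an equality of functions in
  \<open>highest_fun_span\<close>.\<close>

definition form_comb :: "(nat list list \<Rightarrow> complex) \<Rightarrow> nat list list \<Rightarrow> complex" where
  "form_comb k X = (if X \<in> all_tables d n m then \<Sum>T\<in>tables_A \<beta>. k T * table_form d T X else 0)"

lemma highest_fun_form_comb: "highest_fun (form_comb k)"
  unfolding highest_fun_def
proof (intro conjI allI impI)
  fix X assume "form_comb k X \<noteq> 0"
  then have X: "X \<in> all_tables d n m" "(\<Sum>T\<in>tables_A \<beta>. k T * table_form d T X) \<noteq> 0"
    by (auto simp: form_comb_def split: if_splits)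
  then obtain T where "T \<in> tables_A \<beta>" "table_form d T X \<noteq> 0"
    by (metis (no_types, lifting) mult_zero_right sum.neutral)
  then show "X \<in> tables_A \<alpha>" using table_form_support X by blast
next
  show "table_invariant d n m (form_comb k)"
    unfolding table_invariant_def
  proof (intro allI impI ballI)
    fix u Y assume u: "length u = d" "\<forall>k<d. unitriangular n (u ! k)" and Y: "Y \<in> all_tables d n m"
    have "(\<Sum>X\<in>all_tables d n m. form_comb k X * table_coef d u Y X) =
        (\<Sum>X\<in>all_tables d n m. \<Sum>T\<in>tables_A \<beta>. k T * (table_form d T X * table_coef d u Y X))"
      by (simp add: form_comb_def sum_distrib_right mult.assoc)
    also have "\<dots> = (\<Sum>T\<in>tables_A \<beta>. k T * (\<Sum>X\<in>all_tables d n m. table_form d T X * table_coef d u Y X))"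
      by (subst sum.swap) (simp add: sum_distrib_left)
    also have "\<dots> = (\<Sum>T\<in>tables_A \<beta>. k T * table_form d T Y)"
      using table_form_invariant u Y unfolding table_invariant_def by (intro sum.cong refl) simp
    finally show "(\<Sum>X\<in>all_tables d n m. form_comb k X * table_coef d u Y X) = form_comb k Y"
      using Y by (simp add: form_comb_def)
  qed
qed

lemma highest_fun_diff:
  assumes "highest_fun f" "highest_fun g"
  shows "highest_fun (\<lambda>X. f X - g X)"
  unfolding highest_fun_def
proof (intro conjI allI impI)
  fix X assume "f X - g X \<noteq> 0"
  then show "X \<in> tables_A \<alpha>" using assms unfolding highest_fun_def by (metis diff_self)
next
  show "table_invariant d n m (\<lambda>X. f X - g X)"
    using assms unfolding highest_fun_def table_invariant_def by (simp add: left_diff_distrib sum_subtractf)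
qed

text \<open>With the other rows fixed, f as a function of row K is killed by the raising operators.
  If it is nonzero somewhere, it is nonzero at a Yamanouchi word, and putting that word into row K
  leaves the later rows as they were.\<close>

lemma highest_fun_yamanouchi_zero:
  assumes f: "highest_fun f"
    and zero: "\<And>X. X \<in> tables_A \<alpha> \<Longrightarrow> (\<forall>k<d. yamanouchi (table_row X k)) \<Longrightarrow> f X = 0"
  shows "f X = 0"
proof (rule ccontr)
  have supp: "f X \<noteq> 0 \<Longrightarrow> X \<in> tables_A \<alpha>" for X using f by (auto simp: highest_fun_def)
  have inv: "table_invariant d n m f" using f by (simp add: highest_fun_def)
  \<comment> \<open>K counts the initial rows on which no condition is placed: K = 0 is the
    hypothesis and K = d the claim.\<close>
  have step: "\<forall>X\<in>all_tables d n m. (\<forall>k. K \<le> k \<longrightarrow> k < d \<longrightarrow> yamanouchi (table_row X k)) \<longrightarrow> f X = 0" if "K \<le> d" for K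
    using that
  proof (induction K)
    case 0
    then show ?case using zero supp by blast
  next
    case (Suc K)
    then have K: "K < d" by simp
    show ?case
    proof (intro ballI impI, rule ccontr)
      fix X assume X: "X \<in> all_tables d n m" and yam: "\<forall>k. Suc K \<le> k \<longrightarrow> k < d \<longrightarrow> yamanouchi (table_row X k)"
        and nz: "f X \<noteq> 0"
      let ?g = "\<lambda>w. f (set_row X K w)" and ?a = "\<lambda>i. if i \<in> {1..n} then \<alpha> ! K ! (i - 1) else 0"
      have content: "count_list w i = ?a i" if "w \<in> multi_idx m n" "?g w \<noteq> 0" for w i
      proof -
        have "table_row (set_row X K w) K \<in> words (\<alpha> ! K)" using supp that K by (auto simp: tables_A_iff)
        then have w: "w \<in> words (\<alpha> ! K)" using table_row_set_row[OF X that(1) K] by simp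
        have "length (\<alpha> ! K) = n" using conj[OF K] by (simp add: conj_pair_def)
        then show ?thesis using w that(1) by (auto simp: words_def multi_idx_def intro!: count_notin)
      qed
      have row: "table_row X K \<in> multi_idx m n" using table_row_multi_idx[OF X K] .
      have "\<exists>w\<in>multi_idx m n. yamanouchi w \<and> ?g w \<noteq> 0"
      proof (rule highest_weight_yamanouchi[where a = ?a and ?w0.0 = "table_row X K"])
        fix j w assume "1 \<le> j" "Suc j \<le> n" "w \<in> multi_idx m n"
        then show "raise_op j ?g w = 0"
          using table_invariant_slice[OF inv X K] content
          by (intro unipotent_invariant_raise_zero[where m = m and n = n and a = ?a])
      qed (use row nz content set_row_same[OF X K] in auto)
      then obtain w where w: "w \<in> multi_idx m n" "yamanouchi w" "?g w \<noteq> 0" by blast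
      have "yamanouchi (table_row (set_row X K w) k)" if "K \<le> k" "k < d" for k
        using table_row_set_row[OF X w(1) that(2)] yam w(2) that by (auto simp: Suc_le_eq)
      then have "?g w = 0" using Suc set_row_all_tables[OF X w(1)] by auto
      then show False using w by simp
    qed
  qed
  assume "f X \<noteq> 0"
  then have "X \<in> all_tables d n m" using supp tables_A_iff by blast
  then show False using step[of d] \<open>f X \<noteq> 0\<close> by auto
qed

text \<open>A sum suffices as a grading, since triangularity never lowers the code of any row and
  raises it strictly where rows differ.\<close>

definition table_code :: "nat list list \<Rightarrow> nat" where
  "table_code X = (\<Sum>k<d. word_code (Suc n) (table_row X k))"

definition occ_table :: "nat list list \<Rightarrow> nat list list" where
  "occ_table X = transp m (map (\<lambda>k. occ_word (table_row X k)) [0..<d])"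

lemma occ_table:
  assumes "X \<in> tables_A \<alpha>"
  shows "occ_table X \<in> tables_A \<beta>" "k < d \<Longrightarrow> table_row (occ_table X) k = occ_word (table_row X k)"
proof -
  let ?R = "map (\<lambda>k. occ_word (table_row X k)) [0..<d]"
  have w: "occ_word (table_row X k) \<in> words (\<beta> ! k)" if "k < d" for k
    using conj_pair.occ_word_words(1)[OF conj[OF that]] assms that by (simp add: tables_A_iff)
  have "occ_word (table_row X k) \<in> multi_idx m n" if "k < d" for k
  proof -
    interpret conj_pair n m "\<alpha> ! k" "\<beta> ! k" by (rule conj[OF that])
    show ?thesis using w[OF that] length_beta sum_beta by (auto simp: words_def multi_idx_def)
  qed
  then have R: "?R \<in> all_tables m n d" by (auto simp: all_tables_def)
  have row: "table_row (occ_table X) k = occ_word (table_row X k)" if "k < d" for k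
    using table_row_transp[OF R that] that by (simp add: occ_table_def)
  show "occ_table X \<in> tables_A \<beta>"
    unfolding tables_A_beta_iff using transp_all_tables[OF R] row w by (simp add: occ_table_def)
  show "k < d \<Longrightarrow> table_row (occ_table X) k = occ_word (table_row X k)" using row .
qed

lemma table_form_occ_nonzero:
  assumes "X \<in> tables_A \<alpha>"
  shows "table_form d (occ_table X) X \<noteq> 0"
proof -
  have "row_form (table_row (occ_table X) k) (table_row X k) \<noteq> 0" if "k < d" for k
    unfolding occ_table(2)[OF assms that]
    using assms that by (intro conj_pair.occ_word_words(2)[OF conj[OF that]]) (simp add: tables_A_iff)
  then show ?thesis by (simp add: table_form_def)
qed

lemma table_form_triangular:
  assumes X: "X \<in> tables_A \<alpha>" "\<forall>k<d. yamanouchi (table_row X k)"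
    and Y: "Y \<in> all_tables d n m" "table_form d (occ_table X) Y \<noteq> 0"
  shows "Y = X \<or> table_code X < table_code Y"
proof (cases "\<forall>k<d. table_row Y k = table_row X k")
  case True
  then show ?thesis using all_tables_eqI[of Y d n m X] X Y by (auto simp: tables_A_iff)
next
  case False
  have alt: "table_row Y k = table_row X k \<or> word_code (Suc n) (table_row X k) < word_code (Suc n) (table_row Y k)"
    if k: "k < d" for k
  proof -
    have "row_form (table_row (occ_table X) k) (table_row Y k) \<noteq> 0"
      using Y(2) k by (auto simp: table_form_def)
    then show ?thesis
      using X k table_row_multi_idx[OF Y(1) k] unfolding occ_table(2)[OF X(1) k]
      by (intro conj_pair.row_form_triangular[OF conj[OF k]]) (auto simp: tables_A_iff)
  qed
  from False obtain k where k: "k < d" "table_row Y k \<noteq> table_row X k" by blast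
  have "table_code X < table_code Y"
    unfolding table_code_def
  proof (rule sum_strict_mono_ex1)
    show "\<forall>k\<in>{..<d}. word_code (Suc n) (table_row X k) \<le> word_code (Suc n) (table_row Y k)"
      using alt by (metis lessThan_iff less_imp_le order_refl)
    show "\<exists>k\<in>{..<d}. word_code (Suc n) (table_row X k) < word_code (Suc n) (table_row Y k)"
      using alt[OF k(1)] k by auto
  qed simp
  then show ?thesis by simp
qed

text \<open>Triangular elimination by increasing code. The coefficient at \<open>occ_table X\<close>
  corrects the value at X and affects otherwise only tables of larger code. In the end the
  difference vanishes on all tables with Yamanouchi rows, hence everywhere.\<close>

lemma highest_fun_span:
  assumes f: "highest_fun f"
  obtains k where "f = form_comb k"
proof -
  let ?yam = "\<lambda>X. \<forall>k<d. yamanouchi (table_row X k)"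
  have "\<exists>k. \<forall>X\<in>tables_A \<alpha>. ?yam X \<longrightarrow> table_code X < N \<longrightarrow> f X = form_comb k X" for N
  proof (induction N)
    case (Suc N)
    then obtain k where k: "\<And>X. X \<in> tables_A \<alpha> \<Longrightarrow> ?yam X \<Longrightarrow> table_code X < N \<Longrightarrow> f X = form_comb k X" by blast
    define Z where "Z = {X \<in> tables_A \<alpha>. ?yam X \<and> table_code X = N}"
    define r where "r X = (f X - form_comb k X) / table_form d (occ_table X) X" for X
    \<comment> \<open>Adding up over \<open>Z\<close> makes the correction right without knowing
      that \<open>occ_table\<close> is injective on \<open>Z\<close>.\<close>
    define k' where "k' T = k T + (\<Sum>X\<in>Z. if T = occ_table X then r X else 0)" for T
    have finZ: "finite Z" by (simp add: Z_def)
    have comb: "form_comb k' Y = form_comb k Y + (\<Sum>X\<in>Z. r X * table_form d (occ_table X) Y)"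
      if Y: "Y \<in> all_tables d n m" for Y
    proof -
      have "form_comb k' Y = form_comb k Y +
          (\<Sum>T\<in>tables_A \<beta>. \<Sum>X\<in>Z. (if T = occ_table X then r X else 0) * table_form d T Y)"
        using Y by (simp add: form_comb_def k'_def distrib_right sum.distrib sum_distrib_right)
      also have "(\<Sum>T\<in>tables_A \<beta>. \<Sum>X\<in>Z. (if T = occ_table X then r X else 0) * table_form d T Y) =
          (\<Sum>X\<in>Z. \<Sum>T\<in>tables_A \<beta>. if T = occ_table X then r X * table_form d (occ_table X) Y else 0)"
        by (subst sum.swap) (auto intro!: sum.cong)
      also have "\<dots> = (\<Sum>X\<in>Z. r X * table_form d (occ_table X) Y)"
        using occ_table(1) by (intro sum.cong) (auto simp: Z_def)
      finally show ?thesis .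
    qed
    have "f Y = form_comb k' Y" if Y: "Y \<in> tables_A \<alpha>" "?yam Y" "table_code Y < Suc N" for Y
    proof -
      have Ya: "Y \<in> all_tables d n m" using Y tables_A_iff by blast
      have zero: "r X * table_form d (occ_table X) Y = 0" if "X \<in> Z" "X \<noteq> Y" for X
        using table_form_triangular[of X Y] that Y Ya by (auto simp: Z_def)
      show ?thesis
      proof (cases "Y \<in> Z")
        case True
        have "(\<Sum>X\<in>Z. r X * table_form d (occ_table X) Y) = r Y * table_form d (occ_table Y) Y"
        proof -
          have "(\<Sum>X\<in>Z - {Y}. r X * table_form d (occ_table X) Y) = 0"
            by (intro sum.neutral ballI zero) auto
          then show ?thesis using sum.remove[OF finZ True, of "\<lambda>X. r X * table_form d (occ_table X) Y"] by simp
        qed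
        then show ?thesis using comb[OF Ya] table_form_occ_nonzero[OF Y(1)] by (simp add: r_def)
      next
        case False
        then have "table_code Y < N" using Y by (auto simp: Z_def)
        moreover have "(\<Sum>X\<in>Z. r X * table_form d (occ_table X) Y) = 0"
          using zero False by (intro sum.neutral) metis
        ultimately show ?thesis using comb[OF Ya] k[OF Y(1,2)] by simp
      qed
    qed
    then show ?case by blast
  qed auto
  from this[of "Suc (Max (table_code ` tables_A \<alpha>))"]
  obtain k where k: "\<And>X. X \<in> tables_A \<alpha> \<Longrightarrow> ?yam X \<Longrightarrow> f X = form_comb k X"
    by (metis (no_types, lifting) Max_ge finite_imageI finite_tables_A image_eqI le_imp_less_Suc)
  have "f X - form_comb k X = 0" for X
    using highest_fun_yamanouchi_zero[OF highest_fun_diff[OF f highest_fun_form_comb[of k]]] k by simp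
  then have "f = form_comb k" by (simp add: fun_eq_iff)
  then show ?thesis by (rule that)
qed

end

section \<open>The symmetric and the exterior algebra\<close>

lemma permute_list_inverse:
  assumes "\<sigma> permutes {..<length X}"
  shows "permute_list (inv_into UNIV \<sigma>) (permute_list \<sigma> X) = X" "permute_list \<sigma> (permute_list (inv_into UNIV \<sigma>) X) = X"
  using assms permutes_inv[OF assms] permute_list_compose[of "inv_into UNIV \<sigma>" X \<sigma>] permute_list_compose[of \<sigma> X "inv_into UNIV \<sigma>"]
    permutes_inv_o[OF assms] by auto

lemma sum_permute_list:
  assumes \<sigma>: "\<sigma> permutes {..<m}" and len: "\<And>X. X \<in> S \<Longrightarrow> length X = m"
    and closed: "\<And>X \<tau>. X \<in> S \<Longrightarrow> \<tau> permutes {..<m} \<Longrightarrow> permute_list \<tau> X \<in> S"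
  shows "(\<Sum>X\<in>S. f (permute_list \<sigma> X)) = (\<Sum>X\<in>S. f X)"
proof -
  have "\<sigma> permutes {..<length X}" if "X \<in> S" for X using \<sigma> len that by simp
  then show ?thesis
    by (intro sum.reindex_bij_witness[of _ "permute_list (inv_into UNIV \<sigma>)" "permute_list \<sigma>"])
      (auto simp: permute_list_inverse closed \<sigma> permutes_inv[OF \<sigma>])
qed

lemma permute_all_tables:
  assumes "X \<in> all_tables d n m" "\<sigma> permutes {..<m}"
  shows "permute_list \<sigma> X \<in> all_tables d n m"
  using assms by (auto simp: all_tables_def)

lemma table_row_permute:
  assumes "\<sigma> permutes {..<length X}"
  shows "table_row (permute_list \<sigma> X) k = permute_list \<sigma> (table_row X k)"
  using assms by (simp add: table_row_def permute_list_map)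

lemma table_coef_permute:
  assumes "\<sigma> permutes {..<m}" "length X = m" "length Y = m"
  shows "table_coef d u (permute_list \<sigma> Y) (permute_list \<sigma> X) = table_coef d u Y X"
proof -
  have "table_coef d u (permute_list \<sigma> Y) (permute_list \<sigma> X) =
      (\<Prod>p<m. \<Prod>k<d. (u ! k) $$ (Y ! \<sigma> p ! k - 1, X ! \<sigma> p ! k - 1))"
    using assms by (simp add: table_coef_def permute_list_nth)
  also have "\<dots> = table_coef d u Y X"
    unfolding table_coef_def assms(2)
    using prod.permute[OF assms(1), of "\<lambda>p. \<Prod>k<d. (u ! k) $$ (Y ! p ! k - 1, X ! p ! k - 1)"] by (simp add: o_def)
  finally show ?thesis .
qed

lemma prod_list_counts:
  fixes h :: "nat \<Rightarrow> complex"
  assumes "set w \<subseteq> {1..n}"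
  shows "(\<Prod>p<length w. h (w ! p)) = (\<Prod>i<n. h (Suc i) ^ count_list w (Suc i))"
  using assms
proof (induction w)
  case (Cons x w)
  then obtain x' where x': "x = Suc x'" "x' < n" by (cases x) auto
  have "(\<Prod>i<n. h (Suc i) ^ count_list (x # w) (Suc i)) =
      (\<Prod>i<n. (if i = x' then h x else 1) * h (Suc i) ^ count_list w (Suc i))"
    by (intro prod.cong) (auto simp: x')
  also have "\<dots> = h x * (\<Prod>i<n. h (Suc i) ^ count_list w (Suc i))"
    using x' by (simp add: prod.distrib)
  finally show ?case using Cons by (simp add: prod.lessThan_Suc_shift del: prod.lessThan_Suc count_list.simps)
qed simp

lemma table_coef_diagonal:
  assumes "X \<in> all_tables d n m"
  shows "table_coef d t X X = (\<Prod>k<d. \<Prod>i<n. (t ! k) $$ (i, i) ^ count_list (table_row X k) (Suc i))"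
proof -
  have "(\<Prod>p<m. (t ! k) $$ (table_row X k ! p - 1, table_row X k ! p - 1)) =
      (\<Prod>i<n. (t ! k) $$ (i, i) ^ count_list (table_row X k) (Suc i))" if "k < d" for k
    using prod_list_counts[of "table_row X k" n "\<lambda>a. (t ! k) $$ (a - 1, a - 1)"] table_row_multi_idx[OF assms that]
    by (simp add: multi_idx_def)
  then show ?thesis using all_tables_length[OF assms] by (subst table_coef_rows[of _ m]) auto
qed

lemma table_coef_torus:
  assumes t: "t \<in> torus d n" and X: "X \<in> all_tables d n m" and Y: "Y \<in> all_tables d n m" and "Y \<noteq> X"
  shows "table_coef d t Y X = 0"
proof -
  obtain k where k: "k < d" "table_row Y k \<noteq> table_row X k" using all_tables_eqI[OF Y X] assms(4) by blast
  have len: "length X = m" "length Y = m" using X Y all_tables_length by auto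
  then obtain p where p: "p < m" "table_row Y k ! p \<noteq> table_row X k ! p"
    using k(2) by (metis length_table_row nth_equalityI)
  have "table_row Y k ! p \<in> {1..n}" "table_row X k ! p \<in> {1..n}"
    using multi_idx_nth[OF table_row_multi_idx[OF Y k(1)] p(1)] multi_idx_nth[OF table_row_multi_idx[OF X k(1)] p(1)] .
  moreover have "t ! k \<in> carrier_mat n n" "diagonal_mat (t ! k)" using t k by (auto simp: torus_def GL_def)
  ultimately have "(t ! k) $$ (table_row Y k ! p - 1, table_row X k ! p - 1) = 0"
    using p(2) unfolding diagonal_mat_def by (auto simp: eq_diff_iff)
  then have "(\<Prod>p<m. (t ! k) $$ (table_row Y k ! p - 1, table_row X k ! p - 1)) = 0"
    using p by (intro prod_zero) auto
  then show ?thesis unfolding table_coef_rows[OF len] using k by (intro prod_zero) auto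
qed

lemma det_nonzero_GL:
  assumes A: "A \<in> carrier_mat n n" and nz: "det A \<noteq> 0"
  shows "A \<in> GL n"
proof -
  let ?B = "(1 / det A) \<cdot>\<^sub>m adj_mat A"
  have "A * ?B = (1 / det A) \<cdot>\<^sub>m (det A \<cdot>\<^sub>m 1\<^sub>m n)" "?B * A = (1 / det A) \<cdot>\<^sub>m (det A \<cdot>\<^sub>m 1\<^sub>m n)"
    using mult_smult_distrib[OF A adj_mat(1)[OF A]] mult_smult_assoc_mat[OF adj_mat(1)[OF A] A]
    by (simp_all only: adj_mat(2,3)[OF A])
  moreover have "(1 / det A) \<cdot>\<^sub>m (det A \<cdot>\<^sub>m 1\<^sub>m n) = 1\<^sub>m n" using nz by (intro eq_matI) auto
  ultimately have "invertible_mat A"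
    using A adj_mat(1)[OF A] unfolding invertible_mat_def inverts_mat_def by (intro conjI exI[of _ ?B]) auto
  then show ?thesis using A by (simp add: GL_def)
qed

lemma upper_triangular_GL:
  assumes A: "A \<in> carrier_mat n n" "upper_triangular A" and nz: "\<And>i. i < n \<Longrightarrow> A $$ (i, i) \<noteq> 0"
  shows "A \<in> GL n"
proof (rule det_nonzero_GL[OF A(1)])
  have "det A = (\<Prod>i = 0..<n. A $$ (i, i))"
    using det_upper_triangular[OF A(2,1)] A(1) by (simp add: prod_list_diag_prod)
  then show "det A \<noteq> 0" using nz by simp
qed

lemma unitri_iff: "u \<in> unitri d n \<longleftrightarrow> length u = d \<and> (\<forall>k<d. unitriangular n (u ! k))"
proof -
  have "A \<in> GL n" if A: "unitriangular n A" for A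
    using A by (intro upper_triangular_GL) (auto simp: unitriangular_def)
  moreover have "A \<in> carrier_mat n n" if "A \<in> GL n" for A using that by (simp add: GL_def)
  ultimately have "A \<in> GL n \<and> upper_triangular A \<and> (\<forall>i<n. A $$ (i, i) = 1) \<longleftrightarrow> unitriangular n A" for A
    unfolding unitriangular_def by blast
  then show ?thesis unfolding unitri_def by (auto simp: all_set_conv_all_nth)
qed

text \<open>
  The common features of the symmetric (\<open>e = 0\<close>) and the exterior (\<open>e = 1\<close>) algebra: the monomial of a table
  is a signed basis vector that transforms by the \<open>e\<close>-th power of the sign under permutations of the columns.
\<close>

locale table_alg =
  fixes d n e :: nat and key :: "nat list list \<Rightarrow> 'k" and cf :: "nat list list \<Rightarrow> complex"
    and act :: "complex mat list \<Rightarrow> ('k \<Rightarrow>\<^sub>0 complex) \<Rightarrow> ('k \<Rightarrow>\<^sub>0 complex)" and V :: "('k \<Rightarrow>\<^sub>0 complex) set"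
  assumes act_add: "\<And>u x y. act u (x + y) = act u x + act u y"
    and act_scale: "\<And>u c x. act u (scale c x) = scale c (act u x)"
    and act_single: "\<And>u m X. X \<in> all_tables d n m \<Longrightarrow> act u (Poly_Mapping.single (key X) (cf X)) =
      (\<Sum>Y\<in>all_tables d n m. scale (table_coef d u Y X) (Poly_Mapping.single (key Y) (cf Y)))"
    and cf_cases: "\<And>X. cf X = 0 \<or> cf X = 1 \<or> cf X = - 1"
    and key_permute: "\<And>\<sigma> X. \<sigma> permutes {..<length X} \<Longrightarrow> key (permute_list \<sigma> X) = key X"
    and cf_permute: "\<And>\<sigma> X. \<sigma> permutes {..<length X} \<Longrightarrow> cf (permute_list \<sigma> X) = of_int (sign \<sigma>) ^ e * cf X"
    and key_eq: "\<And>X Y. key X = key Y \<Longrightarrow> cf X \<noteq> 0 \<Longrightarrow> cf Y \<noteq> 0 \<Longrightarrow> mset X = mset Y"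
    and cf_zero: "\<And>X. cf X = 0 \<Longrightarrow>
      \<exists>\<sigma>. \<sigma> permutes {..<length X} \<and> permute_list \<sigma> X = X \<and> of_int (sign \<sigma>) ^ e = (- 1 :: complex)"
    and V_iff: "\<And>x. x \<in> V \<longleftrightarrow> (\<forall>K\<in>Poly_Mapping.keys x. \<exists>X. set X \<subseteq> multi_idx d n \<and> key X = K \<and> cf X \<noteq> 0)"
begin

definition mon :: "nat list list \<Rightarrow> ('k \<Rightarrow>\<^sub>0 complex)" where
  "mon X = Poly_Mapping.single (key X) (cf X)"

definition WV :: "nat list list \<Rightarrow> ('k \<Rightarrow>\<^sub>0 complex) set" where
  "WV \<alpha> = {x \<in> V. \<forall>t\<in>torus d n. act t x = scale (weight_char d n \<alpha> t) x}"

definition HWV :: "nat list list \<Rightarrow> ('k \<Rightarrow>\<^sub>0 complex) set" where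
  "HWV \<alpha> = {x \<in> WV \<alpha>. \<forall>u\<in>unitri d n. act u x = x}"

text \<open>The projection from the m-th tensor power, seen as functions on tables, to degree m of
  the algebra.\<close>

definition emb :: "nat \<Rightarrow> (nat list list \<Rightarrow> complex) \<Rightarrow> ('k \<Rightarrow>\<^sub>0 complex)" where
  "emb m f = (\<Sum>X\<in>all_tables d n m. scale (f X) (mon X))"

definition symmetric_fun :: "nat \<Rightarrow> (nat list list \<Rightarrow> complex) \<Rightarrow> bool" where
  "symmetric_fun m f \<longleftrightarrow> (\<forall>\<sigma> X. \<sigma> permutes {..<m} \<longrightarrow> X \<in> all_tables d n m \<longrightarrow>
     f (permute_list \<sigma> X) = of_int (sign \<sigma>) ^ e * f X)"

lemma sign_power_square: "complex_of_int (sign \<sigma>) ^ e * complex_of_int (sign \<sigma>) ^ e = 1"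
  by (simp add: sign_def)

lemma mon_permute: "\<sigma> permutes {..<length X} \<Longrightarrow> mon (permute_list \<sigma> X) = scale (of_int (sign \<sigma>) ^ e) (mon X)"
  by (simp add: mon_def key_permute cf_permute)

lemma act_sum: "act u (\<Sum>i\<in>I. x i) = (\<Sum>i\<in>I. act u (x i))"
proof (induction I rule: infinite_finite_induct)
  have z: "act u 0 = 0" using act_scale[of u 0 0] by simp
  { case (infinite A) then show ?case by (simp add: z) }
  { case empty then show ?case by (simp add: z) }
  case (insert i I)
  then show ?case by (simp add: act_add)
qed

lemma act_mon: "X \<in> all_tables d n m \<Longrightarrow> act u (mon X) = (\<Sum>Y\<in>all_tables d n m. scale (table_coef d u Y X) (mon Y))"
  unfolding mon_def by (rule act_single)

lemma act_emb: "act u (emb m f) = emb m (\<lambda>Y. \<Sum>X\<in>all_tables d n m. f X * table_coef d u Y X)"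
proof -
  have "act u (emb m f) = (\<Sum>X\<in>all_tables d n m. \<Sum>Y\<in>all_tables d n m. scale (f X * table_coef d u Y X) (mon Y))"
    by (simp add: emb_def act_sum act_scale act_mon free_vs.scale_sum_right)
  also have "\<dots> = emb m (\<lambda>Y. \<Sum>X\<in>all_tables d n m. f X * table_coef d u Y X)"
    unfolding emb_def by (subst sum.swap) (simp add: free_vs.scale_sum_left)
  finally show ?thesis .
qed

lemma act_mon_torus:
  assumes "t \<in> torus d n" "X \<in> all_tables d n m"
  shows "act t (mon X) = scale (table_coef d t X X) (mon X)"
proof -
  have "act t (mon X) = (\<Sum>Y\<in>all_tables d n m. if Y = X then scale (table_coef d t X X) (mon X) else 0)"
    unfolding act_mon[OF assms(2)] using table_coef_torus[OF assms] by (intro sum.cong) auto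
  then show ?thesis using assms(2) by simp
qed

lemma V_add: "x \<in> V \<Longrightarrow> y \<in> V \<Longrightarrow> x + y \<in> V"
  unfolding V_iff using keys_add[of x y] by blast

lemma V_scale: "x \<in> V \<Longrightarrow> scale c x \<in> V"
  unfolding V_iff by (auto simp: in_keys_iff)

lemma WV_add: "x \<in> WV \<alpha> \<Longrightarrow> y \<in> WV \<alpha> \<Longrightarrow> x + y \<in> WV \<alpha>"
  by (simp add: WV_def V_add act_add free_vs.scale_right_distrib)

lemma WV_scale: "x \<in> WV \<alpha> \<Longrightarrow> scale c x \<in> WV \<alpha>"
  by (simp add: WV_def V_scale act_scale mult.commute)

lemma HWV_add: "x \<in> HWV \<alpha> \<Longrightarrow> y \<in> HWV \<alpha> \<Longrightarrow> x + y \<in> HWV \<alpha>"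
  by (simp add: HWV_def WV_add act_add)

lemma HWV_scale: "x \<in> HWV \<alpha> \<Longrightarrow> scale c x \<in> HWV \<alpha>"
  by (simp add: HWV_def WV_scale act_scale)

lemma lookup_emb:
  "Poly_Mapping.lookup (emb m f) K = (\<Sum>X\<in>all_tables d n m. if key X = K then f X * cf X else 0)"
  by (simp add: emb_def lookup_sum mon_def lookup_single when_def)

lemma mon_V: "X \<in> all_tables d n m \<Longrightarrow> mon X \<in> V"
  unfolding V_iff mon_def by (auto simp: all_tables_def split: if_splits)

lemma zero_WV: "0 \<in> WV \<alpha>"
proof -
  have "act u 0 = 0" for u using act_scale[of u 0 0] by simp
  then show ?thesis by (simp add: WV_def V_iff)
qed

text \<open>Injectivity of the projection on functions of matching symmetry. Tables with the same
  basis vector and nonzero coefficient are column permutations of one another; the signs of f and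
  \<open>cf\<close> cancel, so their contributions agree instead of cancelling. If the monomial of X
  is zero, a sign-changing permutation fixes X and forces f X = - f X.\<close>

lemma symmetric_fun_emb_zero:
  assumes f: "symmetric_fun m f" and zero: "emb m f = 0" and X: "X \<in> all_tables d n m"
  shows "f X = 0"
proof (cases "cf X = 0")
  case True
  then obtain \<sigma> where "\<sigma> permutes {..<length X}" "permute_list \<sigma> X = X" "of_int (sign \<sigma>) ^ e = (- 1 :: complex)"
    using cf_zero by blast
  then have "f X = - f X" using f X all_tables_length[OF X] unfolding symmetric_fun_def by (metis mult_minus1)
  then show ?thesis by simp
next
  case False
  let ?C = "{Y \<in> all_tables d n m. key Y = key X \<and> cf Y \<noteq> 0}"
  have const: "f Y * cf Y = f X * cf X" if "Y \<in> ?C" for Y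
  proof -
    have "mset Y = mset X" using key_eq[of Y X] that False by simp
    then obtain \<sigma> where \<sigma>: "\<sigma> permutes {..<length X}" "permute_list \<sigma> X = Y" by (rule mset_eq_permutation)
    have "f Y * cf Y = (of_int (sign \<sigma>) ^ e * f X) * (of_int (sign \<sigma>) ^ e * cf X)"
      using f X \<sigma> cf_permute[of \<sigma> X] all_tables_length[OF X] unfolding symmetric_fun_def by metis
    also have "\<dots> = (of_int (sign \<sigma>) ^ e * of_int (sign \<sigma>) ^ e) * (f X * cf X)" by (simp only: ac_simps)
    also have "\<dots> = f X * cf X" by (simp only: sign_power_square mult_1_left)
    finally show ?thesis .
  qed
  have "0 = Poly_Mapping.lookup (emb m f) (key X)" by (simp add: zero)
  also have "\<dots> = (\<Sum>Y\<in>?C. f Y * cf Y)"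
    unfolding lookup_emb by (rule sum.mono_neutral_cong_right) auto
  also have "\<dots> = (\<Sum>Y\<in>?C. f X * cf X)" by (rule sum.cong[OF refl const])
  also have "\<dots> = of_nat (card ?C) * (f X * cf X)" by simp
  finally have "card ?C = 0 \<or> f X * cf X = 0" by auto
  moreover have "X \<in> ?C" using X False by simp
  then have "card ?C \<noteq> 0" by (auto simp: card_eq_0_iff)
  ultimately show ?thesis using False by simp
qed

lemma symmetric_fun_act:
  assumes f: "symmetric_fun m f"
  shows "symmetric_fun m (\<lambda>Y. \<Sum>X\<in>all_tables d n m. f X * table_coef d u Y X)"
  unfolding symmetric_fun_def
proof (intro allI impI)
  fix \<sigma> Y assume \<sigma>: "\<sigma> permutes {..<m}" and Y: "Y \<in> all_tables d n m"
  have "(\<Sum>X\<in>all_tables d n m. f X * table_coef d u (permute_list \<sigma> Y) X) =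
      (\<Sum>X\<in>all_tables d n m. f (permute_list \<sigma> X) * table_coef d u (permute_list \<sigma> Y) (permute_list \<sigma> X))"
    by (rule sum_permute_list[OF \<sigma>, symmetric]) (auto simp: all_tables_length permute_all_tables)
  also have "\<dots> = (\<Sum>X\<in>all_tables d n m. of_int (sign \<sigma>) ^ e * (f X * table_coef d u Y X))"
    using f \<sigma> Y unfolding symmetric_fun_def
    by (intro sum.cong) (auto simp: table_coef_permute all_tables_length)
  finally show "(\<Sum>X\<in>all_tables d n m. f X * table_coef d u (permute_list \<sigma> Y) X) =
      of_int (sign \<sigma>) ^ e * (\<Sum>X\<in>all_tables d n m. f X * table_coef d u Y X)"
    by (simp add: sum_distrib_left)
qed

lemma emb_diff: "emb m (\<lambda>X. f X - g X) = emb m f - emb m g"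
  by (simp add: emb_def free_vs.scale_left_diff_distrib sum_subtractf)

end

lemma (in table_alg) WV_sum: "(\<And>i. i \<in> I \<Longrightarrow> x i \<in> WV \<alpha>) \<Longrightarrow> (\<Sum>i\<in>I. x i) \<in> WV \<alpha>"
  by (induction I rule: infinite_finite_induct) (auto simp: zero_WV WV_add)

text \<open>The entry 2 is chosen because its powers are distinct, so one torus element reads off
  one exponent of a weight.\<close>

definition dilation :: "nat \<Rightarrow> nat \<Rightarrow> nat \<Rightarrow> nat \<Rightarrow> complex mat list" where
  "dilation d n k i = (replicate d (1\<^sub>m n))[k := mat n n (\<lambda>(a, b). if a = b then if a = i then 2 else 1 else 0)]"

lemma dilation_torus: "dilation d n k i \<in> torus d n"
proof -
  let ?A = "mat n n (\<lambda>(a, b). if a = b then if a = i then 2 else 1 else 0) :: complex mat"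
  have "?A \<in> GL n" "1\<^sub>m n \<in> GL n" by (rule upper_triangular_GL; auto)+
  moreover have "diagonal_mat ?A" "diagonal_mat (1\<^sub>m n)" by (auto simp: diagonal_mat_def)
  moreover have "set (dilation d n k i) \<subseteq> insert ?A (set (replicate d (1\<^sub>m n)))"
    unfolding dilation_def by (rule set_update_subset_insert)
  ultimately show ?thesis unfolding torus_def by (auto simp: dilation_def set_replicate_conv_if split: if_splits)
qed

lemma prod_dilation:
  assumes "k < d" "i < n"
  shows "(\<Prod>a<d. \<Prod>b<n. (dilation d n k i ! a) $$ (b, b) ^ c a b) = 2 ^ c k i"
proof -
  have inner: "(\<Prod>b<n. (dilation d n k i ! a) $$ (b, b) ^ c a b) = (if a = k then 2 ^ c k i else 1)" if "a < d" for a
  proof -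
    have "(\<Prod>b<n. (dilation d n k i ! a) $$ (b, b) ^ c a b) = (\<Prod>b<n. if b = i then (if a = k then 2 ^ c k i else 1) else 1)"
      using that by (intro prod.cong) (auto simp: dilation_def)
    then show ?thesis using assms by simp
  qed
  then have "(\<Prod>a<d. \<Prod>b<n. (dilation d n k i ! a) $$ (b, b) ^ c a b) = (\<Prod>a<d. if a = k then 2 ^ c k i else 1)"
    by (intro prod.cong) auto
  then show ?thesis using assms by simp
qed

section \<open>Weight spaces described by functions on tables\<close>

locale alg_tables = conj_tables d n m \<alpha> \<beta> + table_alg d n e key cf act V
  for d n m :: nat and \<alpha> \<beta> :: "nat list list" and e :: nat and key :: "nat list list \<Rightarrow> 'k" and cf act V
begin

lemma length_alpha_nth: "k < d \<Longrightarrow> length (\<alpha> ! k) = n"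
  using conj by (auto simp: conj_pair_def)

lemma weight_char_tables:
  assumes "X \<in> tables_A \<alpha>"
  shows "table_coef d t X X = weight_char d n \<alpha> t"
proof -
  have "count_list (table_row X k) (Suc i) = \<alpha> ! k ! i" if "k < d" "i < n" for k i
    using assms that length_alpha_nth[OF that(1)] by (force simp: tables_A_iff words_def)
  then show ?thesis
    using assms by (simp add: tables_A_iff table_coef_diagonal[of X d n m] weight_char_def)
qed

lemma mon_WV: "X \<in> tables_A \<alpha> \<Longrightarrow> mon X \<in> WV \<alpha>"
  unfolding WV_def using act_mon_torus[of _ X m] weight_char_tables[of X] by (auto simp: tables_A_iff mon_V)

lemma emb_eq_tables:
  assumes "\<And>X. f X \<noteq> 0 \<Longrightarrow> X \<in> tables_A \<alpha>"
  shows "emb m f = (\<Sum>X\<in>tables_A \<alpha>. scale (f X) (mon X))"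
  unfolding emb_def using assms
  by (intro sum.mono_neutral_right) (auto simp: tables_A_iff, metis)

lemma emb_WV:
  assumes "\<And>X. f X \<noteq> 0 \<Longrightarrow> X \<in> tables_A \<alpha>"
  shows "emb m f \<in> WV \<alpha>"
proof -
  have "emb m f = (\<Sum>X\<in>tables_A \<alpha>. scale (f X) (mon X))" by (rule emb_eq_tables) (rule assms)
  then show ?thesis by (simp add: WV_sum WV_scale mon_WV)
qed

lemma permute_tables_A:
  assumes "X \<in> tables_A \<alpha>" "\<sigma> permutes {..<m}"
  shows "permute_list \<sigma> X \<in> tables_A \<alpha>"
  using assms permute_list_words
  by (auto simp: tables_A_iff permute_all_tables table_row_permute all_tables_length)

text \<open>The dilations of the torus detect how often each letter occurs in each row.\<close>

lemma WV_keys: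
  assumes x: "x \<in> WV \<alpha>" and K: "K \<in> Poly_Mapping.keys x"
  obtains X where "X \<in> tables_A \<alpha>" "key X = K" "cf X \<noteq> 0"
proof -
  have "\<forall>K\<in>Poly_Mapping.keys x. \<exists>X. set X \<subseteq> multi_idx d n \<and> key X = K \<and> cf X \<noteq> 0"
    using x by (simp add: WV_def V_iff)
  then obtain R where R: "\<And>K. K \<in> Poly_Mapping.keys x \<Longrightarrow> set (R K) \<subseteq> multi_idx d n \<and> key (R K) = K \<and> cf (R K) \<noteq> 0"
    by metis
  have R_all: "R L \<in> all_tables d n (length (R L))" if "L \<in> Poly_Mapping.keys x" for L
    using R[OF that] by (simp add: all_tables_def)
  have sq: "cf (R L) * cf (R L) = 1" if "L \<in> Poly_Mapping.keys x" for L
    using cf_cases[of "R L"] R[OF that] by auto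
  let ?l = "Poly_Mapping.lookup x"
  have "x = (\<Sum>L\<in>Poly_Mapping.keys x. Poly_Mapping.single L (?l L))" by (rule sum_singles[symmetric])
  also have "\<dots> = (\<Sum>L\<in>Poly_Mapping.keys x. scale (?l L * cf (R L)) (mon (R L)))"
    using R sq by (intro sum.cong) (auto simp: mon_def mult.assoc)
  finally have x_eq: "x = (\<Sum>L\<in>Poly_Mapping.keys x. scale (?l L * cf (R L)) (mon (R L)))" .
  \<comment> \<open>The torus acts diagonally on the chosen monomials, so comparing the coefficients
    at \<open>K\<close> identifies its eigenvalue with the character.\<close>
  have coef: "table_coef d t (R K) (R K) = weight_char d n \<alpha> t" if t: "t \<in> torus d n" for t
  proof -
    have "act t x = (\<Sum>L\<in>Poly_Mapping.keys x. scale (?l L * cf (R L)) (scale (table_coef d t (R L) (R L)) (mon (R L))))"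
      by (subst x_eq) (auto simp: act_sum act_scale act_mon_torus[OF t R_all] intro!: sum.cong)
    also have "\<dots> = (\<Sum>L\<in>Poly_Mapping.keys x. Poly_Mapping.single L (?l L * table_coef d t (R L) (R L)))"
    proof (rule sum.cong)
      fix L assume L: "L \<in> Poly_Mapping.keys x"
      have "?l L * cf (R L) * (table_coef d t (R L) (R L) * cf (R L)) =
          ?l L * table_coef d t (R L) (R L) * (cf (R L) * cf (R L))" by (simp only: ac_simps)
      also have "\<dots> = ?l L * table_coef d t (R L) (R L)" using sq[OF L] by simp
      finally have e: "?l L * cf (R L) * (table_coef d t (R L) (R L) * cf (R L)) = ?l L * table_coef d t (R L) (R L)" .
      have "key (R L) = L" using R[OF L] by simp
      then show "scale (?l L * cf (R L)) (scale (table_coef d t (R L) (R L)) (mon (R L))) =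
          Poly_Mapping.single L (?l L * table_coef d t (R L) (R L))"
        by (simp only: mon_def scale_single e)
    qed simp
    finally have "Poly_Mapping.lookup (act t x) K = ?l K * table_coef d t (R K) (R K)"
      using K by (simp add: lookup_sum lookup_single when_def)
    moreover have "act t x = scale (weight_char d n \<alpha> t) x" using x t by (simp add: WV_def)
    ultimately show ?thesis using K by (simp add: in_keys_iff)
  qed
  have count: "count_list (table_row (R K) k) (Suc i) = \<alpha> ! k ! i" if "k < d" "i < n" for k i
  proof -
    let ?t = "dilation d n k i"
    have "table_coef d ?t (R K) (R K) = 2 ^ count_list (table_row (R K) k) (Suc i)"
      unfolding table_coef_diagonal[OF R_all[OF K]]
      by (rule prod_dilation[OF that, of "\<lambda>a b. count_list (table_row (R K) a) (Suc b)"])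
    moreover have "weight_char d n \<alpha> ?t = 2 ^ (\<alpha> ! k ! i)"
      unfolding weight_char_def by (rule prod_dilation[OF that, of "\<lambda>a b. \<alpha> ! a ! b"])
    ultimately have "cmod (2 ^ count_list (table_row (R K) k) (Suc i)) = cmod (2 ^ (\<alpha> ! k ! i))"
      using coef[OF dilation_torus[of d n k i]] by simp
    then have "(2::real) ^ count_list (table_row (R K) k) (Suc i) = 2 ^ (\<alpha> ! k ! i)"
      by (simp add: norm_power)
    then show ?thesis by simp
  qed
  have "R K \<in> tables_A \<alpha>"
    unfolding tables_A_def
  proof (intro CollectI conjI ballI allI impI)
    show "length c = length \<alpha>" if "c \<in> set (R K)" for c
      using R[OF K] that by (auto simp: multi_idx_def length_alpha)
  next
    fix k assume "k < length \<alpha>"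
    then have k: "k < d" by (simp add: length_alpha)
    have s: "set (table_row (R K) k) \<subseteq> {1..n}"
      using table_row_multi_idx[OF R_all[OF K] k] by (simp add: multi_idx_def)
    have "length (table_row (R K) k) = (\<Sum>i\<in>{1..n}. count_list (table_row (R K) k) i)"
      by (rule sum_count_set[OF s, symmetric]) simp
    also have "\<dots> = (\<Sum>i<n. count_list (table_row (R K) k) (Suc i))"
      by (rule sum.reindex_bij_witness[of _ Suc "\<lambda>i. i - 1"]) auto
    also have "\<dots> = sum_list (\<alpha> ! k)"
      using count[OF k] by (simp add: sum_list_sum_nth length_alpha_nth[OF k] atLeast0LessThan)
    finally have len: "length (table_row (R K) k) = sum_list (\<alpha> ! k)" .
    have "count_list (table_row (R K) k) i = \<alpha> ! k ! (i - 1)" if "i \<in> {1..n}" for i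
      using count[OF k, of "i - 1"] that by (cases i) auto
    then show "table_row (R K) k \<in> words (\<alpha> ! k)"
      using len s by (simp add: words_def length_alpha_nth[OF k])
  qed
  then show ?thesis using that R[OF K] by blast
qed

text \<open>The coefficient of a basis vector is spread evenly, with the sign \<open>cf\<close>,
  over the tables that represent it. This gives a preimage that is symmetric and not merely some
  preimage.\<close>

lemma WV_emb:
  assumes x: "x \<in> WV \<alpha>"
  obtains f where "\<forall>X. f X \<noteq> 0 \<longrightarrow> X \<in> tables_A \<alpha>" "symmetric_fun m f" "x = emb m f"
proof -
  define C where "C K = {X \<in> tables_A \<alpha>. key X = K \<and> cf X \<noteq> 0}" for K
  define f where "f X = (if X \<in> tables_A \<alpha> then Poly_Mapping.lookup x (key X) * cf X / of_nat (card (C (key X))) else 0)" for X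
  have supp: "X \<in> tables_A \<alpha>" if "f X \<noteq> 0" for X using that by (auto simp: f_def split: if_splits)
  have sym: "symmetric_fun m f"
    unfolding symmetric_fun_def
  proof (intro allI impI)
    fix \<sigma> X assume \<sigma>: "\<sigma> permutes {..<m}" and X: "X \<in> all_tables d n m"
    have p: "\<sigma> permutes {..<length X}" "length X = m" using \<sigma> all_tables_length[OF X] by auto
    have "permute_list \<sigma> X \<in> tables_A \<alpha> \<longleftrightarrow> X \<in> tables_A \<alpha>"
      using permute_tables_A[of X \<sigma>] permute_tables_A[of "permute_list \<sigma> X" "inv_into UNIV \<sigma>"]
        permutes_inv[OF \<sigma>] \<sigma> permute_list_inverse(1)[OF p(1)] by auto
    then show "f (permute_list \<sigma> X) = of_int (sign \<sigma>) ^ e * f X"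
      using p by (simp add: f_def key_permute cf_permute)
  qed
  have "Poly_Mapping.lookup (emb m f) K = Poly_Mapping.lookup x K" for K
  proof -
    have fin: "finite (C K)" by (simp add: C_def)
    have "Poly_Mapping.lookup (emb m f) K = (\<Sum>X\<in>C K. Poly_Mapping.lookup x K / of_nat (card (C K)))"
      unfolding lookup_emb
    proof (rule sum.mono_neutral_cong_right)
      fix X assume X: "X \<in> C K"
      then have "cf X * cf X = 1" using cf_cases[of X] by (auto simp: C_def)
      then show "(if key X = K then f X * cf X else 0) = Poly_Mapping.lookup x K / of_nat (card (C K))"
        using X by (simp add: C_def f_def mult.assoc)
    qed (auto simp: C_def tables_A_iff f_def)
    also have "\<dots> = Poly_Mapping.lookup x K"
    proof (cases "K \<in> Poly_Mapping.keys x")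
      case True
      then obtain X where "X \<in> C K" using WV_keys[OF x] by (auto simp: C_def)
      then have "card (C K) \<noteq> 0" using fin by (auto simp: card_eq_0_iff)
      then show ?thesis by simp
    qed (simp add: in_keys_iff)
    finally show ?thesis .
  qed
  then have "x = emb m f" by (intro poly_mapping_eqI) simp
  with supp sym show ?thesis by (intro that) auto
qed

text \<open>Invariance in the algebra only says that the transformed function minus f projects to
  zero. Since this difference is symmetric, it is zero as a function.\<close>

lemma HWV_emb:
  assumes x: "x \<in> HWV \<alpha>"
  obtains f where "highest_fun f" "symmetric_fun m f" "x = emb m f"
proof -
  have "x \<in> WV \<alpha>" using x by (simp add: HWV_def)
  then obtain f where f: "\<forall>X. f X \<noteq> 0 \<longrightarrow> X \<in> tables_A \<alpha>" "symmetric_fun m f" "x = emb m f" by (rule WV_emb)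
  have "table_invariant d n m f"
    unfolding table_invariant_def
  proof (intro allI impI ballI)
    fix u Y assume u: "length u = d" "\<forall>k<d. unitriangular n (u ! k)" and Y: "Y \<in> all_tables d n m"
    let ?g = "\<lambda>Y. \<Sum>X\<in>all_tables d n m. f X * table_coef d u Y X"
    have "act u x = x" using x u by (simp add: HWV_def unitri_iff)
    then have zero: "emb m (\<lambda>Y. ?g Y - f Y) = 0" unfolding f(3) act_emb emb_diff by simp
    have "symmetric_fun m (\<lambda>Y. ?g Y - f Y)"
      using symmetric_fun_act[OF f(2), of u] f(2) unfolding symmetric_fun_def by (simp add: right_diff_distrib)
    from symmetric_fun_emb_zero[OF this zero Y] show "?g Y = f Y" by simp
  qed
  then have "highest_fun f" using f(1) by (auto simp: highest_fun_def)
  with f show ?thesis using that by blast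
qed

lemma emb_HWV:
  assumes f: "highest_fun f"
  shows "emb m f \<in> HWV \<alpha>"
proof -
  have "emb m f \<in> WV \<alpha>" using f by (intro emb_WV) (simp add: highest_fun_def)
  moreover have "act u (emb m f) = emb m f" if "u \<in> unitri d n" for u
    unfolding act_emb using f that
    unfolding emb_def highest_fun_def table_invariant_def unitri_iff by (intro sum.cong) auto
  ultimately show ?thesis by (simp add: HWV_def)
qed

text \<open>Provides the finite dimension that \<open>mutual_linear_injections_surj\<close> asks
  for.\<close>

lemma HWV_span: "HWV \<alpha> \<subseteq> free_vs.span (mon ` tables_A \<alpha>)"
proof
  fix x assume "x \<in> HWV \<alpha>"
  then have "x \<in> WV \<alpha>" by (simp add: HWV_def)
  then obtain f where f: "\<forall>X. f X \<noteq> 0 \<longrightarrow> X \<in> tables_A \<alpha>" "symmetric_fun m f" "x = emb m f" by (rule WV_emb)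
  then have "x = (\<Sum>X\<in>tables_A \<alpha>. scale (f X) (mon X))" using emb_eq_tables[of f] by simp
  then show "x \<in> free_vs.span (mon ` tables_A \<alpha>)"
    by (simp add: free_vs.span_sum free_vs.span_scale free_vs.span_base)
qed

end

section \<open>The maps between weight spaces\<close>

lemma linear_on_sum:
  assumes lin: "linear_on W f" and W: "free_vs.subspace W" and x: "\<And>i. i \<in> I \<Longrightarrow> x i \<in> W"
  shows "f (\<Sum>i\<in>I. scale (c i) (x i)) = (\<Sum>i\<in>I. scale (c i) (f (x i)))"
proof -
  have zero: "f 0 = 0"
  proof -
    have "f (scale 0 0) = scale 0 (f 0)" using lin free_vs.subspace_0[OF W] unfolding linear_on_def by blast
    then show ?thesis by simp
  qed
  show ?thesis
    using x
  proof (induction I rule: infinite_finite_induct)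
    case (insert i I)
    have "(\<Sum>i\<in>I. scale (c i) (x i)) \<in> W"
      using insert W by (intro free_vs.subspace_sum free_vs.subspace_scale) auto
    moreover have "scale (c i) (x i) \<in> W" "x i \<in> W" using insert W by (auto intro: free_vs.subspace_scale)
    ultimately have "f (scale (c i) (x i) + (\<Sum>i\<in>I. scale (c i) (x i))) = scale (c i) (f (x i)) + f (\<Sum>i\<in>I. scale (c i) (x i))"
      using lin unfolding linear_on_def by simp
    then show ?case using insert by simp
  qed (simp_all add: zero)
qed

lemma linear_on_inj_kernel:
  assumes lin: "linear_on W f" and W: "free_vs.subspace W" and ker: "\<And>x. x \<in> W \<Longrightarrow> f x = 0 \<Longrightarrow> x = 0"
  shows "inj_on f W"
proof (rule inj_onI)
  fix x y assume xy: "x \<in> W" "y \<in> W" "f x = f y"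
  have y: "scale (- 1) y \<in> W" using xy(2) free_vs.subspace_scale[OF W] by blast
  have "f (x + scale (- 1) y) = f x + f (scale (- 1) y)" using lin xy(1) y unfolding linear_on_def by blast
  also have "f (scale (- 1) y) = scale (- 1) (f y)" using lin xy(2) unfolding linear_on_def by blast
  also have "f x + scale (- 1) (f y) = 0" using xy(3) by simp
  finally have "x + scale (- 1) y = 0" using ker free_vs.subspace_add[OF W xy(1) y] by blast
  then show "x = y" by simp
qed

text \<open>The composite of g and f is an injective linear map of W' into itself. It sends a basis
  of W' to an independent set of the same finite size, which therefore spans W'; so f is already
  onto.\<close>

lemma mutual_linear_injections_surj:
  fixes W :: "('a \<Rightarrow>\<^sub>0 complex) set" and W' :: "('b \<Rightarrow>\<^sub>0 complex) set"
  assumes W: "free_vs.subspace W" and W': "free_vs.subspace W'"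
    and f: "linear_on W f" "inj_on f W" "f ` W \<subseteq> W'"
    and g: "linear_on W' g" "inj_on g W'" "g ` W' \<subseteq> W"
    and fin: "finite C" "W' \<subseteq> free_vs.span C"
  shows "f ` W = W'"
proof -
  define h where "h y = f (g y)" for y
  have h_lin: "linear_on W' h"
    using f(1) g(1,3) unfolding linear_on_def h_def by (auto simp: image_subset_iff)
  have h_inj: "inj_on h W'"
    using f(2) g(2,3) unfolding h_def inj_on_def by (auto simp: image_subset_iff)
  have h_in: "h y \<in> W'" if "y \<in> W'" for y using f(3) g(3) that unfolding h_def by auto
  obtain B where B: "B \<subseteq> W'" "free_vs.independent B" "W' \<subseteq> free_vs.span B"
    by (rule free_vs.maximal_independent_subset)
  have finB: "finite B" using free_vs.independent_span_bound[OF fin(1) B(2)] B(1) fin(2) by blast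
  have hB: "inj_on h B" using h_inj B(1) by (rule inj_on_subset)
  have h_comb: "h (\<Sum>v\<in>B. scale (u v) v) = (\<Sum>v\<in>B. scale (u v) (h v))" for u
    using B(1) by (intro linear_on_sum[OF h_lin W']) auto
  have comb_in: "(\<Sum>v\<in>B. scale (u v) v) \<in> W'" for u
    using B(1) W' by (intro free_vs.subspace_sum free_vs.subspace_scale) auto
  have indep: "free_vs.independent (h ` B)"
  proof
    assume "free_vs.dependent (h ` B)"
    then obtain u where u: "\<exists>v\<in>h ` B. u v \<noteq> 0" "(\<Sum>v\<in>h ` B. scale (u v) v) = 0"
      using free_vs.dependent_finite[of "h ` B"] finB by auto
    then have "h (\<Sum>v\<in>B. scale (u (h v)) v) = 0"
      unfolding h_comb by (simp add: sum.reindex[OF hB])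
    moreover have "h 0 = 0" using linear_on_sum[OF h_lin W', of "{}"] by simp
    ultimately have "h (\<Sum>v\<in>B. scale (u (h v)) v) = h 0" by simp
    then have "(\<Sum>v\<in>B. scale (u (h v)) v) = 0"
      by (rule inj_onD[OF h_inj _ comb_in free_vs.subspace_0[OF W']])
    moreover have "\<exists>v\<in>B. u (h v) \<noteq> 0" using u(1) by auto
    ultimately have "free_vs.dependent B"
      using free_vs.dependent_finite[OF finB] by (auto intro!: exI[of _ "\<lambda>v. u (h v)"])
    with B(2) show False by simp
  qed
  have "y \<in> f ` W" if y: "y \<in> W'" for y
  proof -
    have "y \<in> free_vs.span (h ` B)"
    proof (rule ccontr)
      assume n: "y \<notin> free_vs.span (h ` B)"
      then have "free_vs.independent (insert y (h ` B))" using indep by (rule free_vs.independent_insertI)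
      moreover have "insert y (h ` B) \<subseteq> free_vs.span B" using y h_in B(1,3) by auto
      ultimately have "card (insert y (h ` B)) \<le> card B"
        using free_vs.independent_span_bound[OF finB] by blast
      moreover have "y \<notin> h ` B" using n free_vs.span_base by blast
      ultimately show False using finB card_image[OF hB] by simp
    qed
    then obtain u where "y = (\<Sum>v\<in>h ` B. scale (u v) v)"
      using free_vs.span_finite[of "h ` B"] finB by auto
    then have "y = h (\<Sum>v\<in>B. scale (u (h v)) v)" unfolding h_comb by (simp add: sum.reindex[OF hB])
    then have "y = f (g (\<Sum>v\<in>B. scale (u (h v)) v))" by (simp add: h_def)
    moreover have "g (\<Sum>v\<in>B. scale (u (h v)) v) \<in> W" using g(3) comb_in by (rule subsetD[OF _ imageI])
    ultimately show ?thesis by (rule image_eqI)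
  qed
  then show ?thesis using f(3) by blast
qed

lemma (in table_alg) subspace_WV: "free_vs.subspace (WV \<alpha>)"
  by (rule free_vs.subspaceI) (auto simp: zero_WV WV_add WV_scale)

lemma (in table_alg) subspace_HWV: "free_vs.subspace (HWV \<alpha>)"
proof (rule free_vs.subspaceI)
  have "act u 0 = 0" for u using act_scale[of u 0 0] by simp
  then show "0 \<in> HWV \<alpha>" by (simp add: HWV_def zero_WV)
qed (auto simp: HWV_add HWV_scale)

section \<open>The map given by the kernel between conjugate shapes\<close>

lemma (in conj_tables) table_form_permute:
  assumes T: "T \<in> tables_A \<beta>" and X: "X \<in> all_tables d n m" and \<sigma>: "\<sigma> permutes {..<m}"
  shows "table_form d (permute_list \<sigma> T) (permute_list \<sigma> X) = of_int (sign \<sigma>) ^ d * table_form d T X"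
proof -
  have len: "length T = m" "length X = m" using T X all_tables_length by (auto simp: tables_A_beta_iff)
  have "row_form (table_row (permute_list \<sigma> T) k) (table_row (permute_list \<sigma> X) k) =
      sign \<sigma> * row_form (table_row T k) (table_row X k)" if "k < d" for k
    using T that \<sigma> len by (simp add: table_row_permute row_form_permute[of _ "\<beta> ! k"] tables_A_beta_iff)
  then show ?thesis by (simp add: table_form_def prod.distrib)
qed

lemma sign_power_cong: "even (a + b) \<Longrightarrow> complex_of_int (sign \<sigma>) ^ a = complex_of_int (sign \<sigma>) ^ b"
  by (cases "evenperm \<sigma>") (auto simp: sign_def minus_one_power_iff)

lemma table_norm_permute: "\<sigma> permutes {..<length T} \<Longrightarrow> table_norm (permute_list \<sigma> T) = table_norm T"
  by (simp add: table_norm_def count_list_eq_mset)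

lemma table_norm_pos: "table_norm T > 0"
  by (simp add: table_norm_def prod_pos)

lemma cnj_table_form: "cnj (table_form d T X) = table_form d T X"
  by (simp add: table_form_def)

text \<open>The common form of the four maps. The condition on \<open>cf1 T\<close> selects the
  sorted tables of the basis: all of them in the symmetric algebra, those with distinct columns in
  the exterior one. \<open>parity\<close> is what makes the kernel compatible with both
  algebras.\<close>

locale alg_pair =
  src: alg_tables d n m \<beta> \<alpha> e1 key1 cf1 act1 V1 + tgt: alg_tables d n m \<alpha> \<beta> e2 key2 cf2 act2 V2
  for d n m :: nat and \<alpha> \<beta> :: "nat list list"
    and e1 :: nat and key1 :: "nat list list \<Rightarrow> 'k" and cf1 act1 V1
    and e2 :: nat and key2 :: "nat list list \<Rightarrow> 'l" and cf2 act2 V2 +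
  fixes Dl :: "('k \<Rightarrow>\<^sub>0 complex) \<Rightarrow> ('l \<Rightarrow>\<^sub>0 complex)"
  assumes parity: "even (e1 + e2 + d)"
    and Dl_linear: "linear_on (src.WV \<beta>) Dl"
    and Dl_mon: "\<And>T. T \<in> tables_A \<beta> \<Longrightarrow> sorted T \<Longrightarrow> cf1 T \<noteq> 0 \<Longrightarrow> Dl (src.mon T) =
      scale (of_int (table_sign d T) / of_nat (table_norm T))
        (\<Sum>X\<in>all_tables d n m. scale (of_int (table_sgn d T X)) (tgt.mon X))"
begin

lemma sign_parity: "complex_of_int (sign \<sigma>) ^ d * complex_of_int (sign \<sigma>) ^ e2 = complex_of_int (sign \<sigma>) ^ e1"
  using sign_power_cong[of "d + e2" e1 \<sigma>] parity by (auto simp: power_add)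

text \<open>Reindexing X by \<sigma> produces the sign to the power d from the kernel and to the
  power e2 from the target monomial. By parity this is the power e1, the rule obeyed by the source
  monomials.\<close>

lemma emb_form_permute:
  assumes T: "T \<in> tables_A \<beta>" and \<sigma>: "\<sigma> permutes {..<m}"
  shows "tgt.emb m (table_form d (permute_list \<sigma> T)) = scale (of_int (sign \<sigma>) ^ e1) (tgt.emb m (table_form d T))"
proof -
  have "tgt.emb m (table_form d (permute_list \<sigma> T)) =
      (\<Sum>X\<in>all_tables d n m. scale (table_form d (permute_list \<sigma> T) (permute_list \<sigma> X)) (tgt.mon (permute_list \<sigma> X)))"
    unfolding tgt.emb_def
    by (rule sum_permute_list[OF \<sigma>, symmetric]) (auto simp: all_tables_length permute_all_tables)
  also have "\<dots> = (\<Sum>X\<in>all_tables d n m. scale (of_int (sign \<sigma>) ^ e1 * table_form d T X) (tgt.mon X))"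
  proof (rule sum.cong)
    fix X assume X: "X \<in> all_tables d n m"
    have "scale (table_form d (permute_list \<sigma> T) (permute_list \<sigma> X)) (tgt.mon (permute_list \<sigma> X)) =
        scale (of_int (sign \<sigma>) ^ d * of_int (sign \<sigma>) ^ e2 * table_form d T X) (tgt.mon X)"
      using \<sigma> all_tables_length[OF X] tgt.table_form_permute[OF T X \<sigma>] by (simp add: tgt.mon_permute ac_simps)
    then show "scale (table_form d (permute_list \<sigma> T) (permute_list \<sigma> X)) (tgt.mon (permute_list \<sigma> X)) =
        scale (of_int (sign \<sigma>) ^ e1 * table_form d T X) (tgt.mon X)" by (simp only: sign_parity)
  qed simp
  finally show ?thesis by (simp add: tgt.emb_def free_vs.scale_sum_right)
qed

lemma Dl_scale: "x \<in> src.WV \<beta> \<Longrightarrow> Dl (scale c x) = scale c (Dl x)"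
  using Dl_linear by (simp add: linear_on_def)

text \<open>Both sides obey the same sign rule under column permutations, so the prescribed values
  at sorted tables determine all others. If the source monomial is zero, the right-hand side equals
  its own negative.\<close>

lemma Dl_mon_tables:
  assumes T: "T \<in> tables_A \<beta>"
  shows "Dl (src.mon T) = scale (1 / of_nat (table_norm T)) (tgt.emb m (table_form d T))"
proof (cases "cf1 T = 0")
  case True
  have len: "length T = m" using T all_tables_length by (auto simp: tgt.tables_A_beta_iff)
  obtain \<sigma> where \<sigma>: "\<sigma> permutes {..<m}" "permute_list \<sigma> T = T" "of_int (sign \<sigma>) ^ e1 = (- 1 :: complex)"
    using src.cf_zero[OF True] len by auto
  have "tgt.emb m (table_form d T) = scale (- 1) (tgt.emb m (table_form d T))"
    using emb_form_permute[OF T \<sigma>(1)] \<sigma>(2,3) by simp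
  then have "scale 2 (tgt.emb m (table_form d T)) = 0"
    by (metis add.right_inverse free_vs.scale_minus_left free_vs.scale_one free_vs.scale_left_distrib one_add_one)
  then have "tgt.emb m (table_form d T) = 0" by simp
  moreover have "src.mon T = 0" by (simp add: src.mon_def True)
  moreover have "Dl 0 = 0" using Dl_scale[OF src.zero_WV, of 0] by simp
  ultimately show ?thesis by simp
next
  case False
  have len: "length T = m" using T all_tables_length by (auto simp: tgt.tables_A_beta_iff)
  have "mset T = mset (sort T)" by simp
  then obtain \<sigma> where \<sigma>: "\<sigma> permutes {..<length (sort T)}" "permute_list \<sigma> (sort T) = T" by (rule mset_eq_permutation)
  have "mset (sort T) = mset T" by simp
  then obtain \<tau> where \<tau>: "\<tau> permutes {..<length T}" "permute_list \<tau> T = sort T" by (rule mset_eq_permutation)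
  have S: "sort T \<in> tables_A \<beta>" using src.permute_tables_A[OF T, of \<tau>] \<tau> len by simp
  have cfS: "cf1 (sort T) \<noteq> 0" using src.cf_permute[of \<sigma> "sort T"] \<sigma> False by auto
  have norm: "table_norm T = table_norm (sort T)" using table_norm_permute[of \<sigma> "sort T"] \<sigma> by simp
  have "src.mon T = scale (of_int (sign \<sigma>) ^ e1) (src.mon (sort T))" using src.mon_permute[of \<sigma> "sort T"] \<sigma> by simp
  then have "Dl (src.mon T) = scale (of_int (sign \<sigma>) ^ e1) (Dl (src.mon (sort T)))"
    using Dl_scale[OF src.mon_WV[OF S]] by simp
  also have "Dl (src.mon (sort T)) = scale (1 / of_nat (table_norm T)) (tgt.emb m (table_form d (sort T)))"
    unfolding Dl_mon[OF S sorted_sort cfS] norm tgt.emb_def table_form_sgn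
    by (simp add: free_vs.scale_sum_right)
  also have "scale (of_int (sign \<sigma>) ^ e1) (scale (1 / of_nat (table_norm T)) (tgt.emb m (table_form d (sort T)))) =
      scale (1 / of_nat (table_norm T)) (tgt.emb m (table_form d T))"
    using emb_form_permute[OF S, of \<sigma>] \<sigma> len by (simp add: mult.commute)
  finally show ?thesis .
qed

lemma Dl_emb:
  assumes g: "\<forall>T. g T \<noteq> 0 \<longrightarrow> T \<in> tables_A \<beta>"
  shows "Dl (src.emb m g) = tgt.emb m (tgt.form_comb (\<lambda>T. g T / of_nat (table_norm T)))"
proof -
  have "src.emb m g = (\<Sum>T\<in>tables_A \<beta>. scale (g T) (src.mon T))" using g src.emb_eq_tables[of g] by simp
  then have "Dl (src.emb m g) = (\<Sum>T\<in>tables_A \<beta>. scale (g T) (Dl (src.mon T)))"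
    using linear_on_sum[OF Dl_linear src.subspace_WV, of "tables_A \<beta>" src.mon g] src.mon_WV by simp
  also have "\<dots> = (\<Sum>T\<in>tables_A \<beta>. \<Sum>X\<in>all_tables d n m.
      scale (g T / of_nat (table_norm T) * table_form d T X) (tgt.mon X))"
    by (intro sum.cong) (auto simp: Dl_mon_tables tgt.emb_def free_vs.scale_sum_right)
  also have "\<dots> = tgt.emb m (tgt.form_comb (\<lambda>T. g T / of_nat (table_norm T)))"
    unfolding tgt.emb_def by (subst sum.swap) (simp add: tgt.form_comb_def free_vs.scale_sum_left)
  finally show ?thesis .
qed

text \<open>For surjectivity the coefficients from \<open>highest_fun_span\<close> are multiplied by
  \<open>table_norm\<close> to cancel the normalisation. \<open>Dl_emb\<close> accepts them as they
  are, symmetric or not.\<close>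

lemma Dl_image: "Dl ` src.WV \<beta> = tgt.HWV \<alpha>"
proof (intro equalityI subsetI)
  fix y assume "y \<in> Dl ` src.WV \<beta>"
  then obtain x where x: "x \<in> src.WV \<beta>" "y = Dl x" by blast
  from x(1) obtain g where g: "\<forall>T. g T \<noteq> 0 \<longrightarrow> T \<in> tables_A \<beta>" "src.symmetric_fun m g" "x = src.emb m g"
    by (rule src.WV_emb)
  then show "y \<in> tgt.HWV \<alpha>" using x Dl_emb[OF g(1)] tgt.emb_HWV[OF tgt.highest_fun_form_comb] by simp
next
  fix y assume "y \<in> tgt.HWV \<alpha>"
  then obtain f where f: "tgt.highest_fun f" "y = tgt.emb m f" by (metis tgt.HWV_emb)
  from f(1) obtain k where k: "f = tgt.form_comb k" by (rule tgt.highest_fun_span)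
  let ?g = "\<lambda>T. if T \<in> tables_A \<beta> then k T * of_nat (table_norm T) else 0"
  have "tgt.form_comb (\<lambda>T. ?g T / of_nat (table_norm T)) = tgt.form_comb k"
    using table_norm_pos by (auto simp: tgt.form_comb_def fun_eq_iff intro!: sum.cong)
  then have "y = Dl (src.emb m ?g)" using Dl_emb[of ?g] f k by simp
  moreover have "src.emb m ?g \<in> src.WV \<beta>" by (rule src.emb_WV) (auto split: if_splits)
  ultimately show "y \<in> Dl ` src.WV \<beta>" by blast
qed

text \<open>Reindexing T gives the sign to the power e1 + d, which equals the power e2 by parity.
  This lets \<open>symmetric_fun_emb_zero\<close> be applied to images under the kernel.\<close>

lemma symmetric_fun_form_comb:
  assumes g: "src.symmetric_fun m g"
  shows "tgt.symmetric_fun m (tgt.form_comb g)"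
  unfolding tgt.symmetric_fun_def
proof (intro allI impI)
  fix \<sigma> X assume \<sigma>: "\<sigma> permutes {..<m}" and X: "X \<in> all_tables d n m"
  have sq: "complex_of_int (sign \<sigma>) ^ e1 * complex_of_int (sign \<sigma>) ^ d = complex_of_int (sign \<sigma>) ^ e2"
    using sign_power_cong[of "e1 + d" e2 \<sigma>] parity by (auto simp: power_add)
  have "tgt.form_comb g (permute_list \<sigma> X) = (\<Sum>T\<in>tables_A \<beta>. g T * table_form d T (permute_list \<sigma> X))"
    using X \<sigma> by (simp add: tgt.form_comb_def permute_all_tables)
  also have "\<dots> = (\<Sum>T\<in>tables_A \<beta>. g (permute_list \<sigma> T) * table_form d (permute_list \<sigma> T) (permute_list \<sigma> X))"
    by (rule sum_permute_list[OF \<sigma>, symmetric]) (auto simp: tgt.tables_A_beta_iff all_tables_length src.permute_tables_A[unfolded tgt.tables_A_beta_iff])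
  also have "\<dots> = (\<Sum>T\<in>tables_A \<beta>. of_int (sign \<sigma>) ^ e2 * (g T * table_form d T X))"
  proof (rule sum.cong)
    fix T assume T: "T \<in> tables_A \<beta>"
    then have "g (permute_list \<sigma> T) = of_int (sign \<sigma>) ^ e1 * g T"
      using g \<sigma> unfolding src.symmetric_fun_def tgt.tables_A_beta_iff by blast
    then have "g (permute_list \<sigma> T) * table_form d (permute_list \<sigma> T) (permute_list \<sigma> X) =
        (of_int (sign \<sigma>) ^ e1 * of_int (sign \<sigma>) ^ d) * (g T * table_form d T X)"
      using tgt.table_form_permute[OF T X \<sigma>] by (simp add: ac_simps)
    then show "g (permute_list \<sigma> T) * table_form d (permute_list \<sigma> T) (permute_list \<sigma> X) =
        of_int (sign \<sigma>) ^ e2 * (g T * table_form d T X)" by (simp only: sq)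
  qed simp
  finally show "tgt.form_comb g (permute_list \<sigma> X) = of_int (sign \<sigma>) ^ e2 * tgt.form_comb g X"
    using X by (simp add: tgt.form_comb_def sum_distrib_left)
qed

text \<open>
  Since \<open>table_form\<close> is symmetric up to a sign, \<open>g = src.form_comb k\<close> and \<open>tgt.form_comb (g / table_norm) = 0\<close> force
  \<open>\<Sum>\<^sub>T |g T|\<^sup>2 / table_norm T = 0\<close>.
\<close>

lemma Dl_kernel:
  assumes z: "z \<in> src.HWV \<beta>" "Dl z = 0"
  shows "z = 0"
proof -
  from z(1) obtain g where g: "src.highest_fun g" "src.symmetric_fun m g" "z = src.emb m g" by (rule src.HWV_emb)
  from g(1) obtain k where k: "g = src.form_comb k" by (rule src.highest_fun_span)
  have supp: "\<forall>T. g T \<noteq> 0 \<longrightarrow> T \<in> tables_A \<beta>" using g(1) by (simp add: src.highest_fun_def)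
  let ?h = "\<lambda>T. g T / of_nat (table_norm T)"
  \<comment> \<open>The division by \<open>table_norm\<close> keeps the symmetry, since the norm is
    constant on rearrangements of the columns.\<close>
  have "src.symmetric_fun m ?h"
    using g(2) unfolding src.symmetric_fun_def by (auto simp: table_norm_permute all_tables_length)
  then have "tgt.symmetric_fun m (tgt.form_comb ?h)" by (rule symmetric_fun_form_comb)
  moreover have "tgt.emb m (tgt.form_comb ?h) = 0" using Dl_emb[OF supp] z g by simp
  ultimately have zero: "tgt.form_comb ?h X = 0" if "X \<in> all_tables d n m" for X
    using tgt.symmetric_fun_emb_zero that by blast
  \<comment> \<open>The kernel is real, so conjugation falls on \<open>k\<close> alone; swapping its
    arguments then expresses g through the kernel that defines \<open>Dl\<close>.\<close>
  have gT: "cnj (g T) = tgt.dual_sign * (\<Sum>X\<in>tables_A \<alpha>. cnj (k X) * table_form d T X)" if T: "T \<in> tables_A \<beta>" for T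
  proof -
    have "T \<in> all_tables d n m" using T tgt.tables_A_beta_iff by blast
    then have "cnj (g T) = (\<Sum>X\<in>tables_A \<alpha>. cnj (k X) * table_form d X T)"
      unfolding k by (simp add: src.form_comb_def cnj_table_form)
    also have "\<dots> = (\<Sum>X\<in>tables_A \<alpha>. tgt.dual_sign * (cnj (k X) * table_form d T X))"
      using tgt.table_form_swap[OF T] by (intro sum.cong) (auto simp: ac_simps)
    finally show ?thesis by (simp add: sum_distrib_left)
  qed
  \<comment> \<open>The weighted squared norm of g becomes a pairing of the conjugate of
    \<open>k\<close> with the function representing \<open>Dl z\<close>, which is zero.\<close>
  have "(\<Sum>T\<in>tables_A \<beta>. ?h T * cnj (g T)) =
      tgt.dual_sign * (\<Sum>T\<in>tables_A \<beta>. \<Sum>X\<in>tables_A \<alpha>. cnj (k X) * (?h T * table_form d T X))"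
    unfolding sum_distrib_left
    by (intro sum.cong) (auto simp: gT sum_distrib_left ac_simps)
  also have "(\<Sum>T\<in>tables_A \<beta>. \<Sum>X\<in>tables_A \<alpha>. cnj (k X) * (?h T * table_form d T X)) =
      (\<Sum>X\<in>tables_A \<alpha>. cnj (k X) * tgt.form_comb ?h X)"
    by (subst sum.swap) (auto simp: tgt.form_comb_def tgt.tables_A_iff sum_distrib_left intro!: sum.cong)
  also have "\<dots> = 0" using zero by (intro sum.neutral) (auto simp: tgt.tables_A_iff)
  finally have sum0: "(\<Sum>T\<in>tables_A \<beta>. ?h T * cnj (g T)) = 0" by simp
  have sq: "?h T * cnj (g T) = complex_of_real ((cmod (g T))\<^sup>2 / real (table_norm T))" for T
  proof -
    have "?h T * cnj (g T) = (g T * cnj (g T)) / of_nat (table_norm T)" by simp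
    also have "g T * cnj (g T) = complex_of_real ((cmod (g T))\<^sup>2)" by (metis complex_norm_square)
    finally show ?thesis by simp
  qed
  have "complex_of_real (\<Sum>T\<in>tables_A \<beta>. (cmod (g T))\<^sup>2 / real (table_norm T)) = 0"
    using sum0 unfolding sq of_real_sum .
  then have "(\<Sum>T\<in>tables_A \<beta>. (cmod (g T))\<^sup>2 / real (table_norm T)) = 0" by (simp only: of_real_eq_0_iff)
  then have "(cmod (g T))\<^sup>2 / real (table_norm T) = 0" if "T \<in> tables_A \<beta>" for T
    using that by (subst (asm) sum_nonneg_eq_0_iff) auto
  then have "g T = 0" for T using supp table_norm_pos[of T] by force
  then show ?thesis by (simp add: g(3) src.emb_def)
qed

lemma Dl_linear_HWV: "linear_on (src.HWV \<beta>) Dl"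
  using Dl_linear by (auto simp: linear_on_def src.HWV_def)

lemma Dl_inj: "inj_on Dl (src.HWV \<beta>)"
  using Dl_kernel by (intro linear_on_inj_kernel[OF Dl_linear_HWV src.subspace_HWV])

lemma Dl_HWV_subset: "Dl ` src.HWV \<beta> \<subseteq> tgt.HWV \<alpha>"
  using Dl_image by (auto simp: src.HWV_def)

end

text \<open>\<open>Nb\<close> serves to supply an injection in the opposite direction; the two maps
  are not claimed to be inverse to each other.\<close>

lemma alg_pair_iso:
  assumes "alg_pair d n m \<alpha> \<beta> e1 key1 cf1 act1 V1 e2 key2 cf2 act2 V2 Dl"
    and "alg_pair d n m \<beta> \<alpha> e2 key2 cf2 act2 V2 e1 key1 cf1 act1 V1 Nb"
  shows "linear_iso_on Dl (table_alg.HWV d n act1 V1 \<beta>) (table_alg.HWV d n act2 V2 \<alpha>)"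
proof -
  interpret A: alg_pair d n m \<alpha> \<beta> e1 key1 cf1 act1 V1 e2 key2 cf2 act2 V2 Dl by (rule assms(1))
  interpret B: alg_pair d n m \<beta> \<alpha> e2 key2 cf2 act2 V2 e1 key1 cf1 act1 V1 Nb by (rule assms(2))
  have "Dl ` A.src.HWV \<beta> = A.tgt.HWV \<alpha>"
    by (rule mutual_linear_injections_surj[OF A.src.subspace_HWV A.tgt.subspace_HWV A.Dl_linear_HWV A.Dl_inj
          A.Dl_HWV_subset B.Dl_linear_HWV B.Dl_inj B.Dl_HWV_subset _ A.tgt.HWV_span]) simp
  then show ?thesis using A.Dl_linear_HWV A.Dl_inj by (simp add: linear_iso_on_def bij_betw_def)
qed

section \<open>The symmetric and the exterior algebra as instances of
  \<open>table_alg\<close>\<close>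

lemma all_tables_zero [simp]: "all_tables d n 0 = {[]}"
  by (auto simp: all_tables_def)

lemma sum_all_tables_Suc:
  "(\<Sum>Y\<in>all_tables d n (Suc m). f Y) = (\<Sum>j\<in>multi_idx d n. \<Sum>Y\<in>all_tables d n m. f (j # Y))"
  unfolding all_tables_def by (rule sum_lists_Suc)

lemma table_coef_Cons:
  "table_coef d u (j # Y) (i # X) = (\<Prod>k<d. (u ! k) $$ (j ! k - 1, i ! k - 1)) * table_coef d u Y X"
  by (simp add: table_coef_def prod.lessThan_Suc_shift del: prod.lessThan_Suc)

lemma sym_act_expand:
  "sym_act d n u (Poly_Mapping.single (mset X) 1) =
     (\<Sum>Y\<in>all_tables d n (length X). scale (table_coef d u Y X) (Poly_Mapping.single (mset Y) 1))"
proof (induction X)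
  case Nil
  show ?case unfolding sym_act_def lin_ext_single by (simp add: table_coef_def)
next
  case (Cons i X)
  let ?c = "\<lambda>j. \<Prod>k<d. (u ! k) $$ (j ! k - 1, i ! k - 1)"
  have "sym_act d n u (Poly_Mapping.single {#i#} 1) = (\<Sum>j\<in>multi_idx d n. Poly_Mapping.single {#j#} (?c j))"
    by (simp add: sym_act_def sym_incl_def act_basis_def)
  moreover have "Poly_Mapping.single (mset (i # X)) (1::complex) = Poly_Mapping.single {#i#} 1 * Poly_Mapping.single (mset X) 1"
    by (simp add: mult_single)
  ultimately have "sym_act d n u (Poly_Mapping.single (mset (i # X)) 1) =
      (\<Sum>j\<in>multi_idx d n. Poly_Mapping.single {#j#} (?c j)) *
      (\<Sum>Y\<in>all_tables d n (length X). scale (table_coef d u Y X) (Poly_Mapping.single (mset Y) 1))"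
    by (simp only: sym_act_mult Cons)
  also have "\<dots> = (\<Sum>j\<in>multi_idx d n. \<Sum>Y\<in>all_tables d n (length X).
      Poly_Mapping.single (mset (j # Y)) (?c j * table_coef d u Y X))"
    by (simp add: sum_product mult_single)
  finally show ?case by (simp add: sum_all_tables_Suc table_coef_Cons)
qed

lemma table_alg_sym: "table_alg d n 0 mset (\<lambda>_. 1) (sym_act d n) (sym_V d n)"
proof
  fix u m X assume "X \<in> all_tables d n m"
  then have "length X = m" by (rule all_tables_length)
  then show "sym_act d n u (Poly_Mapping.single (mset X) 1) =
      (\<Sum>Y\<in>all_tables d n m. scale (table_coef d u Y X) (Poly_Mapping.single (mset Y) 1))"
    using sym_act_expand[of d n u X] by simp
next
  fix x :: "nat list sym_alg"
  have "(\<exists>X. set X \<subseteq> multi_idx d n \<and> mset X = M \<and> (1::complex) \<noteq> 0) \<longleftrightarrow> set_mset M \<subseteq> multi_idx d n" for M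
    using ex_mset[of M] by (metis set_mset_mset zero_neq_one)
  then show "x \<in> sym_V d n \<longleftrightarrow> (\<forall>M\<in>Poly_Mapping.keys x. \<exists>X. set X \<subseteq> multi_idx d n \<and> mset X = M \<and> (1::complex) \<noteq> 0)"
    by (simp add: sym_V_def)
qed (simp_all add: sym_act_def)

definition ext_coef :: "nat list list \<Rightarrow> complex" where
  "ext_coef X = (if distinct X then of_int (lex_sign X) else 0)"

lemma ext_mon_Cons: "ext_mon (a # X) = wedge (Poly_Mapping.single {|a|} 1) (ext_mon X)"
  by (simp add: ext_mon_def wedge_list_Cons ext_incl_def)

text \<open>A new first column has to pass the smaller columns behind it; \<open>wedge_sign\<close>
  counts exactly these, and so does the recursion \<open>lex_sign_Cons\<close>.\<close>

lemma ext_mon_single: "ext_mon X = Poly_Mapping.single (fset_of_list X) (ext_coef X)"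
proof (induction X)
  case Nil
  show ?case by (simp add: ext_mon_def wedge_list_def ext_one_def ext_coef_def)
next
  case (Cons a X)
  have s: "Poly_Mapping.single (fset_of_list X) (ext_coef X) = scale (ext_coef X) (Poly_Mapping.single (fset_of_list X) 1)" by simp
  have "ext_mon (a # X) = Poly_Mapping.single (fset_of_list (a # X)) (ext_coef X * wedge_sign {|a|} (fset_of_list X))"
    unfolding ext_mon_Cons Cons s wedge_scale_right wedge_single by simp
  also have "ext_coef X * wedge_sign {|a|} (fset_of_list X) = ext_coef (a # X)"
  proof (cases "distinct (a # X)")
    case True
    have "length (filter (\<lambda>b. b < a) X) = card (set (filter (\<lambda>b. b < a) X))"
      using True by (simp add: distinct_card del: set_filter)
    also have "set (filter (\<lambda>b. b < a) X) = {b. b |\<in>| fset_of_list X \<and> b < a}" by (auto simp: fset_of_list_elem)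
    finally show ?thesis using True by (simp add: wedge_sign_singleton ext_coef_def lex_sign_Cons fset_of_list_elem)
  qed (auto simp: ext_coef_def wedge_sign_singleton fset_of_list_elem)
  finally show ?case .
qed

lemma wedge_sum_left: "wedge (\<Sum>i\<in>I. x i) y = (\<Sum>i\<in>I. wedge (x i) y)"
  by (simp add: wedge_def)

lemma wedge_sum_right: "wedge y (\<Sum>i\<in>I. x i) = (\<Sum>i\<in>I. wedge y (x i))"
  by (induction I rule: infinite_finite_induct) (auto simp: wedge_add_right)

lemma ext_act_expand:
  "ext_act d n u (ext_mon X) = (\<Sum>Y\<in>all_tables d n (length X). scale (table_coef d u Y X) (ext_mon Y))"
proof (induction X)
  case Nil
  show ?case by (simp add: ext_act_def table_coef_def ext_mon_def wedge_list_def ext_one_def sorted_list_of_fset.rep_eq)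
next
  case (Cons i X)
  let ?c = "\<lambda>j. \<Prod>k<d. (u ! k) $$ (j ! k - 1, i ! k - 1)"
  have "ext_act d n u (Poly_Mapping.single {|i|} 1) = ext_incl (act_basis d n u i)"
    by (simp add: ext_act_def sorted_list_of_fset.rep_eq wedge_list_def)
  also have "\<dots> = (\<Sum>j\<in>multi_idx d n. scale (?c j) (Poly_Mapping.single {|j|} 1))"
    by (simp add: ext_incl_def act_basis_def)
  finally have "ext_act d n u (ext_mon (i # X)) =
      wedge (\<Sum>j\<in>multi_idx d n. scale (?c j) (Poly_Mapping.single {|j|} 1))
        (\<Sum>Y\<in>all_tables d n (length X). scale (table_coef d u Y X) (ext_mon Y))"
    by (simp only: ext_mon_Cons ext_act_wedge Cons)
  also have "\<dots> = (\<Sum>j\<in>multi_idx d n. \<Sum>Y\<in>all_tables d n (length X). scale (?c j * table_coef d u Y X) (ext_mon (j # Y)))"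
    unfolding wedge_sum_left wedge_sum_right wedge_scale_left wedge_scale_right ext_mon_Cons[symmetric]
    by (simp add: free_vs.scale_sum_right, subst sum.swap, simp add: mult.commute)
  finally show ?case by (simp add: sum_all_tables_Suc table_coef_Cons)
qed

lemma table_alg_ext: "table_alg d n 1 fset_of_list ext_coef (ext_act d n) (ext_V d n)"
proof
  fix u m X assume "X \<in> all_tables d n m"
  then have "length X = m" by (rule all_tables_length)
  then show "ext_act d n u (Poly_Mapping.single (fset_of_list X) (ext_coef X)) =
      (\<Sum>Y\<in>all_tables d n m. scale (table_coef d u Y X) (Poly_Mapping.single (fset_of_list Y) (ext_coef Y)))"
    using ext_act_expand[of d n u X] by (simp only: ext_mon_single)
next
  fix X :: "nat list list"
  have "\<bar>lex_sign X\<bar> = 1" by simp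
  then show "ext_coef X = 0 \<or> ext_coef X = 1 \<or> ext_coef X = - 1" by (auto simp: ext_coef_def abs_if split: if_splits)
next
  fix \<sigma> and X :: "nat list list" assume \<sigma>: "\<sigma> permutes {..<length X}"
  then show "fset_of_list (permute_list \<sigma> X) = fset_of_list X"
    by (intro fset_eqI) (simp add: fset_of_list_elem)
  show "ext_coef (permute_list \<sigma> X) = of_int (sign \<sigma>) ^ 1 * ext_coef X"
    using \<sigma> by (simp add: ext_coef_def lex_sign_permute)
next
  fix X Y :: "nat list list" assume "fset_of_list X = fset_of_list Y" "ext_coef X \<noteq> 0" "ext_coef Y \<noteq> 0"
  then show "mset X = mset Y"
    by (metis ext_coef_def fset_of_list.rep_eq set_eq_iff_mset_eq_distinct)
next
  fix X :: "nat list list" assume z: "ext_coef X = 0"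
  have "lex_sign X \<noteq> 0" using abs_lex_sign[of X] by (metis abs_zero zero_neq_one)
  then have "\<not> distinct X" using z by (auto simp: ext_coef_def split: if_splits)
  then obtain i j where ij: "i < length X" "j < length X" "i \<noteq> j" "X ! i = X ! j" by (auto simp: distinct_conv_nth)
  \<comment> \<open>The exchange of two equal columns is odd and leaves the table unchanged.\<close>
  have p: "Transposition.transpose i j permutes {..<length X}" using ij by (intro permutes_swap_id) auto
  have "permute_list (Transposition.transpose i j) X = X"
    using ij p by (intro nth_equalityI) (auto simp: permute_list_nth transpose_def)
  then show "\<exists>\<sigma>. \<sigma> permutes {..<length X} \<and> permute_list \<sigma> X = X \<and> of_int (sign \<sigma>) ^ 1 = (- 1 :: complex)"
    using p ij by (intro exI[of _ "Transposition.transpose i j"]) (simp add: sign_swap_id)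
next
  fix x :: "nat list ext_alg"
  have "(\<exists>X. set X \<subseteq> multi_idx d n \<and> fset_of_list X = A \<and> ext_coef X \<noteq> 0) \<longleftrightarrow> fset A \<subseteq> multi_idx d n" for A
  proof
    assume "\<exists>X. set X \<subseteq> multi_idx d n \<and> fset_of_list X = A \<and> ext_coef X \<noteq> 0"
    then show "fset A \<subseteq> multi_idx d n" by (auto simp: fset_of_list_elem)
  next
    assume A: "fset A \<subseteq> multi_idx d n"
    let ?X = "sorted_list_of_fset A"
    have "set ?X = fset A" "distinct ?X" "sorted ?X" by (simp_all add: sorted_list_of_fset.rep_eq)
    moreover from this have "fset_of_list ?X = A" by (intro fset_eqI) (simp add: fset_of_list_elem)
    ultimately show "\<exists>X. set X \<subseteq> multi_idx d n \<and> fset_of_list X = A \<and> ext_coef X \<noteq> 0"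
      using A by (intro exI[of _ ?X]) (simp add: ext_coef_def lex_sign_sorted)
  qed
  then show "x \<in> ext_V d n \<longleftrightarrow> (\<forall>A\<in>Poly_Mapping.keys x. \<exists>X. set X \<subseteq> multi_idx d n \<and> fset_of_list X = A \<and> ext_coef X \<noteq> 0)"
    by (simp add: ext_V_def)
qed (simp_all add: ext_act_def)

section \<open>Conjugate partitions as zero-padded vectors\<close>

lemma length_filter_sorted:
  fixes l :: "nat list"
  assumes "sorted_wrt (\<ge>) l"
  shows "j < length (filter (\<lambda>a. i < a) l) \<longleftrightarrow> j < length l \<and> i < l ! j"
  using assms
proof (induction l arbitrary: j)
  case (Cons a l)
  show ?case
  proof (cases "i < a")
    case True
    then show ?thesis using Cons by (cases j) auto
  next
    case False
    then have small: "\<forall>b\<in>set (a # l). \<not> i < b" using Cons.prems by auto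
    then have "filter (\<lambda>a. i < a) (a # l) = []" by (simp only: filter_empty_conv)
    moreover have "\<not> i < (a # l) ! j" if "j < length (a # l)" using small nth_mem[OF that] by blast
    ultimately show ?thesis by auto
  qed
qed simp

text \<open>In a decreasing list the entries above i form an initial segment, so counting them
  compares positions with entries. From here on only the symmetric relation \<open>conj_pair\<close>
  is used, and exchanging the shapes needs no double conjugation.\<close>

lemma conj_pair_partition:
  assumes l: "is_partition m l" "length l \<le> n" "first_part l \<le> n"
  shows "conj_pair n m (part_vec n l) (part_vec n (conj_part l))"
proof -
  let ?\<alpha> = "part_vec n l" and ?\<beta> = "part_vec n (conj_part l)"
  have sorted: "sorted_wrt (\<ge>) l" using l by (simp add: is_partition_def)
  have le_first: "a \<le> first_part l" if "a \<in> set l" for a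
    using sorted that by (cases l) (auto simp: first_part_def)
  have len: "length (conj_part l) = first_part l" by (simp add: conj_part_def)
  have a: "?\<alpha> ! j = (if j < length l then l ! j else 0)" if "j < n" for j
    using that by (auto simp: part_vec_def nth_append)
  have b: "?\<beta> ! i = length (filter (\<lambda>a. i < a) l)" if "i < n" for i
  proof (cases "i < first_part l")
    case True
    have "(\<lambda>a. Suc i \<le> a) = (\<lambda>a. i < a)" by (auto simp: fun_eq_iff)
    moreover have "conj_part l ! i = length (filter (\<lambda>a. Suc i \<le> a) l)"
      using True by (simp add: conj_part_def del: upt_Suc)
    ultimately show ?thesis using True by (simp add: part_vec_def nth_append len)
  next
    case False
    then have "filter (\<lambda>a. i < a) l = []" using le_first by (force simp: filter_empty_conv)
    then show ?thesis using False that by (simp add: part_vec_def nth_append len)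
  qed
  \<comment> \<open>The bound on the first part is what gives the padded conjugate length exactly
    n.\<close>
  have lens: "length ?\<alpha> = n" "length ?\<beta> = n" using l by (auto simp: part_vec_def len)
  have conj: "j < ?\<beta> ! i \<longleftrightarrow> i < ?\<alpha> ! j" if "i < n" "j < n" for i j
    using that by (simp add: a b length_filter_sorted[OF sorted])
  have ale: "?\<alpha> ! i \<le> n" if "i < n" for i
    using a[OF that] le_first[of "l ! i"] l(3) by auto
  have ble: "?\<beta> ! i \<le> n" if "i < n" for i
    using b[OF that] l(2) length_filter_le[of "\<lambda>a. i < a" l] by linarith
  have sa: "sum_list ?\<alpha> = m" using l by (simp add: part_vec_def is_partition_def sum_list_replicate)
  \<comment> \<open>Writes each part as a sum of indicators, so that both totals count the cells of
    one diagram.\<close>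
  have count: "c = (\<Sum>j<n. if j < c then 1 else 0)" if "c \<le> n" for c :: nat
  proof -
    have "{j. j < n \<and> j < c} = {..<c}" using that by auto
    then show ?thesis by (simp add: sum.If_cases Int_def)
  qed
  have "sum_list ?\<beta> = (\<Sum>i<n. ?\<beta> ! i)" by (simp add: sum_list_sum_nth lens atLeast0LessThan)
  also have "\<dots> = (\<Sum>i<n. \<Sum>j<n. if j < ?\<beta> ! i then 1 else 0)"
    by (rule sum.cong[OF refl], rule count) (simp add: ble)
  also have "\<dots> = (\<Sum>j<n. \<Sum>i<n. if i < ?\<alpha> ! j then 1 else 0)"
    by (subst sum.swap) (simp add: conj)
  also have "\<dots> = (\<Sum>j<n. ?\<alpha> ! j)"
    by (rule sum.cong[OF refl], rule count[symmetric]) (simp add: ale)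
  also have "\<dots> = m" using sa by (simp add: sum_list_sum_nth lens atLeast0LessThan)
  finally show ?thesis using lens sa ale ble conj by unfold_locales auto
qed

section \<open>The four maps of the theorem\<close>

lemma WV_sym_eq: "table_alg.WV d n (sym_act d n) (sym_V d n) \<alpha> = WV_sym d n \<alpha>"
  and HWV_sym_eq: "table_alg.HWV d n (sym_act d n) (sym_V d n) \<alpha> = HWV_sym d n \<alpha>"
  and mon_sym_eq: "table_alg.mon mset (\<lambda>_. 1) X = sym_mon X"
  by (simp_all add: table_alg.WV_def[OF table_alg_sym] WV_sym_def table_alg.HWV_def[OF table_alg_sym] HWV_sym_def
      table_alg.mon_def[OF table_alg_sym] sym_mon_eq)

lemma WV_ext_eq: "table_alg.WV d n (ext_act d n) (ext_V d n) \<alpha> = WV_ext d n \<alpha>"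
  and HWV_ext_eq: "table_alg.HWV d n (ext_act d n) (ext_V d n) \<alpha> = HWV_ext d n \<alpha>"
  and mon_ext_eq: "table_alg.mon fset_of_list ext_coef X = ext_mon X"
  by (simp_all add: table_alg.WV_def[OF table_alg_ext] WV_ext_def table_alg.HWV_def[OF table_alg_ext] HWV_ext_def
      table_alg.mon_def[OF table_alg_ext] ext_mon_single)

lemma alg_pair_sym_sym:
  assumes ct: "conj_tables d n m \<alpha> \<beta>" and "even d" and lin: "linear_on (WV_sym d n \<beta>) Dl"
    and mon: "\<forall>T\<in>A_lex \<beta>. Dl (sym_mon T) = Delta_vec d n T"
  shows "alg_pair d n m \<alpha> \<beta> 0 mset (\<lambda>_. 1) (sym_act d n) (sym_V d n) 0 mset (\<lambda>_. 1) (sym_act d n) (sym_V d n) Dl"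
proof (intro alg_pair.intro alg_tables.intro alg_pair_axioms.intro ct conj_tables.conj_tables_swap[OF ct]
    table_alg_sym table_alg_sym)
  show "even (0 + 0 + d)" using assms(2) by simp
  show "linear_on (table_alg.WV d n (sym_act d n) (sym_V d n) \<beta>) Dl" using lin by (simp only: WV_sym_eq)
  fix T assume T: "T \<in> tables_A \<beta>" "sorted T" "(1::complex) \<noteq> 0"
  have "T \<in> A_lex \<beta>" using T by (auto simp: A_lex_def split: if_splits)
  moreover have "length T = m"
    using T(1) all_tables_length conj_tables.tables_A_beta_iff[OF ct] by blast
  ultimately show "Dl (table_alg.mon mset (\<lambda>_. 1) T) =
      scale (of_int (table_sign d T) / of_nat (table_norm T))
        (\<Sum>X\<in>all_tables d n m. scale (of_int (table_sgn d T X)) (table_alg.mon mset (\<lambda>_. 1) X))"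
    using mon by (simp only: mon_sym_eq mon_sym_eq Delta_vec_def)
qed

lemma alg_pair_ext_ext:
  assumes ct: "conj_tables d n m \<alpha> \<beta>" and "even d" and lin: "linear_on (WV_ext d n \<beta>) Dl"
    and mon: "\<forall>T\<in>B_lex \<beta>. Dl (ext_mon T) = Nabla_vec d n T"
  shows "alg_pair d n m \<alpha> \<beta> 1 fset_of_list ext_coef (ext_act d n) (ext_V d n) 1 fset_of_list ext_coef (ext_act d n) (ext_V d n) Dl"
proof (intro alg_pair.intro alg_tables.intro alg_pair_axioms.intro ct conj_tables.conj_tables_swap[OF ct]
    table_alg_ext table_alg_ext)
  show "even (1 + 1 + d)" using assms(2) by simp
  show "linear_on (table_alg.WV d n (ext_act d n) (ext_V d n) \<beta>) Dl" using lin by (simp only: WV_ext_eq)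
  fix T assume T: "T \<in> tables_A \<beta>" "sorted T" "ext_coef T \<noteq> 0"
  have "T \<in> B_lex \<beta>" using T by (auto simp: B_lex_def tables_B_def ext_coef_def split: if_splits)
  moreover have "length T = m"
    using T(1) all_tables_length conj_tables.tables_A_beta_iff[OF ct] by blast
  ultimately show "Dl (table_alg.mon fset_of_list ext_coef T) =
      scale (of_int (table_sign d T) / of_nat (table_norm T))
        (\<Sum>X\<in>all_tables d n m. scale (of_int (table_sgn d T X)) (table_alg.mon fset_of_list ext_coef X))"
    using mon by (simp only: mon_ext_eq mon_ext_eq Nabla_vec_def)
qed

lemma alg_pair_ext_sym:
  assumes ct: "conj_tables d n m \<alpha> \<beta>" and "odd d" and lin: "linear_on (WV_ext d n \<beta>) Dl"
    and mon: "\<forall>T\<in>B_lex \<beta>. Dl (ext_mon T) = Delta_vec d n T"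
  shows "alg_pair d n m \<alpha> \<beta> 1 fset_of_list ext_coef (ext_act d n) (ext_V d n) 0 mset (\<lambda>_. 1) (sym_act d n) (sym_V d n) Dl"
proof (intro alg_pair.intro alg_tables.intro alg_pair_axioms.intro ct conj_tables.conj_tables_swap[OF ct]
    table_alg_ext table_alg_sym)
  show "even (1 + 0 + d)" using assms(2) by simp
  show "linear_on (table_alg.WV d n (ext_act d n) (ext_V d n) \<beta>) Dl" using lin by (simp only: WV_ext_eq)
  fix T assume T: "T \<in> tables_A \<beta>" "sorted T" "ext_coef T \<noteq> 0"
  have "T \<in> B_lex \<beta>" using T by (auto simp: B_lex_def tables_B_def ext_coef_def split: if_splits)
  moreover have "length T = m"
    using T(1) all_tables_length conj_tables.tables_A_beta_iff[OF ct] by blast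
  ultimately show "Dl (table_alg.mon fset_of_list ext_coef T) =
      scale (of_int (table_sign d T) / of_nat (table_norm T))
        (\<Sum>X\<in>all_tables d n m. scale (of_int (table_sgn d T X)) (table_alg.mon mset (\<lambda>_. 1) X))"
    using mon by (simp only: mon_ext_eq mon_sym_eq Delta_vec_def)
qed

lemma alg_pair_sym_ext:
  assumes ct: "conj_tables d n m \<alpha> \<beta>" and "odd d" and lin: "linear_on (WV_sym d n \<beta>) Dl"
    and mon: "\<forall>T\<in>A_lex \<beta>. Dl (sym_mon T) = Nabla_vec d n T"
  shows "alg_pair d n m \<alpha> \<beta> 0 mset (\<lambda>_. 1) (sym_act d n) (sym_V d n) 1 fset_of_list ext_coef (ext_act d n) (ext_V d n) Dl"
proof (intro alg_pair.intro alg_tables.intro alg_pair_axioms.intro ct conj_tables.conj_tables_swap[OF ct]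
    table_alg_sym table_alg_ext)
  show "even (0 + 1 + d)" using assms(2) by simp
  show "linear_on (table_alg.WV d n (sym_act d n) (sym_V d n) \<beta>) Dl" using lin by (simp only: WV_sym_eq)
  fix T assume T: "T \<in> tables_A \<beta>" "sorted T" "(1::complex) \<noteq> 0"
  have "T \<in> A_lex \<beta>" using T by (auto simp: A_lex_def split: if_splits)
  moreover have "length T = m"
    using T(1) all_tables_length conj_tables.tables_A_beta_iff[OF ct] by blast
  ultimately show "Dl (table_alg.mon mset (\<lambda>_. 1) T) =
      scale (of_int (table_sign d T) / of_nat (table_norm T))
        (\<Sum>X\<in>all_tables d n m. scale (of_int (table_sgn d T X)) (table_alg.mon fset_of_list ext_coef X))"
    using mon by (simp only: mon_sym_eq mon_ext_eq Nabla_vec_def)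
qed

theorem mainTheorem2:
  fixes d n m :: nat and lam lamv conjv :: "nat list list"
  assumes "d \<ge> 1" and "n \<ge> 1"
    and "length lam = d"
    and "\<And>l. l \<in> set lam \<Longrightarrow> is_partition m l \<and> length l \<le> n \<and> first_part l \<le> n"
    and "lamv = map (part_vec n) lam"
    and "conjv = map (\<lambda>l. part_vec n (conj_part l)) lam"
  shows
    "(odd d \<longrightarrow>
       (\<forall>Dl Nb.
          linear_on (WV_ext d n conjv) Dl \<longrightarrow> (\<forall>T\<in>B_lex conjv. Dl (ext_mon T) = Delta_vec d n T) \<longrightarrow>
          linear_on (WV_sym d n conjv) Nb \<longrightarrow> (\<forall>S\<in>A_lex conjv. Nb (sym_mon S) = Nabla_vec d n S) \<longrightarrow>
          Dl ` WV_ext d n conjv = HWV_sym d n lamv \<and>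
          Nb ` WV_sym d n conjv = HWV_ext d n lamv \<and>
          linear_iso_on Dl (HWV_ext d n conjv) (HWV_sym d n lamv) \<and>
          linear_iso_on Nb (HWV_sym d n conjv) (HWV_ext d n lamv))) \<and>
     (even d \<longrightarrow>
       (\<forall>Dl Nb.
          linear_on (WV_sym d n conjv) Dl \<longrightarrow> (\<forall>S\<in>A_lex conjv. Dl (sym_mon S) = Delta_vec d n S) \<longrightarrow>
          linear_on (WV_ext d n conjv) Nb \<longrightarrow> (\<forall>T\<in>B_lex conjv. Nb (ext_mon T) = Nabla_vec d n T) \<longrightarrow>
          Dl ` WV_sym d n conjv = HWV_sym d n lamv \<and>
          Nb ` WV_ext d n conjv = HWV_ext d n lamv \<and>
          linear_iso_on Dl (HWV_sym d n conjv) (HWV_sym d n lamv) \<and>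
          linear_iso_on Nb (HWV_ext d n conjv) (HWV_ext d n lamv)))"
proof -
  have ct: "conj_tables d n m lamv conjv"
    using assms by (intro conj_tables.intro) (auto intro!: conj_pair_partition)
  have odd_case: "Dl ` WV_ext d n conjv = HWV_sym d n lamv \<and> Nb ` WV_sym d n conjv = HWV_ext d n lamv \<and>
      linear_iso_on Dl (HWV_ext d n conjv) (HWV_sym d n lamv) \<and> linear_iso_on Nb (HWV_sym d n conjv) (HWV_ext d n lamv)"
    if "odd d"
      and D: "linear_on (WV_ext d n conjv) Dl" "\<forall>T\<in>B_lex conjv. Dl (ext_mon T) = Delta_vec d n T"
      and N: "linear_on (WV_sym d n conjv) Nb" "\<forall>T\<in>A_lex conjv. Nb (sym_mon T) = Nabla_vec d n T"
    for Dl Nb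
  proof (intro conjI)
    have Dl: "alg_pair d n m lamv conjv 1 fset_of_list ext_coef (ext_act d n) (ext_V d n) 0 mset (\<lambda>_. 1) (sym_act d n) (sym_V d n) Dl"
      by (rule alg_pair_ext_sym[OF ct that(1) D(1) D(2)])
    \<comment> \<open>The given maps start at the conjugate weight only. The opposite injection
      comes from the map of the other kind with the shapes exchanged, which exists by linear
      extension.\<close>
    obtain FDl where "linear_on (WV_sym d n lamv) FDl" "\<forall>T\<in>A_lex lamv. FDl (sym_mon T) = Nabla_vec d n T"
      using linear_extension_sym[of "WV_sym d n lamv" lamv "Nabla_vec d n"] by blast
    then have Dlr: "alg_pair d n m conjv lamv 0 mset (\<lambda>_. 1) (sym_act d n) (sym_V d n) 1 fset_of_list ext_coef (ext_act d n) (ext_V d n) FDl"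
      by (rule alg_pair_sym_ext[OF conj_tables.conj_tables_swap[OF ct] that(1)])
    have Nb: "alg_pair d n m lamv conjv 0 mset (\<lambda>_. 1) (sym_act d n) (sym_V d n) 1 fset_of_list ext_coef (ext_act d n) (ext_V d n) Nb"
      by (rule alg_pair_sym_ext[OF ct that(1) N(1) N(2)])
    obtain FNb where "linear_on (WV_ext d n lamv) FNb" "\<forall>T\<in>B_lex lamv. FNb (ext_mon T) = Delta_vec d n T"
      using linear_extension_ext[of "WV_ext d n lamv" lamv "Delta_vec d n"] by blast
    then have Nbr: "alg_pair d n m conjv lamv 1 fset_of_list ext_coef (ext_act d n) (ext_V d n) 0 mset (\<lambda>_. 1) (sym_act d n) (sym_V d n) FNb"
      by (rule alg_pair_ext_sym[OF conj_tables.conj_tables_swap[OF ct] that(1)])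
    show "Dl ` WV_ext d n conjv = HWV_sym d n lamv"
      using alg_pair.Dl_image[OF Dl] by (simp only: WV_ext_eq HWV_sym_eq)
    show "Nb ` WV_sym d n conjv = HWV_ext d n lamv"
      using alg_pair.Dl_image[OF Nb] by (simp only: WV_sym_eq HWV_ext_eq)
    show "linear_iso_on Dl (HWV_ext d n conjv) (HWV_sym d n lamv)"
      using alg_pair_iso[OF Dl Dlr] by (simp only: HWV_ext_eq HWV_sym_eq)
    show "linear_iso_on Nb (HWV_sym d n conjv) (HWV_ext d n lamv)"
      using alg_pair_iso[OF Nb Nbr] by (simp only: HWV_sym_eq HWV_ext_eq)
  qed
  have even_case: "Dl ` WV_sym d n conjv = HWV_sym d n lamv \<and> Nb ` WV_ext d n conjv = HWV_ext d n lamv \<and>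
      linear_iso_on Dl (HWV_sym d n conjv) (HWV_sym d n lamv) \<and> linear_iso_on Nb (HWV_ext d n conjv) (HWV_ext d n lamv)"
    if "even d"
      and D: "linear_on (WV_sym d n conjv) Dl" "\<forall>T\<in>A_lex conjv. Dl (sym_mon T) = Delta_vec d n T"
      and N: "linear_on (WV_ext d n conjv) Nb" "\<forall>T\<in>B_lex conjv. Nb (ext_mon T) = Nabla_vec d n T"
    for Dl Nb
  proof (intro conjI)
    have Dl: "alg_pair d n m lamv conjv 0 mset (\<lambda>_. 1) (sym_act d n) (sym_V d n) 0 mset (\<lambda>_. 1) (sym_act d n) (sym_V d n) Dl"
      by (rule alg_pair_sym_sym[OF ct that(1) D(1) D(2)])
    \<comment> \<open>For even d the map back stays in the same algebra, so it is of the same kind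
      with the shapes exchanged.\<close>
    obtain FDl where "linear_on (WV_sym d n lamv) FDl" "\<forall>T\<in>A_lex lamv. FDl (sym_mon T) = Delta_vec d n T"
      using linear_extension_sym[of "WV_sym d n lamv" lamv "Delta_vec d n"] by blast
    then have Dlr: "alg_pair d n m conjv lamv 0 mset (\<lambda>_. 1) (sym_act d n) (sym_V d n) 0 mset (\<lambda>_. 1) (sym_act d n) (sym_V d n) FDl"
      by (rule alg_pair_sym_sym[OF conj_tables.conj_tables_swap[OF ct] that(1)])
    have Nb: "alg_pair d n m lamv conjv 1 fset_of_list ext_coef (ext_act d n) (ext_V d n) 1 fset_of_list ext_coef (ext_act d n) (ext_V d n) Nb"
      by (rule alg_pair_ext_ext[OF ct that(1) N(1) N(2)])
    obtain FNb where "linear_on (WV_ext d n lamv) FNb" "\<forall>T\<in>B_lex lamv. FNb (ext_mon T) = Nabla_vec d n T"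
      using linear_extension_ext[of "WV_ext d n lamv" lamv "Nabla_vec d n"] by blast
    then have Nbr: "alg_pair d n m conjv lamv 1 fset_of_list ext_coef (ext_act d n) (ext_V d n) 1 fset_of_list ext_coef (ext_act d n) (ext_V d n) FNb"
      by (rule alg_pair_ext_ext[OF conj_tables.conj_tables_swap[OF ct] that(1)])
    show "Dl ` WV_sym d n conjv = HWV_sym d n lamv"
      using alg_pair.Dl_image[OF Dl] by (simp only: WV_sym_eq HWV_sym_eq)
    show "Nb ` WV_ext d n conjv = HWV_ext d n lamv"
      using alg_pair.Dl_image[OF Nb] by (simp only: WV_ext_eq HWV_ext_eq)
    show "linear_iso_on Dl (HWV_sym d n conjv) (HWV_sym d n lamv)"
      using alg_pair_iso[OF Dl Dlr] by (simp only: HWV_sym_eq HWV_sym_eq)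
    show "linear_iso_on Nb (HWV_ext d n conjv) (HWV_ext d n lamv)"
      using alg_pair_iso[OF Nb Nbr] by (simp only: HWV_ext_eq HWV_ext_eq)
  qed
  show ?thesis using odd_case even_case by blast
qed

end
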